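(* Let $A\in\mathbb{C}^{n\times n}$ be such that its Kippenhahn polynomial $f_A$ is not a power of a linear form, and let $1\le k\le n$. If $a+ib$ (with $a,b\in\mathbb{R}$) belongs to the boundary $\partial\Lambda_k(A)$ of the rank-$k$ numerical range of $A$ in $\mathbb{C}$, then $g_A(a,b)=0$.
   Context: For $A\in\mathbb{C}^{n\times n}$ put $\Re(A)=\frac12(A+A^* )$, $\Im(A)=\frac{1}{2i}(A-A^* )$, and let $f_A=\det(tI_n+x\Re(A)+y\Im(A))\in\mathbb{R}[t,x,y]$ be the Kippenhahn polynomial. The rank-$k$ numerical range is $\Lambda_k(A)=\{\mu\in\mathbb{C}: \exists X\in\mathbb{C}^{n\times k} \text{ with } X^*X=I_k,\ X^*AX=\mu I_k\}$. Definition of $g_A$ (for $f_A$ not a power of a linear form): let $f=f_A^{\rm red}$ be the square-free part of $f_A$, i.e. the product of its distinct irreducible factors. Let $I\subset\mathbb{R}[t,x,y,a,b]$ be the ideal generated by $f$, $t+ax+by$, and the $2\times2$ minors of $\begin{pmatrix}1&a&b\\ \partial f/\partial t&\partial f/\partial x&\partial f/\partial y\end{pmatrix}$. Let $J\subset\mathbb{R}[a,b]$ be the radical of $(I:\langle t,x,y\rangle^\infty)\cap\mathbb{R}[a,b]$. The ideal $J$ is principal, and $g_A\in\mathbb{R}[a,b]$ denotes a generator of $J$ (unique up to nonzero scalar). The zero set of $g_A$ in $\mathbb{C}^2$ is the union of the set of $(a,b)$ for which the line $t+ax+by=0$ is tangent to the curve $\{f_A=0\}\subset\mathbb{P}^2(\mathbb{C})$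 at some nonsingular point, and of the lines $\{p_0+p_1a+p_2b=0\}$ for all singular points $[p_0:p_1:p_2]\in\mathbb{P}^2(\mathbb{C})$ of the curve $\{f=0\}$ (points where $f$ and $\nabla f$ vanish). *)

theory Defs
  imports
    "HOL-Analysis.Elementary_Topology"
    "HOL-Computational_Algebra.Field_as_Ring"
    "HOL-Computational_Algebra.Polynomial_Factorial"
    "Jordan_Normal_Form.Determinant"
    "Jordan_Normal_Form.Schur_Decomposition"
begin

section \<open>Polynomials in three variables\<close>

text \<open>
  The ring \<open>R[t,x,y]\<close> is represented as \<open>R[y][x][t]\<close>: the outermost variable is \<open>t\<close>, the
  innermost one is \<open>y\<close>. Likewise \<open>\<real>[a,b]\<close> is represented as \<open>\<real>[b][a]\<close>, and
  \<open>\<real>[t,x,y,a,b]\<close> as \<open>\<real>[a,b][t,x,y]\<close>.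
\<close>

type_synonym 'r poly3 = "'r poly poly poly"
type_synonym poly_ab = "real poly poly"

definition const3 :: "'r::comm_ring_1 \<Rightarrow> 'r poly3" where
  "const3 c = [:[:[:c:]:]:]"

definition var_t :: "'r::comm_ring_1 poly3" where
  "var_t = [:0, 1:]"

definition var_x :: "'r::comm_ring_1 poly3" where
  "var_x = [:[:0, 1:]:]"

definition var_y :: "'r::comm_ring_1 poly3" where
  "var_y = [:[:[:0, 1:]:]:]"

definition var_a :: poly_ab where
  "var_a = [:0, 1:]"

definition var_b :: poly_ab where
  "var_b = [:[:0, 1:]:]"

definition eval_ab :: "poly_ab \<Rightarrow> real \<Rightarrow> real \<Rightarrow> real" where
  "eval_ab g a b = poly (poly g [:a:]) b"

definition map_poly3 :: "('r::zero \<Rightarrow> 's::zero) \<Rightarrow> 'r poly3 \<Rightarrow> 's poly3" where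
  "map_poly3 h = map_poly (map_poly (map_poly h))"

definition deriv_t :: "'r::idom poly3 \<Rightarrow> 'r poly3" where
  "deriv_t f = pderiv f"

definition deriv_x :: "'r::idom poly3 \<Rightarrow> 'r poly3" where
  "deriv_x f = map_poly pderiv f"

definition deriv_y :: "'r::idom poly3 \<Rightarrow> 'r poly3" where
  "deriv_y f = map_poly (map_poly pderiv) f"

definition linear_form :: "'r::comm_ring_1 poly3 \<Rightarrow> bool" where
  "linear_form l \<longleftrightarrow>
     (\<exists>c0 c1 c2. l = const3 c0 * var_t + const3 c1 * var_x + const3 c2 * var_y)"

definition power_of_linear_form :: "'r::comm_ring_1 poly3 \<Rightarrow> bool" where
  "power_of_linear_form f \<longleftrightarrow> (\<exists>l m. linear_form l \<and> f = l ^ m)"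

text \<open>
  The elements of \<^const>\<open>prime_factors\<close> are normalized representatives, one for each class of
  associated irreducible factors; so the result is determined up to a nonzero constant factor.
\<close>

definition squarefree_red :: "real poly3 \<Rightarrow> real poly3" where
  "squarefree_red f = \<Prod>(prime_factors f)"


section \<open>Ideals\<close>

lemma module_times: "Modules.module ((*) :: 'r::comm_ring_1 \<Rightarrow> 'r \<Rightarrow> 'r)"
  by unfold_locales (simp_all add: algebra_simps)

definition ideal_gen :: "'r::comm_ring_1 set \<Rightarrow> 'r set" where
  "ideal_gen S = Modules.module.span (*) S"

primrec ideal_pow :: "'r::comm_ring_1 set \<Rightarrow> nat \<Rightarrow> 'r set" where
  "ideal_pow I 0 = UNIV"
| "ideal_pow I (Suc N) = ideal_gen {p * q | p q. p \<in> I \<and> q \<in> ideal_pow I N}"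

definition ideal_colon :: "'r::comm_ring_1 set \<Rightarrow> 'r set \<Rightarrow> 'r set" where
  "ideal_colon I K = {p. \<forall>q\<in>K. p * q \<in> I}"

definition ideal_saturation :: "'r::comm_ring_1 set \<Rightarrow> 'r set \<Rightarrow> 'r set" where
  "ideal_saturation I K = (\<Union>N. ideal_colon I (ideal_pow K N))"

definition ideal_radical :: "'r::comm_ring_1 set \<Rightarrow> 'r set" where
  "ideal_radical I = {p. \<exists>N. p ^ N \<in> I}"


section \<open>The Kippenhahn polynomial and the rank-k numerical range\<close>

definition re_mat :: "complex mat \<Rightarrow> complex mat" where
  "re_mat A = (1 / 2) \<cdot>\<^sub>m (A + mat_adjoint A)"

definition im_mat :: "complex mat \<Rightarrow> complex mat" where
  "im_mat A = (1 / (2 * \<i>)) \<cdot>\<^sub>m (A - mat_adjoint A)"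

definition kippenhahn_complex :: "complex mat \<Rightarrow> complex poly3" where
  "kippenhahn_complex A =
     det (var_t \<cdot>\<^sub>m 1\<^sub>m (dim_row A) + var_x \<cdot>\<^sub>m map_mat const3 (re_mat A)
          + var_y \<cdot>\<^sub>m map_mat const3 (im_mat A))"

text \<open>
  The coefficients of the determinant are real, so taking their real parts merely changes the
  coefficient ring; see lemma \<open>of_real_kippenhahn\<close> below.
\<close>

definition kippenhahn :: "complex mat \<Rightarrow> real poly3" where
  "kippenhahn A = map_poly3 Re (kippenhahn_complex A)"

definition rank_numerical_range :: "nat \<Rightarrow> complex mat \<Rightarrow> complex set" where
  "rank_numerical_range k A =
     {\<mu>. \<exists>X \<in> carrier_mat (dim_row A) k.
          mat_adjoint X * X = 1\<^sub>m k \<and> mat_adjoint X * A * X = \<mu> \<cdot>\<^sub>m 1\<^sub>m k}"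

lemma mat_adjoint_index:
  assumes "A \<in> carrier_mat n n" "i < n" "j < n"
  shows "mat_adjoint A $$ (i, j) = conjugate (A $$ (j, i))"
  using assms by (auto simp: mat_adjoint_def mat_of_rows_def)

lemma comm_ring_hom_map_poly:
  assumes "comm_ring_hom h" shows "comm_ring_hom (map_poly h)"
proof -
  interpret h: comm_ring_hom h by fact
  interpret map_h: map_poly_comm_ring_hom h ..
  show ?thesis by unfold_locales
qed

lemma of_real_kippenhahn:
  assumes A: "A \<in> carrier_mat n n"
  shows "map_poly3 complex_of_real (kippenhahn A) = kippenhahn_complex A"
proof -
  let ?M = "var_t \<cdot>\<^sub>m 1\<^sub>m (dim_row A) + var_x \<cdot>\<^sub>m map_mat const3 (re_mat A)
          + var_y \<cdot>\<^sub>m map_mat const3 (im_mat A)"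
  have adj: "mat_adjoint A \<in> carrier_mat n n" using A by (auto simp: mat_adjoint_def)
  have M: "?M \<in> carrier_mat n n" using A adj by (auto simp: re_mat_def im_mat_def)
  have c: "comm_ring_hom cnj" by unfold_locales auto
  have "comm_ring_hom (map_poly3 cnj)"
    unfolding map_poly3_def by (intro comm_ring_hom_map_poly c)
  then interpret h: comm_ring_hom "map_poly3 cnj" .
  have v: "map_poly3 cnj var_t = var_t" "map_poly3 cnj var_x = var_x" "map_poly3 cnj var_y = var_y"
    "\<And>z. map_poly3 cnj (const3 z) = const3 (cnj z)"
    by (auto simp: map_poly3_def var_t_def var_x_def var_y_def const3_def poly_eq_iff
        coeff_map_poly coeff_pCons split: nat.split)
  have re: "cnj (re_mat A $$ (i, j)) = re_mat A $$ (j, i)"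
    and im: "cnj (im_mat A $$ (i, j)) = im_mat A $$ (j, i)" if "i < n" "j < n" for i j
    using A adj that mat_adjoint_index[OF A]
    by (auto simp: re_mat_def im_mat_def field_simps)
  have dim: "re_mat A \<in> carrier_mat n n" "im_mat A \<in> carrier_mat n n"
    using A adj by (auto simp: re_mat_def im_mat_def)
  have "map_mat (map_poly3 cnj) ?M = transpose_mat ?M"
  proof (rule eq_matI)
    fix i j assume "i < dim_row (transpose_mat ?M)" "j < dim_col (transpose_mat ?M)"
    then have ij: "i < n" "j < n" using M by auto
    have one: "map_poly3 cnj (var_t * (if i = j then 1 else 0)) = var_t * (if j = i then 1 else 0)"
      by (simp add: v)
    show "map_mat (map_poly3 cnj) ?M $$ (i, j) = transpose_mat ?M $$ (i, j)"
      using ij A dim re im one by (simp add: h.hom_add h.hom_mult v)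
  qed (use dim in auto)
  then have "map_poly3 cnj (kippenhahn_complex A) = kippenhahn_complex A"
    using det_transpose[OF M] by (simp add: kippenhahn_complex_def h.hom_det[symmetric])
  then have "cnj (coeff (coeff (coeff (kippenhahn_complex A) i) j) l)
      = coeff (coeff (coeff (kippenhahn_complex A) i) j) l" for i j l
    by (simp add: map_poly3_def poly_eq_iff coeff_map_poly)
  then show ?thesis
    by (auto simp: kippenhahn_def map_poly3_def poly_eq_iff coeff_map_poly complex_eq_iff)
qed


section \<open>The polynomial g\<close>

text \<open>
  Below, \<open>F\<close> denotes the square-free part of the Kippenhahn polynomial, with its coefficients
  viewed as constants in \<open>\<real>[a,b]\<close>.
\<close>

definition incidence_ideal :: "complex mat \<Rightarrow> poly_ab poly3 set" where
  "incidence_ideal A =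
     (let F = map_poly3 (\<lambda>c. [:[:c:]:]) (squarefree_red (kippenhahn A));
          a = const3 var_a; b = const3 var_b
      in ideal_gen {F,
                    var_t + a * var_x + b * var_y,
                    deriv_x F - a * deriv_t F,
                    deriv_y F - b * deriv_t F,
                    a * deriv_y F - b * deriv_x F})"

definition dual_ideal :: "complex mat \<Rightarrow> poly_ab set" where
  "dual_ideal A =
     ideal_radical {g. const3 g \<in>
       ideal_saturation (incidence_ideal A) (ideal_gen {var_t, var_x, var_y})}"

text \<open>The polynomial \<open>g\<^sub>A\<close> is determined only up to a nonzero constant factor.\<close>

definition is_g_poly :: "complex mat \<Rightarrow> poly_ab \<Rightarrow> bool" where
  "is_g_poly A g \<longleftrightarrow> ideal_gen {g} = dual_ideal A"

end

theory Submission
  imports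
    Defs
    "HOL-Computational_Algebra.Fundamental_Theorem_Algebra"
    "HOL-Library.Function_Algebras"
    "HOL-Analysis.Elementary_Metric_Spaces"
begin

text \<open>
  Let \<open>L z\<close> be the \<open>k\<close>-th largest eigenvalue of \<open>Re z \<cdot> \<Re>(A) + Im z \<cdot> \<Im>(A)\<close>. By Li and Sze,
  \<open>\<mu>\<close> lies in the rank-\<open>k\<close> numerical range if and only if the real inner product of \<open>\<mu>\<close> and \<open>z\<close> is at
  most \<open>L z\<close> for all \<open>z\<close>. Hence for a boundary point \<open>\<mu>\<close> either equality holds for some \<open>z\<^sub>0 \<noteq> 0\<close>,
  or the Kippenhahn polynomial vanishes on the whole line dual to \<open>\<mu>\<close>. In the first case that line
  meets the curve at the point \<open>(- L z\<^sub>0, Re z\<^sub>0, Im z\<^sub>0)\<close>, and if it were transversal to the curve there, \<open>L z\<close>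
  minus the inner product would be strictly monotone, hence change sign, near \<open>z\<^sub>0\<close>. So in both cases
  the square-free part of the Kippenhahn polynomial has no derivative along the line at a real point
  of the curve, that is, the incidence equations have a solution over \<open>(Re \<mu>, Im \<mu>)\<close> with nonzero
  point coordinates; such solutions are zeros of every element of the dual ideal.

  Of the theorem of Li and Sze only the strict form is needed: if all forms \<open>x h + y g\<close>, except
  \<open>0\<close>, are positive definite on subspaces of dimension \<open>k\<close>, then \<open>h\<close> and \<open>g\<close> have a common isotropic
  subspace of dimension \<open>k\<close>.
\<close>

section \<open>Hermitian forms\<close>

text \<open>The two forms are \<open>Re(A) - a I\<close> and \<open>Im(A) - b I\<close>; an
  orthonormal basis of a common isotropic subspace of dimension \<open>k\<close> is exactly a matrix
  \<open>X\<close> compressing \<open>A\<close> to a scalar. The obstacle is that both forms are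
  indefinite, so their pencil may have nonreal eigenvalues or nontrivial Jordan blocks. Every such
  defect produces an eigenvector isotropic for both forms; it is a vector of the desired subspace
  and lowers \<open>k\<close> and the dimension together. In the remaining diagonal case only the
  signs of the diagonal entries and the order of the eigenvalues matter. Choosing as base direction
  a generic one with the fewest positive entries, and comparing it with all other generic
  directions, forces the positive eigenvalues to interlace with the negative ones, while at least
  \<open>k\<close> positive ones remain. Strictness is also what makes the condition stable: by
  homogeneity it is uniform on the unit circle, hence open in \<open>mu\<close>. At a contact point
  \<open>L\<close> need not be differentiable, since eigenvalues may cross; the argument therefore
  uses only continuity of \<open>L\<close> and derivatives of the polynomial.\<close>

locale complex_vs = vector_space scale for scale :: "complex \<Rightarrow> 'v::ab_group_add \<Rightarrow> 'v" (infixr "*s" 75)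
begin

definition hermitian_form :: "('v \<Rightarrow> 'v \<Rightarrow> complex) \<Rightarrow> bool" where
  "hermitian_form h \<longleftrightarrow> (\<forall>x y z. h x (y + z) = h x y + h x z) \<and>
     (\<forall>x c y. h x (c *s y) = c * h x y) \<and> (\<forall>x y. h y x = cnj (h x y))"

definition nondegenerate_on :: "('v \<Rightarrow> 'v \<Rightarrow> complex) \<Rightarrow> 'v set \<Rightarrow> bool" where
  "nondegenerate_on h V \<longleftrightarrow> (\<forall>x\<in>V. (\<forall>y\<in>V. h y x = 0) \<longrightarrow> x = 0)"

text \<open>Only an upper bound is required, as an induction measure and as a source of finite
  bases. Phrased with independent sets, it drops to a proper subspace by inserting a single
  vector.\<close>

definition dim_at_most :: "nat \<Rightarrow> 'v set \<Rightarrow> bool" where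
  "dim_at_most d V \<longleftrightarrow> (\<forall>B\<subseteq>V. independent B \<longrightarrow> finite B \<and> card B \<le> d)"

text \<open>Positivity has to be demanded on the whole span, whereas \<open>isotropic_rank\<close>
  below tests basis vectors: sesquilinearity spreads zeros from a basis to its span, but not
  signs.\<close>

definition positive_rank :: "nat \<Rightarrow> 'v set \<Rightarrow> ('v \<Rightarrow> 'v \<Rightarrow> complex) \<Rightarrow> bool" where
  "positive_rank k V h \<longleftrightarrow> (\<exists>B\<subseteq>V. independent B \<and> finite B \<and> card B = k \<and>
     (\<forall>x\<in>span B. x \<noteq> 0 \<longrightarrow> 0 < Re (h x x)))"

definition isotropic_rank ::
    "nat \<Rightarrow> 'v set \<Rightarrow> ('v \<Rightarrow> 'v \<Rightarrow> complex) \<Rightarrow> ('v \<Rightarrow> 'v \<Rightarrow> complex) \<Rightarrow> bool" where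
  "isotropic_rank k V h g \<longleftrightarrow> (\<exists>B\<subseteq>V. independent B \<and> finite B \<and> card B = k \<and>
     (\<forall>x\<in>B. \<forall>y\<in>B. h x y = 0 \<and> g x y = 0))"

definition pencil :: "('v \<Rightarrow> 'v \<Rightarrow> complex) \<Rightarrow> ('v \<Rightarrow> 'v \<Rightarrow> complex) \<Rightarrow> real \<Rightarrow> real \<Rightarrow> 'v \<Rightarrow> 'v \<Rightarrow> complex"
  where "pencil h g x y v w = of_real x * h v w + of_real y * g v w"

section \<open>Sesquilinear algebra of one Hermitian form\<close>

context
  fixes h assumes h: "hermitian_form h"
begin

lemma form_add_right: "h x (y + z) = h x y + h x z"
  using h unfolding hermitian_form_def by blast

lemma form_scale_right: "h x (c *s y) = c * h x y"
  using h unfolding hermitian_form_def by blast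

lemma form_cnj: "cnj (h x y) = h y x"
  using h unfolding hermitian_form_def by metis

lemma form_add_left: "h (y + z) x = h y x + h z x"
  using form_cnj[of x "y + z"] form_add_right[of x y z] form_cnj[of x y] form_cnj[of x z] by simp

lemma form_scale_left: "h (c *s y) x = cnj c * h y x"
  using form_cnj[of x "c *s y"] form_scale_right[of x c y] form_cnj[of x y] by simp

lemma form_zero_right: "h x 0 = 0"
  using form_scale_right[of x 0 0] by simp

lemma form_zero_left: "h 0 x = 0"
  using form_scale_left[of 0 0 x] by simp

lemma form_minus_right: "h x (- y) = - h x y"
  using form_scale_right[of x "-1" y] by simp

lemma form_minus_left: "h (- y) x = - h y x"
  using form_scale_left[of "-1" y x] by simp

lemma form_diff_right: "h x (y - z) = h x y - h x z"
  using form_add_right[of x y "- z"] form_minus_right[of x z] by simp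

lemma form_diff_left: "h (y - z) x = h y x - h z x"
  using form_add_left[of y "- z" x] form_minus_left[of z x] by simp

lemma form_sum_right: "h x (sum f S) = (\<Sum>i\<in>S. h x (f i))"
  by (induction S rule: infinite_finite_induct) (simp_all add: form_zero_right form_add_right)

lemma form_sum_left: "h (sum f S) x = (\<Sum>i\<in>S. h (f i) x)"
  by (induction S rule: infinite_finite_induct) (simp_all add: form_zero_left form_add_left)

lemma form_self_real: "h x x = of_real (Re (h x x))"
  using form_cnj[of x x] by (metis Reals_cnj_iff of_real_Re)

lemmas form_simps = form_add_right form_scale_right form_add_left form_scale_left form_zero_right
  form_zero_left form_minus_right form_minus_left form_diff_right form_diff_left

lemma subspace_orthogonal: "subspace V \<Longrightarrow> subspace {w \<in> V. h v w = 0}"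
  by (auto simp: subspace_def form_simps)

lemma form_span_right_zero: "y \<in> span B \<Longrightarrow> (\<And>b. b \<in> B \<Longrightarrow> h x b = 0) \<Longrightarrow> h x y = 0"
proof (induction rule: span_induct_alt)
  case base then show ?case by (simp add: form_simps)
next
  case (step c b y) then show ?case by (simp add: form_simps)
qed

lemma form_span_zero:
  "x \<in> span B \<Longrightarrow> y \<in> span C \<Longrightarrow> (\<And>b c. b \<in> B \<Longrightarrow> c \<in> C \<Longrightarrow> h b c = 0) \<Longrightarrow> h x y = 0"
proof -
  assume x: "x \<in> span B" and y: "y \<in> span C" and 0: "\<And>b c. b \<in> B \<Longrightarrow> c \<in> C \<Longrightarrow> h b c = 0"
  have "h b y = 0" if "b \<in> B" for b using form_span_right_zero[OF y] 0 that by blast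
  then have "h y b = 0" if "b \<in> B" for b using that form_cnj by (metis complex_cnj_zero)
  then have "h y x = 0" using form_span_right_zero[OF x] by blast
  then show "h x y = 0" using form_cnj by (metis complex_cnj_zero)
qed

end

lemma hermitian_pencil:
  "hermitian_form h \<Longrightarrow> hermitian_form g \<Longrightarrow> hermitian_form (pencil h g x y)"
  unfolding hermitian_form_def[of "pencil h g x y"]
  by (simp add: pencil_def form_add_right form_scale_right form_cnj algebra_simps)

section \<open>Bounded dimension and eigenvectors of a pair of forms\<close>

lemma dim_at_most_basis:
  assumes "subspace V" "dim_at_most d V"
  obtains B where "B \<subseteq> V" "independent B" "finite B" "span B = V"
proof -
  obtain B where B: "B \<subseteq> V" "independent B" "V \<subseteq> span B"
    using maximal_independent_subset[of V] by blast
  have "span B = V" using span_subspace[OF B(1,3) assms(1)] .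
  moreover have "finite B" using assms(2) B unfolding dim_at_most_def by blast
  ultimately show ?thesis using that B by blast
qed

text \<open>A vector of \<open>V\<close> outside \<open>V'\<close> extends every independent subset
  of \<open>V'\<close> by one element.\<close>

lemma dim_at_most_less:
  assumes V: "subspace V'" and d: "dim_at_most (Suc d) V" and sub: "V' \<subseteq> V" and v: "v \<in> V" "v \<notin> V'"
  shows "dim_at_most d V'"
  unfolding dim_at_most_def
proof (intro allI impI)
  fix B assume B: "B \<subseteq> V'" "independent B"
  have vB: "v \<notin> span B" using span_minimal[OF B(1) V] v by blast
  then have "independent (insert v B)" using independent_insertI B by blast
  then have "finite (insert v B) \<and> card (insert v B) \<le> Suc d"
    using d B sub v unfolding dim_at_most_def by blast
  moreover have "v \<notin> B" using vB span_base by blast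
  ultimately show "finite B \<and> card B \<le> d" by auto
qed

lemma dim_at_most_span:
  assumes "finite S" "V \<subseteq> span S" shows "dim_at_most (card S) V"
  using assms independent_span_bound unfolding dim_at_most_def by (meson order_trans)

text \<open>In a basis of \<open>V\<close> nondegeneracy makes the Gram matrix of \<open>h\<close>
  invertible; its inverse times the Gram matrix of \<open>g\<close> has a complex eigenvector. The
  eigenvalue \<open>c\<close> may be nonreal because \<open>h\<close> may be indefinite.\<close>

lemma eigenvector_exists:
  assumes h: "hermitian_form h" and g: "hermitian_form g" and V: "subspace V" "dim_at_most d V"
    and nd: "nondegenerate_on h V" and v0: "v0 \<in> V" "v0 \<noteq> 0"
  obtains c v where "v \<in> V" "v \<noteq> 0" "\<And>w. w \<in> V \<Longrightarrow> g w v = c * h w v"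
proof -
  obtain B where B: "B \<subseteq> V" "independent B" "finite B" "span B = V"
    using dim_at_most_basis[OF V] .
  obtain bs where bs: "set bs = B" "distinct bs" using finite_distinct_list[OF B(3)] by blast
  define m where "m = length bs"
  have "B \<noteq> {}" using B(4) v0 by auto
  then have m: "m > 0" using bs m_def by auto
  have bsB: "bs ! i \<in> B" if "i < m" for i using that bs m_def by auto
  have bij: "bij_betw ((!) bs) {..<m} B"
    using bij_betw_nth[OF bs(2), of "{..<m}" B] bs(1) m_def by auto
  define comb where "comb c = (\<Sum>i<m. (c $ i) *s (bs ! i))" for c :: "complex vec"
  have combV: "comb c \<in> V" for c
    unfolding comb_def using bsB B(1) V(1) by (intro subspace_sum subspace_scale) auto
  have comb0: "c = 0\<^sub>v m" if c: "c \<in> carrier_vec m" "comb c = 0" for c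
  proof -
    define u where "u b = c $ (inv_into {..<m} ((!) bs) b)" for b
    have ui: "u (bs ! i) = c $ i" if "i < m" for i
      unfolding u_def using that bij by (simp add: bij_betw_def inv_into_f_f)
    have "(\<Sum>b\<in>B. u b *s b) = (\<Sum>i<m. u (bs ! i) *s (bs ! i))"
      using sum.reindex_bij_betw[OF bij, of "\<lambda>b. u b *s b"] by simp
    also have "\<dots> = comb c" unfolding comb_def using ui by (intro sum.cong) auto
    finally have "(\<Sum>b\<in>B. u b *s b) = 0" using c by simp
    then have "u b = 0" if "b \<in> B" for b using independentD[OF B(2,3) subset_refl] that by blast
    then have "c $ i = 0" if "i < m" for i using ui[OF that] bsB[OF that] by simp
    then show ?thesis using c by (intro eq_vecI) auto
  qed
  define Gram where "Gram f = mat m m (\<lambda>(i, j). f (bs ! i) (bs ! j))" for f :: "'v \<Rightarrow> 'v \<Rightarrow> complex"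
  have Gc[simp]: "Gram f \<in> carrier_mat m m" for f by (simp add: Gram_def)
  have gram: "f (bs ! i) (comb c) = (Gram f *\<^sub>v c) $ i"
    if f: "hermitian_form f" and c: "c \<in> carrier_vec m" and i: "i < m" for f c i
    using c i unfolding comb_def Gram_def
    by (auto simp: form_sum_right[OF f] form_scale_right[OF f] scalar_prod_def mult.commute
        atLeast0LessThan intro!: sum.cong)
  have det: "det (Gram h) \<noteq> 0"
  proof
    assume "det (Gram h) = 0"
    then obtain c where c: "c \<in> carrier_vec m" "c \<noteq> 0\<^sub>v m" "Gram h *\<^sub>v c = 0\<^sub>v m"
      using det_0_iff_vec_prod_zero[OF Gc[of h]] by blast
    have "h b (comb c) = 0" if b: "b \<in> B" for b
    proof -
      obtain i where "i < m" "b = bs ! i" using bij b unfolding bij_betw_def by blast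
      then show ?thesis using gram[OF h c(1)] c(3) by simp
    qed
    then have "h y (comb c) = 0" if "y \<in> V" for y
      using form_span_zero[OF h, of y B "comb c" "{comb c}"] that B(4) by (simp add: span_base)
    then have "comb c = 0" using nd combV unfolding nondegenerate_on_def by blast
    then show False using comb0 c by blast
  qed
  then have "Gram h \<in> Units (ring_mat TYPE(complex) m ())" by (rule det_non_zero_imp_unit[OF Gc])
  then obtain H' where H': "H' \<in> carrier_mat m m" "Gram h * H' = 1\<^sub>m m"
    unfolding Units_def ring_mat_simps by blast
  define M where "M = H' * Gram g"
  have M: "M \<in> carrier_mat m m" using H' by (simp add: M_def)
  have "degree (char_poly M) = m" using degree_monic_char_poly[OF M] by blast
  then have "\<not> constant (poly (char_poly M))" using m by (simp add: constant_degree)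
  then obtain c where "poly (char_poly M) c = 0" using fundamental_theorem_of_algebra by blast
  then have "eigenvalue M c" using eigenvalue_root_char_poly[OF M] by blast
  then obtain u where u: "u \<in> carrier_vec m" "u \<noteq> 0\<^sub>v m" "M *\<^sub>v u = c \<cdot>\<^sub>v u"
    using M unfolding eigenvalue_def eigenvector_def by auto
  have "Gram g *\<^sub>v u = (Gram h * H') *\<^sub>v (Gram g *\<^sub>v u)"
    using mult_mat_vec_carrier[OF Gc[of g] u(1)] unfolding H'(2) by simp
  also have "\<dots> = Gram h *\<^sub>v (M *\<^sub>v u)" using H' u(1) unfolding M_def
    using assoc_mult_mat_vec[OF Gc[of h] H'(1), of "Gram g *\<^sub>v u"] assoc_mult_mat_vec[OF H'(1) Gc[of g] u(1)]
      mult_mat_vec_carrier[OF Gc[of g] u(1)] by simp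
  also have "\<dots> = c \<cdot>\<^sub>v (Gram h *\<^sub>v u)" unfolding u(3) using mult_mat_vec[OF Gc[of h] u(1)] by simp
  finally have eq: "Gram g *\<^sub>v u = c \<cdot>\<^sub>v (Gram h *\<^sub>v u)" .
  have on_B: "g b (comb u) = c * h b (comb u)" if b: "b \<in> B" for b
  proof -
    obtain i where i: "i < m" "b = bs ! i" using bij b unfolding bij_betw_def by blast
    then show ?thesis using gram[OF g u(1) i(1)] gram[OF h u(1) i(1)] index_smult_vec(1)[of i "Gram h *\<^sub>v u" c]
      Gc[of h] unfolding eq by (simp del: index_mult_mat_vec)
  qed
  have "g w (comb u) = c * h w (comb u)" if "w \<in> V" for w
  proof -
    have "w \<in> span B" using that B(4) by simp
    then show ?thesis
    proof (induction rule: span_induct_alt)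
      case base then show ?case by (simp add: form_simps[OF h] form_simps[OF g])
    next
      case (step a b y) then show ?case
        using on_B by (simp add: form_simps[OF h] form_simps[OF g] algebra_simps)
    qed
  qed
  moreover have "comb u \<noteq> 0" using comb0 u by blast
  ultimately show ?thesis using that combV by blast
qed

end

section \<open>Splitting off an isotropic eigenvector\<close>

context complex_vs begin

text \<open>Subtracting multiples of a pivot \<open>a\<close> with \<open>f a \<noteq> 0\<close>
  moves the other \<open>k\<close> vectors into the kernel of \<open>f\<close>; this shear is
  injective on their span because \<open>a\<close> lies outside it.\<close>

lemma hyperplane_section:
  assumes B: "independent B" "finite B" "card B = Suc k" and f: "Vector_Spaces.linear scale (*) f"
  obtains C where "C \<subseteq> span B" "independent C" "finite C" "card C = k" "\<And>c. c \<in> C \<Longrightarrow> f c = 0"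
proof (cases "\<forall>b\<in>B. f b = 0")
  case True
  obtain C where "C \<subseteq> B" "card C = k" "finite C"
    using obtain_subset_with_card_n[of k B] B by (metis le_add2 plus_1_eq_Suc)
  then show ?thesis using that[of C] True independent_mono[OF B(1)] span_base by blast
next
  case False
  interpret f: Vector_Spaces.linear scale "(*)" f by fact
  interpret p: vector_space_pair scale scale ..
  obtain a where a: "a \<in> B" "f a \<noteq> 0" using False by blast
  define L where "L x = x - (f x / f a) *s a" for x
  have L: "Vector_Spaces.linear scale scale L"
    by unfold_locales (auto simp: L_def f.add f.scale algebra_simps add_divide_distrib)
  have ind: "independent (B - {a})" and na: "a \<notin> span (B - {a})"
    using B(1) a(1) dependent_def independent_mono[OF B(1)] by auto
  have inj: "inj_on L (span (B - {a}))"
  proof (subst p.linear_inj_on_iff_eq_0[OF L subspace_span], intro ballI impI)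
    fix x assume x: "x \<in> span (B - {a})" "L x = 0"
    then have eq: "x = (f x / f a) *s a" by (simp add: L_def)
    show "x = 0"
    proof (rule ccontr)
      assume "x \<noteq> 0"
      then have "f x / f a \<noteq> 0" using eq by (metis scale_zero_left)
      then have "a = inverse (f x / f a) *s x" using eq by (metis scale_one scale_scale left_inverse)
      then show False using x(1) na span_scale by metis
    qed
  qed
  have "independent (L ` (B - {a}))" using p.linear_independent_injective_image[OF L ind inj] .
  moreover have "card (L ` (B - {a})) = k"
    using card_image[OF inj_on_subset[OF inj span_superset]] B a(1) by simp
  moreover have "L ` (B - {a}) \<subseteq> span B"
    unfolding L_def using a(1) by (intro image_subsetI span_diff span_scale span_base) auto
  moreover have "f c = 0" if "c \<in> L ` (B - {a})" for c
    using that a(2) by (auto simp: L_def f.diff f.scale)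
  ultimately show ?thesis using that B(2) by blast
qed

lemma linear_hermitian_right: "hermitian_form h \<Longrightarrow> Vector_Spaces.linear scale (*) (h x)"
  by unfold_locales (auto simp: form_simps algebra_simps)

context
  fixes h g V v u c
  assumes h: "hermitian_form h" and g: "hermitian_form g" and V: "subspace V"
    and v: "v \<in> V" and hvv: "h v v = 0" and eig: "\<And>w. w \<in> V \<Longrightarrow> g w v = c * h w v"
    and u: "u \<in> V" "h u v = 1"
begin

text \<open>Since \<open>h v v = 0\<close> and \<open>h u v = 1\<close>, the vectors
  \<open>v\<close> and \<open>u\<close> span a hyperbolic plane for \<open>h\<close>, and
  \<open>V\<close> is the \<open>h\<close>-orthogonal sum of this plane and
  \<open>W\<close>.\<close>

lemma isotropic_pair_complement:
  defines "W \<equiv> {w \<in> V. h v w = 0 \<and> h u w = 0}"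
  shows "subspace W" and "nondegenerate_on h V \<Longrightarrow> nondegenerate_on h W" and "v \<notin> W"
proof -
  let ?W = "{w \<in> V. h v w = 0 \<and> h u w = 0}"
  have W: "W = ?W" by (simp add: W_def)
  show "subspace W" unfolding W using V by (auto simp: subspace_def form_simps[OF h])
  show "v \<notin> W" unfolding W using u by simp
  assume nd: "nondegenerate_on h V"
  have vu: "h v u = 1" using u form_cnj[OF h, of u v] by simp
  show "nondegenerate_on h W" unfolding W nondegenerate_on_def
  proof (intro ballI impI)
    fix x assume x: "x \<in> ?W" and 0: "\<forall>y\<in>?W. h y x = 0"
    have "h y x = 0" if y: "y \<in> V" for y
    proof -
      \<comment> \<open>The projection of \<open>y\<close> to the complement. The term with
        \<open>h u u\<close> is there because \<open>u\<close> itself need not be isotropic.\<close>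
      define y' where "y' = y - h v y *s u - (h u y - h v y * h u u) *s v"
      have "y' \<in> ?W"
        using y v u V unfolding y'_def
        by (auto simp: form_simps[OF h] vu hvv intro!: subspace_diff subspace_scale)
      then have "h y' x = 0" using 0 by blast
      then show ?thesis using x form_cnj[OF h, of v x] form_cnj[OF h, of u x]
        by (simp add: y'_def form_simps[OF h])
    qed
    then show "x = 0" using nd x unfolding nondegenerate_on_def by blast
  qed
qed

text \<open>\<open>v\<close> can be added to any isotropic subspace of the complement: it is
  orthogonal to it for \<open>h\<close>, hence also for \<open>g\<close> by the eigenvector
  equation, and \<open>g v v = c * h v v = 0\<close>.\<close>

lemma isotropic_rank_lift:
  assumes "isotropic_rank k {w \<in> V. h v w = 0 \<and> h u w = 0} h g" (is "isotropic_rank k ?W h g")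
  shows "isotropic_rank (Suc k) V h g"
proof -
  obtain B where B: "B \<subseteq> ?W" "independent B" "finite B" "card B = k"
    "\<forall>x\<in>B. \<forall>y\<in>B. h x y = 0 \<and> g x y = 0"
    using assms unfolding isotropic_rank_def by blast
  have "v \<notin> span B" using span_minimal[OF B(1) isotropic_pair_complement(1)] u by auto
  then have ind: "independent (insert v B)" and nv: "v \<notin> B"
    using independent_insertI B(2) span_base by blast+
  have hv: "h v b = 0" "h b v = 0" "g b v = 0" "g v b = 0" if "b \<in> B" for b
  proof -
    show 1: "h v b = 0" using that B(1) by blast
    show 2: "h b v = 0" using form_cnj[OF h, of v b] 1 by simp
    show 3: "g b v = 0" using eig[of b] that B(1) 2 by auto
    show "g v b = 0" using form_cnj[OF g, of b v] 3 by simp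
  qed
  show ?thesis unfolding isotropic_rank_def
    using B hv ind nv v hvv eig[OF v] by (intro exI[of _ "insert v B"]) auto
qed

text \<open>Cutting a positive subspace with the hyperplane \<open>h v x = 0\<close> costs at most
  one dimension. On the part of that hyperplane inside \<open>V\<close>, \<open>v\<close> is
  orthogonal to everything for both forms, so adding multiples of \<open>v\<close> moves the section
  into the complement without changing the pencil. Injectivity holds since the pencil vanishes at
  \<open>v\<close>, which keeps \<open>v\<close> out of a positive subspace.\<close>

lemma positive_rank_restrict:
  assumes pos: "positive_rank (Suc k) V (pencil h g x y)" and v0: "v \<noteq> 0"
  shows "positive_rank k {w \<in> V. h v w = 0 \<and> h u w = 0} (pencil h g x y)"
proof -
  let ?p = "pencil h g x y"
  let ?W = "{w \<in> V. h v w = 0 \<and> h u w = 0}"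
  have p: "hermitian_form ?p" using hermitian_pencil[OF h g] .
  obtain B where B: "B \<subseteq> V" "independent B" "finite B" "card B = Suc k"
    "\<And>x. x \<in> span B \<Longrightarrow> x \<noteq> 0 \<Longrightarrow> 0 < Re (?p x x)"
    using pos unfolding positive_rank_def by blast
  obtain C where C: "C \<subseteq> span B" "independent C" "finite C" "card C = k" "\<And>c. c \<in> C \<Longrightarrow> h v c = 0"
    using hyperplane_section[OF B(2-4) linear_hermitian_right[OF h, of v]] by blast
  have CB: "span C \<subseteq> span B" using C(1) span_minimal by blast
  have CV: "span C \<subseteq> V" using CB span_minimal[OF B(1) V] by blast
  have hvC: "h v x = 0" if "x \<in> span C" for x using form_span_right_zero[OF h that] C(5) by blast
  have hCv: "h x v = 0" if "x \<in> span C" for x using form_cnj[OF h, of v x] hvC[OF that] by simp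
  have gCv: "g x v = 0" "g v x = 0" if "x \<in> span C" for x
    using eig[of x] hCv[OF that] CV that form_cnj[OF g, of x v] by auto
  have vC: "v \<notin> span C"
  proof
    assume "v \<in> span C"
    then have "0 < Re (?p v v)" using CB B(5) v0 by blast
    then show False using hvv eig[OF v] by (simp add: pencil_def)
  qed
  interpret q: vector_space_pair scale scale ..
  define L where "L x = x - h u x *s v" for x
  have L: "Vector_Spaces.linear scale scale L"
    by unfold_locales (auto simp: L_def form_simps[OF h] algebra_simps)
  have inj: "inj_on L (span C)"
  proof (subst q.linear_inj_on_iff_eq_0[OF L subspace_span], intro ballI impI)
    fix x assume x: "x \<in> span C" "L x = 0"
    then have eq: "x = h u x *s v" by (simp add: L_def)
    show "x = 0"
    proof (rule ccontr)
      assume "x \<noteq> 0"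
      then have "h u x \<noteq> 0" using eq by (metis scale_zero_left)
      then have "v = inverse (h u x) *s x" using eq by (metis scale_one scale_scale left_inverse)
      then show False using x(1) vC span_scale by metis
    qed
  qed
  have "independent (L ` C)" using q.linear_independent_injective_image[OF L C(2) inj] .
  moreover have "card (L ` C) = k" using card_image[OF inj_on_subset[OF inj span_superset]] C by simp
  moreover have "L ` C \<subseteq> ?W"
    using C(5) CV span_superset[of C] v u V hvv
    by (auto simp: L_def form_simps[OF h] intro!: subspace_diff subspace_scale)
  moreover have "0 < Re (?p z z)" if "z \<in> span (L ` C)" "z \<noteq> 0" for z
  proof -
    obtain x where x: "x \<in> span C" "z = L x" using \<open>z \<in> span (L ` C)\<close> q.linear_span_image[OF L] by blast
    have "x \<noteq> 0" using x \<open>z \<noteq> 0\<close> by (auto simp: L_def form_simps[OF h])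
    then have "0 < Re (?p x x)" using B(5) CB x(1) by blast
    moreover have "?p z z = ?p x x"
      using hvC[OF x(1)] hCv[OF x(1)] gCv[OF x(1)] hvv eig[OF v]
      by (simp add: x(2) L_def pencil_def form_simps[OF h] form_simps[OF g])
    ultimately show ?thesis by simp
  qed
  ultimately show ?thesis unfolding positive_rank_def using C(3) by (intro exI[of _ "L ` C"]) auto
qed

end

section \<open>Simultaneous diagonalization and the law of inertia\<close>

definition orthogonal_for :: "'v set \<Rightarrow> ('v \<Rightarrow> 'v \<Rightarrow> complex) \<Rightarrow> bool" where
  "orthogonal_for B h \<longleftrightarrow> (\<forall>b\<in>B. \<forall>c\<in>B. b \<noteq> c \<longrightarrow> h b c = 0)"

lemma orthogonal_forD: "orthogonal_for B h \<Longrightarrow> b \<in> B \<Longrightarrow> c \<in> B \<Longrightarrow> b \<noteq> c \<Longrightarrow> h b c = 0"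
  by (simp add: orthogonal_for_def)

text \<open>A nonisotropic eigenvector splits off together with its \<open>h\<close>-orthogonal
  complement, which is also \<open>g\<close>-orthogonal to it. Absence of isotropic eigenvectors
  passes to the complement because its eigenvectors are eigenvectors on all of
  \<open>V\<close>.\<close>

lemma orthogonal_eigenbasis:
  assumes h: "hermitian_form h" and g: "hermitian_form g" and "subspace V" "dim_at_most d V"
    and "nondegenerate_on h V"
    and "\<And>v c. v \<in> V \<Longrightarrow> v \<noteq> 0 \<Longrightarrow> (\<And>w. w \<in> V \<Longrightarrow> g w v = c * h w v) \<Longrightarrow> h v v \<noteq> 0"
  shows "\<exists>B. finite B \<and> span B = V \<and> orthogonal_for B h \<and> orthogonal_for B g \<and> (\<forall>b\<in>B. h b b \<noteq> 0)"
  using assms(3-)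
proof (induction d arbitrary: V)
  case 0
  have "v = 0" if "v \<in> V" for v
    using 0(2) that dependent_single[of v] unfolding dim_at_most_def
    by (metis card_eq_0_iff empty_not_insert empty_subsetI insert_subset le_zero_eq)
  then have "V = {0}" using subspace_0[OF 0(1)] by blast
  then show ?case by (intro exI[of _ "{}"]) (auto simp: orthogonal_for_def)
next
  case (Suc d)
  show ?case
  proof (cases "V = {0}")
    case True
    then show ?thesis by (intro exI[of _ "{}"]) (auto simp: orthogonal_for_def)
  next
    case False
    then obtain v0 where "v0 \<in> V" "v0 \<noteq> 0" using subspace_0[OF Suc(2)] by blast
    then obtain c v where v: "v \<in> V" "v \<noteq> 0" "\<And>w. w \<in> V \<Longrightarrow> g w v = c * h w v"
      using eigenvector_exists[OF h g Suc(2,3,4)] by blast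
    have hvv: "h v v \<noteq> 0" using Suc(5)[OF v] .
    let ?W = "{w \<in> V. h v w = 0}"
    have W: "subspace ?W" using subspace_orthogonal[OF h Suc(2)] .
    have proj: "w - (h v w / h v v) *s v \<in> ?W" if "w \<in> V" for w
      using that v(1) hvv Suc(2) by (auto simp: form_simps[OF h] intro!: subspace_diff subspace_scale)
    have hW: "h w v = 0" "g w v = 0" "g v w = 0" if "w \<in> ?W" for w
      using that form_cnj[OF h, of v w] v(3)[of w] form_cnj[OF g, of w v] by auto
    have "dim_at_most d ?W" using dim_at_most_less[OF W Suc(3) _ v(1)] hvv by blast
    moreover have "nondegenerate_on h ?W" unfolding nondegenerate_on_def
    proof (intro ballI impI)
      fix x assume x: "x \<in> ?W" and 0: "\<forall>y\<in>?W. h y x = 0"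
      have "h y x = 0" if "y \<in> V" for y
        using 0 proj[OF that] x by (force simp: form_simps[OF h])
      then show "x = 0" using Suc(4) x unfolding nondegenerate_on_def by blast
    qed
    moreover have "h x x \<noteq> 0" if x: "x \<in> ?W" "x \<noteq> 0" and e: "\<And>w. w \<in> ?W \<Longrightarrow> g w x = a * h w x" for x a
    proof -
      have "g w x = a * h w x" if "w \<in> V" for w
        using e[OF proj[OF that]] x(1) hW[OF x(1)] by (simp add: form_simps[OF h] form_simps[OF g])
      then show ?thesis using Suc(5) x by blast
    qed
    ultimately obtain B where B: "finite B" "span B = ?W" "orthogonal_for B h" "orthogonal_for B g"
      "\<forall>b\<in>B. h b b \<noteq> 0"
      using Suc(1)[OF W] by blast
    have "B \<subseteq> ?W" using B(2) span_superset by blast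
    then have "orthogonal_for (insert v B) h" "orthogonal_for (insert v B) g"
      using B(3,4) hW unfolding orthogonal_for_def by blast+
    moreover have "span (insert v B) = V"
    proof
      show "span (insert v B) \<subseteq> V" using span_minimal[OF _ Suc(2)] v(1) \<open>B \<subseteq> ?W\<close> by blast
      show "V \<subseteq> span (insert v B)" using proj B(2) span_breakdown_eq by blast
    qed
    ultimately show ?thesis using B hvv by (intro exI[of _ "insert v B"]) auto
  qed
qed

context
  fixes h B assumes h: "hermitian_form h" and B: "finite B" "orthogonal_for B h" "\<forall>b\<in>B. h b b \<noteq> 0"
begin

lemma orthogonal_pick:
  assumes "b \<in> C" "C \<subseteq> B" shows "h b (\<Sum>c\<in>C. a c *s c) = a b * h b b"
proof -
  have "h b c = 0" if "c \<in> C" "c \<noteq> b" for c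
    using orthogonal_forD[OF B(2), of b c] assms that by auto
  then have "h b (\<Sum>c\<in>C. a c *s c) = (\<Sum>c\<in>C. if c = b then a b * h b b else 0)"
    unfolding form_sum_right[OF h] form_scale_right[OF h] by (intro sum.cong) auto
  also have "\<dots> = a b * h b b" using assms finite_subset[OF _ B(1)] by simp
  finally show ?thesis .
qed

lemma orthogonal_expansion:
  assumes "C \<subseteq> B" "x \<in> span C" shows "x = (\<Sum>b\<in>C. (h b x / h b b) *s b)"
proof -
  have fin: "finite C" using finite_subset[OF assms(1) B(1)] .
  obtain a where a: "x = (\<Sum>b\<in>C. a b *s b)" using assms(2) span_finite[OF fin] by auto
  have "h b x / h b b = a b" if "b \<in> C" for b
    using orthogonal_pick[OF that assms(1), of a] a that B(3) assms(1) by auto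
  then show ?thesis using a by (simp cong: sum.cong)
qed

lemma orthogonal_independent: "independent B"
  using orthogonal_pick[OF _ subset_refl] B(3) form_zero_right[OF h]
  by (auto simp: independent_explicit_finite_subsets dependent_finite[OF B(1)])
    (metis mult_eq_0_iff)

lemma orthogonal_form_self:
  assumes p: "hermitian_form p" "orthogonal_for B p" and C: "C \<subseteq> B"
  shows "Re (p (\<Sum>b\<in>C. a b *s b) (\<Sum>b\<in>C. a b *s b)) = (\<Sum>b\<in>C. (cmod (a b))\<^sup>2 * Re (p b b))"
proof -
  have "p b (\<Sum>c\<in>C. a c *s c) = a b * p b b" if "b \<in> C" for b
  proof -
    have "p b c = 0" if "c \<in> C" "c \<noteq> b" for c
      using orthogonal_forD[OF p(2), of b c] C that \<open>b \<in> C\<close> by auto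
    then have "p b (\<Sum>c\<in>C. a c *s c) = (\<Sum>c\<in>C. if c = b then a b * p b b else 0)"
      unfolding form_sum_right[OF p(1)] form_scale_right[OF p(1)] by (intro sum.cong) auto
    then show ?thesis using that finite_subset[OF C B(1)] by simp
  qed
  then have "p (\<Sum>b\<in>C. a b *s b) (\<Sum>b\<in>C. a b *s b) = (\<Sum>b\<in>C. cnj (a b) * (a b * p b b))"
    unfolding form_sum_left[OF p(1)] form_scale_left[OF p(1)] by (intro sum.cong) auto
  also have "\<dots> = (\<Sum>b\<in>C. of_real ((cmod (a b))\<^sup>2 * Re (p b b)))"
  proof (intro sum.cong refl)
    fix b
    have "cnj (a b) * a b = of_real ((cmod (a b))\<^sup>2)" by (metis complex_norm_square mult.commute)
    then show "cnj (a b) * (a b * p b b) = of_real ((cmod (a b))\<^sup>2 * Re (p b b))"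
      using form_self_real[OF p(1), of b] by (metis mult.assoc of_real_mult)
  qed
  finally show ?thesis by simp
qed

text \<open>Sylvester's law of inertia for \<open>p\<close>; the form \<open>h\<close> serves to
  read off coordinates as \<open>h b x / h b b\<close>. A positive subspace projects injectively to
  the positive coordinates, since \<open>p\<close> is nonpositive on the kernel of this
  projection.\<close>

lemma positive_rank_orthogonal_iff:
  assumes p: "hermitian_form p" "orthogonal_for B p"
  shows "positive_rank k (span B) p \<longleftrightarrow> k \<le> card {b \<in> B. 0 < Re (p b b)}" (is "_ \<longleftrightarrow> k \<le> card ?P")
proof
  assume "positive_rank k (span B) p"
  then obtain C where C: "C \<subseteq> span B" "independent C" "finite C" "card C = k"
    "\<And>x. x \<in> span C \<Longrightarrow> x \<noteq> 0 \<Longrightarrow> 0 < Re (p x x)"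
    unfolding positive_rank_def by blast
  interpret q: vector_space_pair scale scale ..
  define L where "L x = (\<Sum>b\<in>?P. (h b x / h b b) *s b)" for x
  have L: "Vector_Spaces.linear scale scale L"
    by unfold_locales
      (auto simp: L_def form_simps[OF h] add_divide_distrib scale_left_distrib sum.distrib
        scale_sum_right)
  have inj: "inj_on L (span C)"
  proof (subst q.linear_inj_on_iff_eq_0[OF L subspace_span], intro ballI impI)
    fix x assume x: "x \<in> span C" "L x = 0"
    have xB: "x \<in> span B" using x(1) C(1) span_minimal[OF C(1) subspace_span] by blast
    have 0: "h b x = 0" if "b \<in> ?P" for b
    proof -
      have "h b (L x) = h b x / h b b * h b b"
        unfolding L_def using orthogonal_pick[OF that, of "\<lambda>b. h b x / h b b"] by auto
      then show ?thesis using that B(3) x(2) by (simp add: form_simps[OF h])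
    qed
    have "Re (p x x) = (\<Sum>b\<in>B. (cmod (h b x / h b b))\<^sup>2 * Re (p b b))"
      using orthogonal_expansion[OF subset_refl xB] orthogonal_form_self[OF p subset_refl, of "\<lambda>b. h b x / h b b"]
      by simp
    also have "\<dots> \<le> 0"
    proof (intro sum_nonpos)
      fix b assume "b \<in> B"
      show "(cmod (h b x / h b b))\<^sup>2 * Re (p b b) \<le> 0"
      proof (cases "b \<in> ?P")
        case True then show ?thesis using 0 by simp
      next
        case False then have "Re (p b b) \<le> 0" using \<open>b \<in> B\<close> by simp
        then show ?thesis by (simp add: mult_nonneg_nonpos)
      qed
    qed
    finally show "x = 0" using C(5) x(1) by force
  qed
  have "independent (L ` C)" using q.linear_independent_injective_image[OF L C(2) inj] .
  moreover have "L ` C \<subseteq> span ?P" unfolding L_def by (intro image_subsetI span_sum span_scale span_base)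
  ultimately have "card (L ` C) \<le> card ?P" using independent_span_bound[of ?P "L ` C"] B(1) by simp
  moreover have "card (L ` C) = k" using card_image[OF inj_on_subset[OF inj span_superset]] C by simp
  ultimately show "k \<le> card ?P" by simp
next
  assume "k \<le> card ?P"
  then obtain C where C: "C \<subseteq> ?P" "card C = k" "finite C" by (rule obtain_subset_with_card_n)
  have CB: "C \<subseteq> B" using C by blast
  have "0 < Re (p x x)" if x: "x \<in> span C" "x \<noteq> 0" for x
  proof -
    define a where "a b = h b x / h b b" for b
    have e: "x = (\<Sum>b\<in>C. a b *s b)" using orthogonal_expansion[OF CB x(1)] by (simp add: a_def)
    then have "Re (p x x) = (\<Sum>b\<in>C. (cmod (a b))\<^sup>2 * Re (p b b))"
      using orthogonal_form_self[OF p CB, of a] by simp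
    moreover obtain b where "b \<in> C" "a b \<noteq> 0"
    proof (rule ccontr)
      assume "\<not> thesis"
      then have "\<And>b. b \<in> C \<Longrightarrow> a b = 0" using that by blast
      then have "x = 0" unfolding e by (intro sum.neutral) simp
      then show False using x by simp
    qed
    then have "(\<Sum>b\<in>C. (cmod (a b))\<^sup>2 * Re (p b b)) > 0"
      using C by (intro sum_pos2[of C b] mult_nonneg_nonneg) (auto intro: less_imp_le)
    ultimately show ?thesis by simp
  qed
  then show "positive_rank k (span B) p" unfolding positive_rank_def
    using C CB independent_mono[OF orthogonal_independent CB] span_superset[of B]
    by (intro exI[of _ C]) auto
qed

end

end

section \<open>Isotropic subspaces of diagonal pencils\<close>

text \<open>The sum is the coefficient of degree \<open>card I - 1\<close> in the Lagrange
  interpolation polynomial of the monomial of degree \<open>s\<close>. Interpolation reproduces that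
  monomial, whose degree is smaller.\<close>

lemma sum_power_divided_difference:
  fixes x :: "'i \<Rightarrow> real"
  assumes I: "finite I" "inj_on x I" and s: "Suc s < card I"
  shows "(\<Sum>j\<in>I. x j ^ s / (\<Prod>l\<in>I - {j}. x j - x l)) = 0"
proof -
  define D where "D j = (\<Prod>l\<in>I - {j}. x j - x l)" for j
  define L where "L j = (\<Prod>l\<in>I - {j}. [:- x l, 1:])" for j
  have D: "D j \<noteq> 0" if "j \<in> I" for j
    using I that by (auto simp: D_def inj_on_def)
  have degL: "degree (L j) = card I - 1" and lead: "lead_coeff (L j) = 1" if "j \<in> I" for j
  proof -
    show "degree (L j) = card I - 1" using I(1) that unfolding L_def
      by (subst degree_prod_eq_sum_degree) auto
    show "lead_coeff (L j) = 1" unfolding L_def by (subst lead_coeff_prod) simp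
  qed
  have polyL: "poly (L j) (x i) = (if i = j then D j else 0)" if "i \<in> I" "j \<in> I" for i j
    using that I(1) unfolding L_def D_def poly_prod by (auto intro: prod_zero)
  \<comment> \<open>The interpolation error: it has \<open>card I\<close> roots but degree below
    \<open>card I\<close>.\<close>
  define Q where "Q = (\<Sum>j\<in>I. smult (x j ^ s / D j) (L j)) - monom 1 s"
  have root: "poly Q (x i) = 0" if "i \<in> I" for i
  proof -
    have "(\<Sum>j\<in>I. x j ^ s / D j * poly (L j) (x i)) = (\<Sum>j\<in>I. if i = j then x j ^ s else 0)"
      using that D polyL by (intro sum.cong) auto
    then show ?thesis using that I(1) by (simp add: Q_def poly_sum poly_monom)
  qed
  have degQ: "degree Q \<le> card I - 1" unfolding Q_def
    using s degL by (intro degree_diff_le degree_sum_le I(1))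
      (auto simp: degree_monom_eq intro: order_trans[OF degree_smult_le])
  have "Q = 0"
  proof (rule ccontr)
    assume "Q \<noteq> 0"
    then have "card (x ` I) \<le> degree Q"
      using card_poly_roots_bound[of Q] card_mono[OF poly_roots_finite[of Q], of "x ` I"] root by force
    then show False using degQ s card_image[OF I(2)] by simp
  qed
  then have "coeff (\<Sum>j\<in>I. smult (x j ^ s / D j) (L j)) (card I - 1) = coeff (monom 1 s) (card I - 1)"
    by (simp add: Q_def)
  moreover have "coeff (L j) (card I - 1) = 1" if "j \<in> I" for j using lead[OF that] degL[OF that] by simp
  ultimately show ?thesis using s by (simp add: coeff_sum D_def[symmetric])
qed

text \<open>Exactly the \<open>n - j\<close> factors with \<open>l > j\<close> are negative.\<close>

lemma sign_prod_differences:
  fixes x :: "nat \<Rightarrow> real"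
  assumes "strict_mono_on {..n} x" "j \<le> n"
  shows "(-1) ^ (n - j) * (\<Prod>l\<in>{..n} - {j}. x j - x l) > 0"
proof -
  have split: "{..n} - {j} = {..<j} \<union> {j<..n}" using assms(2) by auto
  have "(\<Prod>l\<in>{j<..n}. x j - x l) = (\<Prod>l\<in>{j<..n}. (-1) * (x l - x j))" by (intro prod.cong) auto
  also have "\<dots> = (-1) ^ (n - j) * (\<Prod>l\<in>{j<..n}. x l - x j)"
    unfolding prod.distrib by simp
  finally have "(-1) ^ (n - j) * (\<Prod>l\<in>{..n} - {j}. x j - x l) =
      (\<Prod>l\<in>{..<j}. x j - x l) * (\<Prod>l\<in>{j<..n}. x l - x j) * ((-1) ^ (n - j) * (-1) ^ (n - j))"
    unfolding split by (subst prod.union_disjoint) auto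
  moreover have "(-1) ^ (n - j) * (-1) ^ (n - j) = (1::real)" by (simp flip: power_add)
  moreover have "(\<Prod>l\<in>{..<j}. x j - x l) > 0" "(\<Prod>l\<in>{j<..n}. x l - x j) > 0"
    using assms by (auto intro!: prod_pos simp: strict_mono_on_def)
  ultimately show ?thesis by simp
qed

section \<open>Isotropic subspaces from alternating chains of eigenvectors\<close>

context complex_vs begin

text \<open>The hypothesis concerns the indexed family, so it also excludes repetitions:
  \<open>x t = x u\<close> would be a relation with coefficients \<open>1\<close> and
  \<open>- 1\<close>.\<close>

lemma independent_familyI:
  fixes m :: nat
  assumes "\<And>c. (\<Sum>t<m. c t *s x t) = 0 \<Longrightarrow> (\<forall>t<m. c t = 0)"
  shows "inj_on x {..<m}" "independent (x ` {..<m})"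
proof -
  show inj: "inj_on x {..<m}"
  proof (rule inj_onI, rule ccontr)
    fix t u assume tu: "t \<in> {..<m}" "u \<in> {..<m}" "x t = x u" "t \<noteq> u"
    have "(\<Sum>i<m. (if i = t then 1 else if i = u then - 1 else 0) *s x i) =
        (\<Sum>i<m. (if i = t then x t else 0) + (if i = u then - x u else 0))"
      using tu by (intro sum.cong) auto
    also have "\<dots> = x t - x u" using tu(1,2) by (simp add: sum.distrib)
    also have "\<dots> = 0" using tu(3) by simp
    finally show False using assms[of "\<lambda>i. if i = t then 1 else if i = u then - 1 else 0"] tu by auto
  qed
  show "independent (x ` {..<m})"
  proof
    assume "dependent (x ` {..<m})"
    then obtain a where a: "\<exists>v\<in>x ` {..<m}. a v \<noteq> 0" "(\<Sum>v\<in>x ` {..<m}. a v *s v) = 0"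
      using dependent_finite[of "x ` {..<m}"] by auto
    have "(\<Sum>t<m. a (x t) *s x t) = 0" using a(2) by (simp add: sum.reindex[OF inj])
    then have "\<forall>t<m. a (x t) = 0" using assms[of "\<lambda>t. a (x t)"] by blast
    then show False using a(1) by auto
  qed
qed

lemma independent_union:
  assumes "independent C" "independent D" "finite C" "finite D" "span C \<inter> span D \<subseteq> {0}"
  shows "C \<inter> D = {}" "independent (C \<union> D)"
proof -
  show disj: "C \<inter> D = {}"
    using assms(1,5) span_superset[of C] span_superset[of D] dependent_zero by blast
  show "independent (C \<union> D)"
  proof
    assume "dependent (C \<union> D)"
    then obtain a where a: "\<exists>v\<in>C \<union> D. a v \<noteq> 0" "(\<Sum>v\<in>C \<union> D. a v *s v) = 0"
      using dependent_finite[of "C \<union> D"] assms by auto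
    let ?x = "\<Sum>v\<in>C. a v *s v" and ?y = "\<Sum>v\<in>D. a v *s v"
    have xy: "?x + ?y = 0" using a(2) sum.union_disjoint[OF assms(3,4) disj] by metis
    have x: "?x \<in> span C" and y: "?y \<in> span D" by (intro span_sum span_scale span_base; assumption)+
    have "?x = - ?y" using xy by (simp add: eq_neg_iff_add_eq_0)
    then have "?x \<in> span D" using y span_neg by metis
    then have x0: "?x = 0" using x assms(5) by blast
    then have y0: "?y = 0" using xy by simp
    show False using a(1) independentD[OF assms(1,3) subset_refl x0] independentD[OF assms(2,4) subset_refl y0]
      by blast
  qed
qed

context
  fixes h g B
  assumes h: "hermitian_form h" and g: "hermitian_form g"
    and B: "finite B" "orthogonal_for B h" "orthogonal_for B g" "\<forall>b\<in>B. h b b \<noteq> 0"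
begin

text \<open>Spans of disjoint subsets of the orthogonal basis are orthogonal for both forms and meet
  only in 0, so isotropic subspaces in them add up.\<close>

lemma isotropic_rank_union:
  assumes "isotropic_rank m (span C) h g" "isotropic_rank n (span D) h g"
    and CD: "C \<subseteq> B" "D \<subseteq> B" "C \<inter> D = {}"
  shows "isotropic_rank (m + n) (span (C \<union> D)) h g"
proof -
  obtain X where X: "X \<subseteq> span C" "independent X" "finite X" "card X = m"
    "\<forall>x\<in>X. \<forall>y\<in>X. h x y = 0 \<and> g x y = 0"
    using assms(1) unfolding isotropic_rank_def by blast
  obtain Y where Y: "Y \<subseteq> span D" "independent Y" "finite Y" "card Y = n"
    "\<forall>x\<in>Y. \<forall>y\<in>Y. h x y = 0 \<and> g x y = 0"
    using assms(2) unfolding isotropic_rank_def by blast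
  have bc: "h b c = 0" "g b c = 0" "h c b = 0" "g c b = 0" if "b \<in> C" "c \<in> D" for b c
  proof -
    have "b \<in> B" "c \<in> B" "b \<noteq> c" using that CD by auto
    then show "h b c = 0" "g b c = 0" "h c b = 0" "g c b = 0"
      using orthogonal_forD[OF B(2)] orthogonal_forD[OF B(3)] by metis+
  qed
  have xy: "h x y = 0" "g x y = 0" "h y x = 0" "g y x = 0" if "x \<in> span C" "y \<in> span D" for x y
    using form_span_zero[OF h that] form_span_zero[OF g that] form_span_zero[OF h that(2,1)]
      form_span_zero[OF g that(2,1)] bc by auto
  have "span X \<inter> span Y \<subseteq> {0}"
  proof
    fix x assume "x \<in> span X \<inter> span Y"
    then have x: "x \<in> span C" "x \<in> span D" using X(1) Y(1) span_minimal subspace_span by blast+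
    have "h b x = 0" if "b \<in> C" for b using xy[OF span_base[OF that] x(2)] by simp
    then have "(\<Sum>b\<in>C. (h b x / h b b) *s b) = 0" by (intro sum.neutral) simp
    then show "x \<in> {0}" using orthogonal_expansion[OF h B(1,2,4) CD(1) x(1)] by simp
  qed
  note U = independent_union[OF X(2) Y(2) X(3) Y(3) this]
  have "X \<union> Y \<subseteq> span (C \<union> D)" using X(1) Y(1) span_mono[of C "C \<union> D"] span_mono[of D "C \<union> D"] by blast
  moreover have "\<forall>x\<in>X \<union> Y. \<forall>y\<in>X \<union> Y. h x y = 0 \<and> g x y = 0"
    using X(1,5) Y(1,5) xy by blast
  moreover have "card (X \<union> Y) = m + n" using card_Un_disjoint[OF X(3) Y(3) U(1)] X(4) Y(4) by simp
  ultimately show ?thesis unfolding isotropic_rank_def using U(2) X(3) Y(3)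
    by (intro exI[of _ "X \<union> Y"]) auto
qed

lemma isotropic_rank_zero: "subspace V \<Longrightarrow> isotropic_rank 0 V h g"
  unfolding isotropic_rank_def using independent_empty by (intro exI[of _ "{}"]) auto

lemma isotropic_rank_Union:
  assumes "finite I" "\<And>i. i \<in> I \<Longrightarrow> isotropic_rank (m i) (span (C i)) h g" "\<And>i. i \<in> I \<Longrightarrow> C i \<subseteq> B"
    "\<And>i j. i \<in> I \<Longrightarrow> j \<in> I \<Longrightarrow> i \<noteq> j \<Longrightarrow> C i \<inter> C j = {}"
  shows "isotropic_rank (sum m I) (span (\<Union>i\<in>I. C i)) h g"
  using assms
proof (induction I rule: finite_induct)
  case empty
  then show ?case using isotropic_rank_zero[of "{0}"] by simp
next
  case (insert i I)
  have "C i \<inter> (\<Union>j\<in>I. C j) = {}" using insert.prems(3)[of i] insert.hyps(2) by blast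
  moreover have "(\<Union>j\<in>I. C j) \<subseteq> B" using insert.prems(2) by blast
  ultimately show ?case
    using isotropic_rank_union[of "m i" "C i" "sum m I" "\<Union>j\<in>I. C j"] insert by simp
qed

text \<open>
  Divided differences of order \<open>2m\<close> annihilate polynomials of degree below \<open>2m\<close>, and their weights
  alternate in sign; so weighted Vandermonde vectors in the span of an alternating chain of
  \<open>2m + 1\<close> eigenvectors are isotropic.
\<close>

lemma isotropic_rank_chain:
  assumes b: "\<And>j. j \<le> 2 * m \<Longrightarrow> b j \<in> B"
    and alt: "\<And>j. j \<le> 2 * m \<Longrightarrow> (-1) ^ j * Re (h (b j) (b j)) < 0"
    and r: "\<And>j. j \<le> 2 * m \<Longrightarrow> Re (g (b j) (b j)) = r j * Re (h (b j) (b j))"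
    and mono: "\<And>j. j < 2 * m \<Longrightarrow> r j < r (Suc j)"
  shows "isotropic_rank m (span (b ` {..2 * m})) h g"
proof -
  let ?J = "{..2 * m}"
  have less: "r i < r j" if "i < j" "j \<le> 2 * m" for i j
    using that
  proof (induction j)
    case (Suc j) then show ?case using mono[of j] by (cases "i = j") auto
  qed simp
  have smr: "strict_mono_on ?J r" using less by (auto simp: strict_mono_on_def)
  have injr: "inj_on r ?J" using smr strict_mono_on_imp_inj_on by blast
  have rb: "r j = Re (g (b j) (b j)) / Re (h (b j) (b j))" if "j \<le> 2 * m" for j
    using r[OF that] alt[OF that] by auto
  have injb: "inj_on b ?J"
  proof (rule inj_onI)
    fix i j assume "i \<in> ?J" "j \<in> ?J" "b i = b j"
    then have "r i = r j" using rb[of i] rb[of j] by simp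
    then show "i = j" using injr \<open>i \<in> ?J\<close> \<open>j \<in> ?J\<close> by (auto dest: inj_onD)
  qed
  define \<eta> where "\<eta> j = Re (h (b j) (b j))" for j
  define D where "D j = (\<Prod>l\<in>?J - {j}. r j - r l)" for j
  \<comment> \<open>Chosen so that \<open>a j * a j * \<eta> j\<close> is minus the
    divided-difference weight \<open>1 / D j\<close>. The radicand is positive because
    \<open>D j\<close> has the sign \<open>(-1) ^ j\<close>, the parities of
    \<open>2 * m - j\<close> and \<open>j\<close> being equal, and \<open>\<eta> j\<close> has the
    opposite one.\<close>
  define a where "a j = sqrt (- 1 / (\<eta> j * D j))" for j
  have neg: "\<eta> j * D j < 0" if "j \<le> 2 * m" for j
  proof -
    have "(-1) ^ (2 * m - j) = ((-1) ^ j :: real)" using that by (simp add: minus_one_power_iff)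
    then have "(-1) ^ j * D j > 0" using sign_prod_differences[OF smr that] by (simp add: D_def)
    moreover have "(-1) ^ j * \<eta> j < 0" using alt[OF that] by (simp add: \<eta>_def)
    ultimately show ?thesis by (cases "even j") (auto simp: mult_pos_neg mult_neg_pos)
  qed
  have a2: "a j * a j * \<eta> j = - 1 / D j" and a0: "a j \<noteq> 0" if "j \<le> 2 * m" for j
  proof -
    have "- 1 / (\<eta> j * D j) > 0" using divide_neg_neg[of "- 1", OF _ neg[OF that]] by simp
    then show "a j \<noteq> 0" unfolding a_def by (metis less_irrefl real_sqrt_eq_zero_cancel_iff)
    have "a j * a j = - 1 / (\<eta> j * D j)" using \<open>- 1 / (\<eta> j * D j) > 0\<close> by (simp add: a_def)
    then show "a j * a j * \<eta> j = - 1 / D j" using neg[OF that] by (cases "\<eta> j = 0"; cases "D j = 0") simp_all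
  qed
  define x where "x t = (\<Sum>j\<in>?J. of_real (a j * r j ^ t) *s b j)" for t
  have form: "p (x t) (x u) = of_real (\<Sum>j\<in>?J. a j * a j * r j ^ (t + u) * Re (p (b j) (b j)))"
    if p: "hermitian_form p" and orth: "orthogonal_for B p" for p t u
  proof -
    have "p (b i) (x u) = of_real (a i * r i ^ u) * p (b i) (b i)" if "i \<in> ?J" for i
    proof -
      have "p (b i) (b j) = 0" if "j \<in> ?J" "j \<noteq> i" for j
        using orthogonal_forD[OF orth, of "b i" "b j"] b[of i] b[of j] that \<open>i \<in> ?J\<close> injb
        by (auto simp: inj_on_def)
      then have "p (b i) (x u) = (\<Sum>j\<in>?J. if j = i then of_real (a i * r i ^ u) * p (b i) (b i) else 0)"
        unfolding x_def form_sum_right[OF p] form_scale_right[OF p] by (intro sum.cong) auto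
      then show ?thesis using that by simp
    qed
    then have "p (x t) (x u) = (\<Sum>i\<in>?J. cnj (of_real (a i * r i ^ t)) * (of_real (a i * r i ^ u) * p (b i) (b i)))"
      unfolding x_def[of t] form_sum_left[OF p] form_scale_left[OF p] by (intro sum.cong) auto
    also have "\<dots> = (\<Sum>i\<in>?J. of_real (a i * a i * r i ^ (t + u) * Re (p (b i) (b i))))"
      using form_self_real[OF p] by (intro sum.cong refl)
        (metis (no_types, lifting) complex_cnj_complex_of_real mult.assoc mult.left_commute
          of_real_mult power_add)
    finally show ?thesis by simp
  qed
  have "h (x t) (x u) = 0 \<and> g (x t) (x u) = 0" if "t < m" "u < m" for t u
  proof -
    have 1: "(\<Sum>j\<in>?J. a j * a j * r j ^ (t + u) * \<eta> j) = - (\<Sum>j\<in>?J. r j ^ (t + u) / D j)"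
      unfolding sum_negf[symmetric]
    proof (intro sum.cong refl)
      fix j assume "j \<in> ?J"
      then have "(a j * a j * \<eta> j) * r j ^ (t + u) = - 1 / D j * r j ^ (t + u)" using a2[of j] by simp
      then show "a j * a j * r j ^ (t + u) * \<eta> j = - (r j ^ (t + u) / D j)" by (simp add: mult_ac)
    qed
    have 2: "(\<Sum>j\<in>?J. a j * a j * r j ^ (t + u) * Re (g (b j) (b j))) = - (\<Sum>j\<in>?J. r j ^ Suc (t + u) / D j)"
      unfolding sum_negf[symmetric]
    proof (intro sum.cong refl)
      fix j assume "j \<in> ?J"
      then have "(a j * a j * \<eta> j) * r j ^ Suc (t + u) = - 1 / D j * r j ^ Suc (t + u)"
        and "Re (g (b j) (b j)) = r j * \<eta> j" using a2[of j] r[of j] by (simp_all add: \<eta>_def)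
      then show "a j * a j * r j ^ (t + u) * Re (g (b j) (b j)) = - (r j ^ Suc (t + u) / D j)"
        by (simp add: mult_ac)
    qed
    \<comment> \<open>The largest exponent is \<open>2 * m - 1\<close>, reached in the sum for
      \<open>g\<close> when \<open>t = u = m - 1\<close>; this is why \<open>2 * m + 1\<close> nodes
      are required.\<close>
    have "(\<Sum>j\<in>?J. r j ^ (t + u) / D j) = 0" "(\<Sum>j\<in>?J. r j ^ Suc (t + u) / D j) = 0"
      unfolding D_def using that by (intro sum_power_divided_difference[OF _ injr]; simp)+
    then show ?thesis unfolding form[OF h B(2)] form[OF g B(3)] 2 1[unfolded \<eta>_def]
      by (simp only: minus_zero of_real_0)
  qed
  moreover have "\<forall>t<m. c t = 0" if c: "(\<Sum>t<m. c t *s x t) = 0" for c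
  proof -
    \<comment> \<open>A linear relation among the \<open>x t\<close> is a polynomial of degree below
      \<open>m\<close> that vanishes at all \<open>2 * m + 1\<close> nodes
      \<open>r j\<close>.\<close>
    define p where "p = (\<Sum>t<m. monom (c t) t)"
    have root: "poly p (of_real (r j)) = 0" if "j \<in> ?J" for j
    proof -
      have "(\<Sum>t<m. c t *s x t) = (\<Sum>j\<in>?J. (\<Sum>t<m. c t * of_real (a j * r j ^ t)) *s b j)"
        unfolding x_def scale_sum_right scale_scale scale_sum_left by (rule sum.swap)
      also have "\<dots> = (\<Sum>j\<in>?J. (of_real (a j) * poly p (of_real (r j))) *s b j)"
        by (intro sum.cong refl) (simp add: p_def poly_sum poly_monom sum_distrib_left algebra_simps)
      finally have "h (b j) (\<Sum>j\<in>?J. (of_real (a j) * poly p (of_real (r j))) *s b j) = 0"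
        using c by (simp add: form_zero_right[OF h])
      moreover have "h (b j) (b i) = 0" if "i \<in> ?J" "i \<noteq> j" for i
        using orthogonal_forD[OF B(2), of "b j" "b i"] b[of i] b[of j] that \<open>j \<in> ?J\<close> injb
        by (auto simp: inj_on_def)
      then have "h (b j) (\<Sum>j\<in>?J. (of_real (a j) * poly p (of_real (r j))) *s b j) =
          (\<Sum>i\<in>?J. if i = j then of_real (a j) * poly p (of_real (r j)) * h (b j) (b j) else 0)"
        unfolding form_sum_right[OF h] form_scale_right[OF h] by (intro sum.cong) auto
      ultimately show ?thesis using that a0[of j] B(4) b[of j] by simp
    qed
    have "p = 0"
    proof (rule ccontr)
      assume p0: "p \<noteq> 0"
      then have m: "m > 0" by (auto simp: p_def)
      have "degree p \<le> m - 1" unfolding p_def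
        by (intro degree_sum_le) (auto intro: order_trans[OF degree_monom_le])
      moreover have "card ((\<lambda>j. complex_of_real (r j)) ` ?J) \<le> degree p"
        using card_poly_roots_bound[OF p0] root
          card_mono[OF poly_roots_finite[OF p0], of "(\<lambda>j. complex_of_real (r j)) ` ?J"] by force
      moreover have "card ((\<lambda>j. complex_of_real (r j)) ` ?J) = 2 * m + 1"
        using injr by (subst card_image) (auto simp: inj_on_def)
      ultimately show False using m by simp
    qed
    moreover have "coeff p t = c t" if "t < m" for t
      using that by (simp add: p_def coeff_sum)
    ultimately show ?thesis by (metis coeff_0)
  qed
  note I = independent_familyI[where m = m and x = x, OF this]
  have "x t \<in> span (b ` ?J)" for t unfolding x_def by (intro span_sum span_scale span_base) simp
  then show ?thesis unfolding isotropic_rank_def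
    using I card_image[OF I(1)] calculation by (intro exI[of _ "x ` {..<m}"]) auto
qed

end

end

section \<open>Counting in sorted lists and residue classes\<close>

context
  fixes f :: "'b \<Rightarrow> real" and xs :: "'b list"
  assumes xs: "sorted (map f xs)" "distinct xs"
begin

lemma sorted_nth_le: "i \<le> j \<Longrightarrow> j < length xs \<Longrightarrow> f (xs ! i) \<le> f (xs ! j)"
  using xs(1) sorted_nth_mono[of "map f xs" i j] by simp

lemma card_nth_image: "J \<subseteq> {..<length xs} \<Longrightarrow> card ((!) xs ` J) = card J"
  using xs(2) by (intro card_image inj_on_nth) auto

lemma card_le_nth: "i < length xs \<Longrightarrow> Suc i \<le> card {x \<in> set xs. f x \<le> f (xs ! i)}"
  using card_nth_image[of "{..i}"] card_mono[of "{x \<in> set xs. f x \<le> f (xs ! i)}" "(!) xs ` {..i}"]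
    sorted_nth_le by (force)

lemma card_ge_nth: "i < length xs \<Longrightarrow> length xs - i \<le> card {x \<in> set xs. f (xs ! i) \<le> f x}"
  using card_nth_image[of "{i..<length xs}"]
    card_mono[of "{x \<in> set xs. f (xs ! i) \<le> f x}" "(!) xs ` {i..<length xs}"]
    sorted_nth_le by (force)

text \<open>If entry \<open>i\<close> were at least \<open>s\<close>, only the \<open>i\<close>
  positions before it could hold values below \<open>s\<close>.\<close>

lemma nth_less_of_card:
  assumes "i < card {x \<in> set xs. f x < s}" shows "i < length xs" "f (xs ! i) < s"
proof -
  have "card {x \<in> set xs. f x < s} \<le> card (set xs)" by (intro card_mono) auto
  then show i: "i < length xs" using assms distinct_card[OF xs(2)] by simp
  show "f (xs ! i) < s"
  proof (rule ccontr)
    assume neg: "\<not> f (xs ! i) < s"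
    have "{x \<in> set xs. f x < s} \<subseteq> (!) xs ` {..<i}"
    proof
      fix x assume x: "x \<in> {x \<in> set xs. f x < s}"
      then obtain j where j: "j < length xs" "x = xs ! j" by (auto simp: in_set_conv_nth)
      then have "j < i" using neg x sorted_nth_le[of i j] by force
      then show "x \<in> (!) xs ` {..<i}" using j by blast
    qed
    then have "card {x \<in> set xs. f x < s} \<le> card ((!) xs ` {..<i})" by (intro card_mono) auto
    then show False using assms card_nth_image[of "{..<i}"] i by simp
  qed
qed

lemma nth_greater_of_card:
  assumes "i < length xs" "length xs - i \<le> card {x \<in> set xs. s < f x}" shows "s < f (xs ! i)"
proof (rule ccontr)
  assume neg: "\<not> s < f (xs ! i)"
  have "{x \<in> set xs. s < f x} \<subseteq> (!) xs ` {Suc i..<length xs}"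
  proof
    fix x assume x: "x \<in> {x \<in> set xs. s < f x}"
    then obtain j where j: "j < length xs" "x = xs ! j" by (auto simp: in_set_conv_nth)
    then have "i < j" using neg x sorted_nth_le[of j i] assms(1) by force
    then show "x \<in> (!) xs ` {Suc i..<length xs}" using j by auto
  qed
  then have "card {x \<in> set xs. s < f x} \<le> card ((!) xs ` {Suc i..<length xs})" by (intro card_mono) auto
  moreover have "card ((!) xs ` {Suc i..<length xs}) = length xs - Suc i"
    using card_nth_image[of "{Suc i..<length xs}"] by (simp add: subset_iff)
  ultimately show False using assms by simp
qed

end

lemma obtain_sorted_list:
  fixes f :: "'b \<Rightarrow> real"
  assumes "finite S"
  obtains xs where "set xs = S" "distinct xs" "sorted (map f xs)"
proof -
  obtain ys where ys: "set ys = S" "distinct ys" using finite_distinct_list[OF assms] by blast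
  then show ?thesis using that[of "sort_key f ys"] by simp
qed

text \<open>For \<open>c < \<delta>\<close>, \<open>M c\<close> counts the indices below
  \<open>P\<close> that are congruent to \<open>c\<close> modulo \<open>\<delta>\<close>; the
  formula is the ceiling of \<open>(P - c) / \<delta>\<close>.\<close>

lemma residue_class_decomposition:
  fixes P \<delta> :: nat assumes "0 < \<delta>"
  defines "M \<equiv> \<lambda>c. (P + \<delta> - 1 - c) div \<delta>"
  shows "c < \<delta> \<Longrightarrow> i < M c \<longleftrightarrow> c + i * \<delta> < P"
    and "(\<Sum>c<\<delta>. M c) = P"
    and "c < \<delta> \<Longrightarrow> c' < \<delta> \<Longrightarrow> c + i * \<delta> = c' + i' * \<delta> \<Longrightarrow> c = c' \<and> i = i'"
proof -
  show iff: "i < M c \<longleftrightarrow> c + i * \<delta> < P" if "c < \<delta>" for c i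
  proof -
    have "i < M c \<longleftrightarrow> Suc i * \<delta> \<le> P + \<delta> - 1 - c"
      unfolding M_def Suc_le_eq[symmetric] by (rule less_eq_div_iff_mult_less_eq[OF assms(1)])
    then show ?thesis using that by auto
  qed
  show uniq: "c = c' \<and> i = i'" if "c < \<delta>" "c' < \<delta>" "c + i * \<delta> = c' + i' * \<delta>" for c c' i i'
  proof -
    have "c = (c + i * \<delta>) mod \<delta>" "c' = (c' + i' * \<delta>) mod \<delta>" using that(1,2) by simp_all
    then have "c = c'" using that(3) by metis
    then show ?thesis using that(3) assms(1) by simp
  qed
  have "{..<P} = (\<Union>c<\<delta>. (\<lambda>i. c + i * \<delta>) ` {..<M c})"
  proof (intro equalityI subsetI)
    fix p assume "p \<in> {..<P}"
    then have p: "p mod \<delta> \<in> {..<\<delta>}" "p div \<delta> \<in> {..<M (p mod \<delta>)}"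
      using assms(1) iff[of "p mod \<delta>" "p div \<delta>"] by simp_all
    have "p = p mod \<delta> + p div \<delta> * \<delta>" by simp
    then have "p \<in> (\<lambda>i. p mod \<delta> + i * \<delta>) ` {..<M (p mod \<delta>)}" using p(2) by (rule image_eqI)
    then show "p \<in> (\<Union>c<\<delta>. (\<lambda>i. c + i * \<delta>) ` {..<M c})" by (rule UN_I[OF p(1)])
  qed (use iff in auto)
  also have "card \<dots> = (\<Sum>c<\<delta>. card ((\<lambda>i. c + i * \<delta>) ` {..<M c}))"
  proof (intro card_UN_disjoint ballI impI)
    fix c d assume cd: "c \<in> {..<\<delta>}" "d \<in> {..<\<delta>}" "c \<noteq> d"
    then have "c + i * \<delta> \<noteq> d + j * \<delta>" for i j using uniq[of c d i j] by auto
    then show "(\<lambda>i. c + i * \<delta>) ` {..<M c} \<inter> (\<lambda>i. d + i * \<delta>) ` {..<M d} = {}" by blast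
  qed simp_all
  also have "\<dots> = (\<Sum>c<\<delta>. M c)"
    using assms(1) by (intro sum.cong refl) (simp add: card_image inj_on_def)
  finally show "(\<Sum>c<\<delta>. M c) = P" by simp
qed

text \<open>Supplies parameters \<open>x + e\<close> and \<open>x - e\<close> beside an eigenvalue
  \<open>x\<close> that are not eigenvalues themselves and have none between them and
  \<open>x\<close>.\<close>

lemma finite_gap:
  fixes F :: "real set" and x :: real assumes "finite F"
  obtains e where "0 < e" "\<And>y. y \<in> F \<Longrightarrow> y \<noteq> x \<Longrightarrow> e < \<bar>y - x\<bar>"
proof -
  have "\<exists>e>0. \<forall>y\<in>F. y \<noteq> x \<longrightarrow> e < \<bar>y - x\<bar>" using assms
  proof (induction F rule: finite_induct)
    case empty then show ?case by (intro exI[of _ 1]) simp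
  next
    case (insert z F)
    then obtain e where e: "e > 0" "\<forall>y\<in>F. y \<noteq> x \<longrightarrow> e < \<bar>y - x\<bar>" by blast
    show ?case
    proof (cases "z = x")
      case True then show ?thesis using e by auto
    next
      case False then show ?thesis using e
        by (intro exI[of _ "min e (\<bar>z - x\<bar> / 2)"]) (auto simp: min_less_iff_disj)
    qed
  qed
  then show ?thesis using that by blast
qed

section \<open>Interlacing eigenvalues\<close>

context complex_vs begin

context
  fixes h g B
  assumes h: "hermitian_form h" and g: "hermitian_form g"
    and B: "finite B" "orthogonal_for B h" "orthogonal_for B g" "\<forall>b\<in>B. h b b \<noteq> 0"
begin

text \<open>
  If every positive eigenvector is interlaced with negative ones, list both kinds by increasing
  eigenvalue. With \<open>\<delta>\<close> more negative than positive eigenvectors, the \<open>i\<close>-th positive one lies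
  strictly between the negative ones of indices \<open>i\<close> and \<open>i + \<delta>\<close>, so that the indices in a residue
  class modulo \<open>\<delta>\<close> form an alternating chain.
\<close>

lemma isotropic_rank_interlacing:
  fixes r
  defines "r \<equiv> \<lambda>b. Re (g b b) / Re (h b b)"
  defines "Q \<equiv> {b \<in> B. Re (h b b) < 0}" and "P \<equiv> {b \<in> B. 0 < Re (h b b)}"
  assumes below: "\<And>p. p \<in> P \<Longrightarrow> card {b \<in> P. r b \<le> r p} \<le> card {b \<in> Q. r b < r p}"
    and above: "\<And>p. p \<in> P \<Longrightarrow> card {b \<in> P. r p \<le> r b} \<le> card {b \<in> Q. r p < r b}"
  shows "isotropic_rank (card P) (span B) h g"
proof -
  have fin: "finite P" "finite Q" using B(1) by (auto simp: P_def Q_def)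
  obtain ps where ps: "set ps = P" "distinct ps" "sorted (map r ps)"
    using obtain_sorted_list[OF fin(1)] by blast
  obtain qs where qs: "set qs = Q" "distinct qs" "sorted (map r qs)"
    using obtain_sorted_list[OF fin(2)] by blast
  let ?p = "length ps" and ?q = "length qs"
  define \<delta> where "\<delta> = ?q - ?p"
  have cP: "card P = ?p" using distinct_card[OF ps(2)] ps(1) by simp
  have left: "i < ?q \<and> r (qs ! i) < r (ps ! i)" if "i < ?p" for i
  proof -
    have "Suc i \<le> card {b \<in> P. r b \<le> r (ps ! i)}" using card_le_nth[OF ps(3,2) that] ps(1) by simp
    then have "i < card {b \<in> set qs. r b < r (ps ! i)}"
      using below[of "ps ! i"] that ps(1) qs(1) nth_mem[OF that] by simp
    then show ?thesis using nth_less_of_card[OF qs(3,2)] by blast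
  qed
  show ?thesis
  proof (cases "?p = 0")
    case True
    then show ?thesis using isotropic_rank_zero[OF h g B subspace_span] cP by simp
  next
    case False
    then have "?p - 1 < ?p" by simp
    then have "?p - 1 < ?q" using left by blast
    then have pq: "?p \<le> ?q" using False by linarith
    have right: "i + \<delta> < ?q \<and> r (ps ! i) < r (qs ! (i + \<delta>))" if "i < ?p" for i
    proof -
      have lt: "i + \<delta> < ?q" using that pq by (simp add: \<delta>_def)
      have "?p - i \<le> card {b \<in> P. r (ps ! i) \<le> r b}" using card_ge_nth[OF ps(3,2) that] ps(1) by simp
      then have "?q - (i + \<delta>) \<le> card {b \<in> set qs. r (ps ! i) < r b}"
        using above[of "ps ! i"] ps(1) qs(1) nth_mem[OF that] pq by (simp add: \<delta>_def)
      then show ?thesis using nth_greater_of_card[OF qs(3,2) lt] lt by blast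
    qed
    \<comment> \<open>With \<open>\<delta> = 0\<close>, \<open>r (qs ! 0)\<close> would lie strictly
      on both sides of \<open>r (ps ! 0)\<close>.\<close>
    have \<delta>: "0 < \<delta>"
    proof (rule ccontr)
      assume "\<not> 0 < \<delta>"
      then show False using left[of 0] right[of 0] False by simp
    qed
    define M where "M c = (?p + \<delta> - 1 - c) div \<delta>" for c
    note D = residue_class_decomposition(1,2)[OF \<delta>, where P = ?p, folded M_def]
      residue_class_decomposition(3)[OF \<delta>]
    \<comment> \<open>Positions \<open>2 * i\<close> and \<open>2 * i + 1\<close> carry the negative
      and the positive eigenvector of index \<open>c + i * \<delta>\<close>. Ending at the even
      position \<open>2 * M c\<close> gives one more negative vector than positive ones.\<close>
    define node where "node c j = (if even j then qs ! (c + j div 2 * \<delta>) else ps ! (c + j div 2 * \<delta>))"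
      for c j
    define C where "C c = node c ` {..2 * M c}" for c
    have qpd: "?q = ?p + \<delta>" using pq \<delta>_def by simp
    \<comment> \<open>The closing index \<open>c + M c * \<delta>\<close> is beyond the end of
      \<open>ps\<close> but still inside \<open>qs\<close>, which is longer by
      \<open>\<delta>\<close>.\<close>
    have qlt: "c + i * \<delta> < ?q" if "c < \<delta>" "i \<le> M c" for c i
    proof (cases i)
      case 0 then show ?thesis using that qpd by simp
    next
      case (Suc i')
      then have "c + i' * \<delta> < ?p" using D(1)[of c i'] that by simp
      then show ?thesis using Suc qpd by simp
    qed
    have nodeQ: "node c j \<in> Q" if "c < \<delta>" "j \<le> 2 * M c" "even j" for c j
    proof -
      have "j div 2 \<le> M c" using that by simp
      then have "c + j div 2 * \<delta> < ?q" using qlt[OF that(1)] by simp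
      then show ?thesis using that(3) qs(1) nth_mem by (fastforce simp: node_def)
    qed
    have oddlt: "c + j div 2 * \<delta> < ?p" if "c < \<delta>" "j \<le> 2 * M c" "odd j" for c j
    proof -
      have "j div 2 < M c" using that by (elim oddE) simp
      then show ?thesis using D(1)[OF that(1)] by blast
    qed
    have nodeP: "node c j \<in> P" if "c < \<delta>" "j \<le> 2 * M c" "odd j" for c j
      using oddlt[OF that] that(3) ps(1) nth_mem by (fastforce simp: node_def)
    have "isotropic_rank (M c) (span (C c)) h g" if c: "c < \<delta>" for c
      unfolding C_def
    proof (rule isotropic_rank_chain[OF h g B, where r = "\<lambda>j. r (node c j)"])
      fix j assume j: "j \<le> 2 * M c"
      show "node c j \<in> B" using nodeQ[OF c j] nodeP[OF c j] by (auto simp: P_def Q_def)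
      show "(-1) ^ j * Re (h (node c j) (node c j)) < 0"
        using nodeQ[OF c j] nodeP[OF c j] by (cases "even j") (auto simp: P_def Q_def)
      show "Re (g (node c j) (node c j)) = r (node c j) * Re (h (node c j) (node c j))"
        using nodeQ[OF c j] nodeP[OF c j] by (cases "even j") (auto simp: P_def Q_def r_def)
    next
      fix j assume j: "j < 2 * M c"
      show "r (node c j) < r (node c (Suc j))"
      proof (cases "even j")
        case True
        then obtain i where i: "j = 2 * i" by blast
        then have "c + i * \<delta> < ?p" using D(1)[OF c] j by simp
        then show ?thesis using left i by (simp add: node_def)
      next
        case False
        then obtain i where i: "j = 2 * i + 1" by (elim oddE)
        then have "i < M c" using j by simp
        then have "c + i * \<delta> < ?p" using D(1)[OF c] by blast
        then show ?thesis using right[of "c + i * \<delta>"] i by (simp add: node_def algebra_simps)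
      qed
    qed
    moreover have CB: "C c \<subseteq> B" if c: "c < \<delta>" for c
      using nodeQ[OF c] nodeP[OF c] by (auto simp: C_def P_def Q_def)
    moreover have "C c \<inter> C d = {}" if cd: "c < \<delta>" "d < \<delta>" "c \<noteq> d" for c d
    proof (rule ccontr)
      assume "C c \<inter> C d \<noteq> {}"
      then obtain i j where ij: "i \<le> 2 * M c" "j \<le> 2 * M d" "node c i = node d j"
        by (auto simp: C_def)
      have "P \<inter> Q = {}" by (auto simp: P_def Q_def)
      then have "node c i \<in> Q \<longleftrightarrow> even i" "node d j \<in> Q \<longleftrightarrow> even j"
        using nodeQ[OF cd(1) ij(1)] nodeP[OF cd(1) ij(1)] nodeQ[OF cd(2) ij(2)] nodeP[OF cd(2) ij(2)]
        by blast+
      then have par: "even i = even j" using ij(3) by simp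
      have "c + i div 2 * \<delta> = d + j div 2 * \<delta>"
      proof (cases "even i")
        case True
        then have "c + i div 2 * \<delta> < ?q" "d + j div 2 * \<delta> < ?q"
          using qlt[of c "i div 2"] qlt[of d "j div 2"] cd ij par by auto
        then show ?thesis using ij(3) True par nth_eq_iff_index_eq[OF qs(2)] by (simp add: node_def)
      next
        case False
        then show ?thesis
          using ij(3) par nth_eq_iff_index_eq[OF ps(2)] oddlt[OF cd(1) ij(1)] oddlt[OF cd(2) ij(2)]
          by (simp add: node_def)
      qed
      then show False using D(3)[OF cd(1,2)] cd(3) by blast
    qed
    ultimately have iso: "isotropic_rank (\<Sum>c<\<delta>. M c) (span (\<Union>c<\<delta>. C c)) h g"
      by (intro isotropic_rank_Union[OF h g B]) auto
    have "span (\<Union>c<\<delta>. C c) \<subseteq> span B" using CB by (intro span_mono) blast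
    then show ?thesis using iso D(2) cP unfolding isotropic_rank_def by (metis (no_types, lifting) order_trans)
  qed
qed

end

lemma isotropic_rank_mono:
  assumes "isotropic_rank m V h g" "k \<le> m" shows "isotropic_rank k V h g"
proof -
  obtain B where B: "B \<subseteq> V" "independent B" "finite B" "card B = m" "\<forall>x\<in>B. \<forall>y\<in>B. h x y = 0 \<and> g x y = 0"
    using assms(1) unfolding isotropic_rank_def by blast
  obtain C where "C \<subseteq> B" "card C = k" "finite C"
    using obtain_subset_with_card_n[of k B] assms(2) B(4) by blast
  moreover have "C \<subseteq> V" "independent C" "\<forall>x\<in>C. \<forall>y\<in>C. h x y = 0 \<and> g x y = 0"
    using B(1,5) independent_mono[OF B(2)] \<open>C \<subseteq> B\<close> by blast+
  ultimately show ?thesis unfolding isotropic_rank_def by blast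
qed

text \<open>The coefficient matrix with rows \<open>(x, y)\<close> and \<open>(- y, x)\<close> has
  determinant \<open>x\<^sup>2 + y\<^sup>2\<close>, so both pairs of forms have the same common
  zeros.\<close>

lemma isotropic_rank_pencil:
  assumes "isotropic_rank k V (pencil h g x y) (pencil h g (- y) x)" "x\<^sup>2 + y\<^sup>2 \<noteq> 0"
  shows "isotropic_rank k V h g"
proof -
  have "h v w = 0 \<and> g v w = 0" if "pencil h g x y v w = 0" "pencil h g (- y) x v w = 0" for v w
  proof -
    have e: "of_real x * h v w + of_real y * g v w = 0" "of_real (- y) * h v w + of_real x * g v w = 0"
      using that by (simp_all add: pencil_def)
    have n: "complex_of_real (x\<^sup>2 + y\<^sup>2) \<noteq> 0" using assms(2) by (metis of_real_eq_0_iff)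
    have "of_real (x\<^sup>2 + y\<^sup>2) * h v w = of_real x * (of_real x * h v w + of_real y * g v w)
        - of_real y * (of_real (- y) * h v w + of_real x * g v w)"
      by (simp add: algebra_simps power2_eq_square)
    moreover have "of_real (x\<^sup>2 + y\<^sup>2) * g v w = of_real y * (of_real x * h v w + of_real y * g v w)
        + of_real x * (of_real (- y) * h v w + of_real x * g v w)"
      by (simp add: algebra_simps power2_eq_square)
    ultimately have "of_real (x\<^sup>2 + y\<^sup>2) * h v w = 0" "of_real (x\<^sup>2 + y\<^sup>2) * g v w = 0"
      using e by simp_all
    then show ?thesis using n by (metis mult_eq_0_iff)
  qed
  moreover obtain B where "B \<subseteq> V" "independent B" "finite B" "card B = k"
    "\<forall>v\<in>B. \<forall>w\<in>B. pencil h g x y v w = 0 \<and> pencil h g (- y) x v w = 0"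
    using assms(1) unfolding isotropic_rank_def by blast
  ultimately show ?thesis unfolding isotropic_rank_def by (intro exI[of _ B]) blast
qed

end

section \<open>The theorem of Li and Sze\<close>

context complex_vs begin

lemma Re_pencil: "Re (pencil h g x y v w) = x * Re (h v w) + y * Re (g v w)"
  by (simp add: pencil_def)

lemma orthogonal_for_pencil:
  "orthogonal_for B h \<Longrightarrow> orthogonal_for B g \<Longrightarrow> orthogonal_for B (pencil h g x y)"
  by (simp add: orthogonal_for_def pencil_def)

context
  fixes h g B
  assumes h: "hermitian_form h" and g: "hermitian_form g"
    and B: "finite B" "orthogonal_for B h" "orthogonal_for B g" "\<forall>b\<in>B. h b b \<noteq> 0"
    and def: "\<And>v c. v \<in> span B \<Longrightarrow> v \<noteq> 0 \<Longrightarrow> (\<And>w. w \<in> span B \<Longrightarrow> g w v = c * h w v) \<Longrightarrow> h v v \<noteq> 0"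
begin

text \<open>Two eigenvectors with the same eigenvalue and values of opposite sign span a plane of
  eigenvectors on which the form is indefinite; it contains an isotropic eigenvector, which
  \<open>def\<close> excludes. Equality of eigenvalues is assumed for the rotated pair and has to be
  carried back to \<open>h\<close> and \<open>g\<close>.\<close>

lemma no_opposite_collision:
  assumes vw: "v \<in> B" "w \<in> B"
    and signs: "Re (pencil h g x y w w) < 0" "0 < Re (pencil h g x y v v)"
    and eq: "Re (pencil h g (- y) x v v) = \<rho> * Re (pencil h g x y v v)"
      "Re (pencil h g (- y) x w w) = \<rho> * Re (pencil h g x y w w)"
  shows False
proof -
  define e where "e b = Re (h b b)" for b
  define q where "q b = Re (g b b)" for b
  have he: "h b b = of_real (e b)" and gq: "g b b = of_real (q b)" for b
    using form_self_real[OF h, of b] form_self_real[OF g, of b] by (simp_all add: e_def q_def)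
  have e0: "e v \<noteq> 0" using B(4) vw he by auto
  have s: "x * e w + y * q w < 0" "0 < x * e v + y * q v" using signs by (simp_all add: Re_pencil e_def q_def)
  have lin: "(- y - \<rho> * x) * e b + (x - \<rho> * y) * q b = 0" if "b \<in> {v, w}" for b
    using eq that by (auto simp: Re_pencil e_def q_def algebra_simps)
  \<comment> \<open>A zero would mean an infinite eigenvalue of \<open>g\<close> relative to
    \<open>h\<close>, which is impossible because \<open>h v v\<close> is nonzero.\<close>
  have "x - \<rho> * y \<noteq> 0"
  proof
    assume x: "x - \<rho> * y = 0"
    then have "- y - \<rho> * x = 0" using lin[of v] e0 by simp
    moreover have "- y - \<rho> * x = - (1 + \<rho> * \<rho>) * y" using x by (simp add: algebra_simps)
    moreover have "1 + \<rho> * \<rho> > 0" by (simp add: add_pos_nonneg)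
    ultimately have "y = 0" by simp
    then show False using x s by simp
  qed
  then obtain c where c: "q v = c * e v" "q w = c * e w"
    using lin[of v] lin[of w] that[of "(y + \<rho> * x) / (x - \<rho> * y)"] by (simp add: field_simps)
  \<comment> \<open>With \<open>q = c * e\<close> at both vectors, the squares of \<open>a\<close>
    and \<open>b\<close> are \<open>- (x + y * c) * e w\<close> and
    \<open>(x + y * c) * e v\<close>; the two contributions to \<open>h z z\<close> then
    cancel.\<close>
  define a where "a = sqrt (- (x * e w + y * q w))"
  define b where "b = sqrt (x * e v + y * q v)"
  define z where "z = of_real a *s v + of_real b *s w"
  have ab: "a * a = - (x * e w + y * q w)" "b * b = x * e v + y * q v" "a \<noteq> 0"
    using s by (auto simp: a_def b_def)
  have ne: "v \<noteq> w" using signs by auto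
  have o: "h v w = 0" "h w v = 0" "g v w = 0" "g w v = 0"
    using ne vw orthogonal_forD[OF B(2)] orthogonal_forD[OF B(3)] by metis+
  have "h z z = of_real (a * a * e v + b * b * e w)"
    unfolding z_def by (simp add: form_simps[OF h] o he[of v] he[of w] algebra_simps)
  also have "a * a * e v + b * b * e w = 0" unfolding ab c by (simp add: algebra_simps)
  finally have hz: "h z z = 0" by simp
  have "h v z = of_real (a * e v)" unfolding z_def by (simp add: form_simps[OF h] o he[of v])
  then have z0: "z \<noteq> 0" using ab(3) e0 form_zero_right[OF h] by auto
  have zB: "z \<in> span B" unfolding z_def using vw by (intro span_add span_scale span_base)
  have onB: "g u z = of_real c * h u z" if u: "u \<in> B" for u
  proof -
    consider "u = v" | "u = w" | "u \<noteq> v" "u \<noteq> w" by blast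
    then show ?thesis
    proof cases
      case 1 then show ?thesis by (simp add: z_def form_simps[OF h] form_simps[OF g] o he gq c)
    next
      case 2 then show ?thesis by (simp add: z_def form_simps[OF h] form_simps[OF g] o he gq c)
    next
      case 3
      then have "h u v = 0" "h u w = 0" "g u v = 0" "g u w = 0"
        using vw u orthogonal_forD[OF B(2)] orthogonal_forD[OF B(3)] by metis+
      then show ?thesis by (simp add: z_def form_simps[OF h] form_simps[OF g])
    qed
  qed
  have "g u z = of_real c * h u z" if "u \<in> span B" for u
    using that
  proof (induction rule: span_induct_alt)
    case base then show ?case by (simp add: form_simps[OF h] form_simps[OF g])
  next
    case (step d u y) then show ?case
      using onB by (simp add: form_simps[OF h] form_simps[OF g] algebra_simps)
  qed
  then show False using def[OF zB z0] hz by blast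
qed

text \<open>A generic direction with the fewest positive diagonal entries is rotated into the role
  of \<open>h\<close>. Comparing it with the direction \<open>s h' - g'\<close> and its negative
  counts eigenvectors on either side of \<open>s\<close>; moving \<open>s\<close> just past an
  eigenvalue yields the interlacing counts. Positivity in every direction leaves at least
  \<open>k\<close> positive entries even at the minimum.\<close>

lemma isotropic_rank_definite:
  assumes pos: "\<And>x y. (x, y) \<noteq> (0, 0) \<Longrightarrow> positive_rank k (span B) (pencil h g x y)"
  shows "isotropic_rank k (span B) h g"
proof -
  define e where "e b = Re (h b b)" for b
  define q where "q b = Re (g b b)" for b
  define N where "N z = card {b \<in> B. 0 < fst z * e b + snd z * q b}" for z
  have kN: "k \<le> N z" if "z \<noteq> (0, 0)" for z
    using positive_rank_orthogonal_iff[OF h B(1,2,4) hermitian_pencil[OF h g]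
        orthogonal_for_pencil[OF B(2,3)], of k "fst z" "snd z"] pos[of "fst z" "snd z"] that
    by (simp add: N_def Re_pencil e_def q_def prod_eq_iff)
  let ?gen = "\<lambda>z. z \<noteq> (0, 0) \<and> (\<forall>b\<in>B. fst z * e b + snd z * q b \<noteq> 0)"
  have "?gen (1, 0)"
  proof -
    have "e b \<noteq> 0" if "b \<in> B" for b
      using B(4) that form_self_real[OF h, of b] by (auto simp: e_def)
    then show ?thesis by simp
  qed
  then obtain z where z: "?gen z" "\<And>z'. ?gen z' \<Longrightarrow> N z \<le> N z'"
    using ex_has_least_nat[of ?gen "(1, 0)" N] by blast
  obtain x y where xy: "z = (x, y)" by (cases z)
  let ?h = "pencil h g x y" and ?g = "pencil h g (- y) x"
  define e' where "e' b = x * e b + y * q b" for b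
  define q' where "q' b = - y * e b + x * q b" for b
  have e': "Re (?h b b) = e' b" "Re (?g b b) = q' b" for b
    by (simp_all add: Re_pencil e_def q_def e'_def q'_def)
  have e'0: "e' b \<noteq> 0" if "b \<in> B" for b using z(1) that xy by (simp add: e'_def)
  define r where "r b = q' b / e' b" for b
  have q'r: "q' b = r b * e' b" if "b \<in> B" for b using e'0[OF that] by (simp add: r_def)
  let ?P = "{b \<in> B. 0 < e' b}" and ?Q = "{b \<in> B. e' b < 0}"
  have NP: "N z = card ?P" by (simp add: N_def xy e'_def)
  \<comment> \<open>The competing direction is \<open>s * (x, y) - (- y, x)\<close>, with diagonal
    entries \<open>e' b * (s - r b)\<close>. It is generic as long as \<open>s\<close> is not an
    eigenvalue, and so is its negative.\<close>
  have count: "card ?P \<le> card {b \<in> B. 0 < e' b * (s - r b)}" "card ?P \<le> card {b \<in> B. e' b * (s - r b) < 0}"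
    if s: "s \<notin> r ` B" for s
  proof -
    have eqn: "(s * x + y) * e b + (s * y - x) * q b = e' b * (s - r b)" if "b \<in> B" for b
      using q'r[OF that] by (simp add: e'_def q'_def algebra_simps)
    have gen0: "e' b * (s - r b) \<noteq> 0" if "b \<in> B" for b using s e'0[OF that] that by auto
    have nz: "(s * x + y, s * y - x) \<noteq> (0, 0)"
    proof
      assume a: "(s * x + y, s * y - x) = (0, 0)"
      then have "x = s * y" and "s * x + y = 0" by auto
      then have "y * (s * s + 1) = 0" by (simp add: algebra_simps)
      moreover have "s * s + 1 > 0" by (simp add: add_nonneg_pos)
      ultimately have "y = 0" by simp
      then show False using a z(1) xy by simp
    qed
    have "?gen (s * x + y, s * y - x)" using nz eqn gen0 by simp
    moreover have eqn': "- (s * x + y) * e b + - (s * y - x) * q b = - (e' b * (s - r b))"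
      if "b \<in> B" for b
      using eqn[OF that] by (simp add: algebra_simps)
    then have "?gen (- (s * x + y), - (s * y - x))"
      using nz gen0 unfolding fst_conv snd_conv by (metis neg_equal_0_iff_equal prod.inject)
    moreover have "N (s * x + y, s * y - x) = card {b \<in> B. 0 < e' b * (s - r b)}"
      unfolding N_def using eqn by (intro arg_cong[where f = card] Collect_cong) auto
    moreover have "N (- (s * x + y), - (s * y - x)) = card {b \<in> B. e' b * (s - r b) < 0}"
      unfolding N_def fst_conv snd_conv using eqn'
      by (intro arg_cong[where f = card] Collect_cong) (metis neg_0_less_iff_less)
    ultimately show "card ?P \<le> card {b \<in> B. 0 < e' b * (s - r b)}"
      "card ?P \<le> card {b \<in> B. e' b * (s - r b) < 0}"
      using z(2) NP by metis+
  qed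
  have tie: "r w \<noteq> r v" if "v \<in> ?P" "w \<in> ?Q" for v w
    using no_opposite_collision[of v w x y "r v"] that q'r[of v] q'r[of w] e' by auto
  have fin: "finite (r ` B)" "finite B" using B(1) by auto
  have iso: "isotropic_rank (card ?P) (span B) ?h ?g"
  proof (rule isotropic_rank_interlacing[OF hermitian_pencil[OF h g, of x y] hermitian_pencil[OF h g, of "- y" x]
        fin(2) orthogonal_for_pencil[OF B(2,3)] orthogonal_for_pencil[OF B(2,3)], unfolded e', folded r_def])
    show "\<forall>b\<in>B. ?h b b \<noteq> 0" using e' e'0 by (metis complex_Re_numeral zero_complex.simps(1))
  next
    fix p assume p: "p \<in> ?P"
    obtain d where d: "0 < d" "\<And>t. t \<in> r ` B \<Longrightarrow> t \<noteq> r p \<Longrightarrow> d < \<bar>t - r p\<bar>"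
      using finite_gap[OF fin(1), of "r p"] by blast
    have d': "d < \<bar>r b - r p\<bar>" if "b \<in> B" "r b \<noteq> r p" for b using d(2) that by blast
    show "card {b \<in> ?P. r b \<le> r p} \<le> card {b \<in> ?Q. r b < r p}"
    proof -
      \<comment> \<open>No eigenvalue lies strictly between \<open>r p\<close> and this parameter.
        By \<open>tie\<close>, the entries counted as negative belong to positive vectors above
        \<open>r p\<close> or to negative vectors strictly below it.\<close>
      have "r p + d \<notin> r ` B" using d(1) d(2)[of "r p + d"] by auto
      then have c: "card ?P \<le> card {b \<in> B. e' b * (r p + d - r b) < 0}" using count(2) by blast
      have "{b \<in> B. e' b * (r p + d - r b) < 0} \<subseteq> {b \<in> ?P. r p < r b} \<union> {b \<in> ?Q. r b < r p}"
      proof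
        fix b assume "b \<in> {b \<in> B. e' b * (r p + d - r b) < 0}"
        then show "b \<in> {b \<in> ?P. r p < r b} \<union> {b \<in> ?Q. r b < r p}"
          using d(1) d'[of b] tie[OF p, of b] by (auto simp: mult_less_0_iff)
      qed
      then have "card ?P \<le> card ({b \<in> ?P. r p < r b} \<union> {b \<in> ?Q. r b < r p})"
        using fin(2) by (intro le_trans[OF c] card_mono) auto
      also have "\<dots> \<le> card {b \<in> ?P. r p < r b} + card {b \<in> ?Q. r b < r p}" by (rule card_Un_le)
      finally have "card ?P \<le> card {b \<in> ?P. r p < r b} + card {b \<in> ?Q. r b < r p}" .
      moreover have "card ?P = card {b \<in> ?P. r b \<le> r p} + card {b \<in> ?P. r p < r b}"
        using fin(2) by (subst card_Un_disjoint[symmetric]) (auto intro!: arg_cong[where f = card])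
      ultimately show ?thesis by simp
    qed
    show "card {b \<in> ?P. r p \<le> r b} \<le> card {b \<in> ?Q. r p < r b}"
    proof -
      have "r p - d \<notin> r ` B" using d(1) d(2)[of "r p - d"] by auto
      then have c: "card ?P \<le> card {b \<in> B. 0 < e' b * (r p - d - r b)}" using count(1) by blast
      have "{b \<in> B. 0 < e' b * (r p - d - r b)} \<subseteq> {b \<in> ?P. r b < r p} \<union> {b \<in> ?Q. r p < r b}"
      proof
        fix b assume "b \<in> {b \<in> B. 0 < e' b * (r p - d - r b)}"
        then show "b \<in> {b \<in> ?P. r b < r p} \<union> {b \<in> ?Q. r p < r b}"
          using d(1) d'[of b] tie[OF p, of b] by (auto simp: zero_less_mult_iff)
      qed
      then have "card ?P \<le> card ({b \<in> ?P. r b < r p} \<union> {b \<in> ?Q. r p < r b})"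
        using fin(2) by (intro le_trans[OF c] card_mono) auto
      also have "\<dots> \<le> card {b \<in> ?P. r b < r p} + card {b \<in> ?Q. r p < r b}" by (rule card_Un_le)
      finally have "card ?P \<le> card {b \<in> ?P. r b < r p} + card {b \<in> ?Q. r p < r b}" .
      moreover have "card ?P = card {b \<in> ?P. r p \<le> r b} + card {b \<in> ?P. r b < r p}"
        using fin(2) by (subst card_Un_disjoint[symmetric]) (auto intro!: arg_cong[where f = card])
      ultimately show ?thesis by simp
    qed
  qed
  have "k \<le> card ?P" using kN[of z] z(1) NP by simp
  moreover have "x\<^sup>2 + y\<^sup>2 \<noteq> 0" using z(1) xy by (simp add: sum_power2_eq_zero_iff)
  ultimately show ?thesis using isotropic_rank_pencil[OF isotropic_rank_mono[OF iso]] by blast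
qed

end

text \<open>
  A strict form of the theorem of Li and Sze on higher rank numerical ranges. Isotropic eigenvectors
  of the pencil are split off together with a hyperbolic partner; what remains is diagonalizable.
\<close>

theorem isotropic_rank_of_positive_pencil:
  assumes h: "hermitian_form h" and g: "hermitian_form g"
    and "subspace V" "dim_at_most d V" "nondegenerate_on h V"
    and "\<And>x y. (x, y) \<noteq> (0, 0) \<Longrightarrow> positive_rank k V (pencil h g x y)"
  shows "isotropic_rank k V h g"
  using assms(3-)
proof (induction d arbitrary: V k rule: less_induct)
  case (less d)
  show ?case
  proof (cases "\<exists>v c. v \<in> V \<and> v \<noteq> 0 \<and> (\<forall>w\<in>V. g w v = c * h w v) \<and> h v v = 0")
    case False
    then obtain B where B: "finite B" "span B = V" "orthogonal_for B h" "orthogonal_for B g" "\<forall>b\<in>B. h b b \<noteq> 0"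
      using orthogonal_eigenbasis[OF h g less.prems(1-3)] by blast
    show ?thesis using isotropic_rank_definite[OF h g B(1,3,4,5), of k] less.prems(4) False B(2) by blast
  next
    case True
    then obtain v c where v: "v \<in> V" "v \<noteq> 0" "h v v = 0" and eig: "\<And>w. w \<in> V \<Longrightarrow> g w v = c * h w v"
      by blast
    obtain y where y: "y \<in> V" "h y v \<noteq> 0" using less.prems(3) v unfolding nondegenerate_on_def by blast
    \<comment> \<open>The conjugate compensates the conjugate-linearity of \<open>h\<close> in its
      first argument.\<close>
    define u where "u = cnj (1 / h y v) *s y"
    have u: "u \<in> V" "h u v = 1" using y subspace_scale[OF less.prems(1)]
      by (auto simp: u_def form_scale_left[OF h])
    note P = h g less.prems(1) v(1,3) eig u
    show ?thesis
    proof (cases k)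
      case 0
      then show ?thesis using subspace_0 independent_empty unfolding isotropic_rank_def
        by (intro exI[of _ "{}"]) auto
    next
      case (Suc k')
      let ?W = "{w \<in> V. h v w = 0 \<and> h u w = 0}"
      have W: "subspace ?W" "v \<notin> ?W" "nondegenerate_on h ?W"
        using isotropic_pair_complement[OF P] less.prems(3) by blast+
      have "d \<noteq> 0"
      proof
        assume "d = 0"
        then have "card {v} \<le> 0" using less.prems(2) v dependent_single[of v]
          unfolding dim_at_most_def by (metis empty_subsetI insert_subset)
        then show False by simp
      qed
      then obtain d' where d': "d = Suc d'" using not0_implies_Suc by blast
      have "dim_at_most d' ?W"
        using dim_at_most_less[OF W(1) less.prems(2)[unfolded d'] _ v(1) W(2)] by blast
      moreover have "positive_rank k' ?W (pencil h g x y)" if "(x, y) \<noteq> (0, 0)" for x y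
        using positive_rank_restrict[OF P _ v(2)] less.prems(4)[OF that] Suc by blast
      ultimately have "isotropic_rank k' ?W h g" using less.IH[of d' ?W k'] W d' by simp
      then show ?thesis using isotropic_rank_lift[OF P] Suc by blast
    qed
  qed
qed

end

section \<open>Matrices and their numerical ranges\<close>

lemma kth_largest:
  fixes d :: "'b \<Rightarrow> real"
  assumes "finite C" "1 \<le> k" "k \<le> card C"
  obtains c where "c \<in> C" "\<And>t. k \<le> card {b \<in> C. t < d b} \<longleftrightarrow> t < d c"
proof -
  obtain xs where xs: "set xs = C" "distinct xs" "sorted (map d xs)" using obtain_sorted_list[OF assms(1)] by blast
  have len: "length xs = card C" using distinct_card[OF xs(2)] xs(1) by simp
  define i where "i = card C - k"
  have i: "i < length xs" "length xs - i = k" using assms len by (auto simp: i_def)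
  have "k \<le> card {b \<in> C. t < d b} \<longleftrightarrow> t < d (xs ! i)" for t
  proof
    assume "k \<le> card {b \<in> C. t < d b}"
    then show "t < d (xs ! i)" using nth_greater_of_card[OF xs(3,2) i(1), of t] i(2) xs(1) by simp
  next
    assume t: "t < d (xs ! i)"
    have "k \<le> card {b \<in> C. d (xs ! i) \<le> d b}" using card_ge_nth[OF xs(3,2) i(1)] i(2) xs(1) by simp
    also have "\<dots> \<le> card {b \<in> C. t < d b}" using t assms(1) by (intro card_mono) auto
    finally show "k \<le> card {b \<in> C. t < d b}" .
  qed
  then show ?thesis using that[of "xs ! i"] i(1) xs(1) nth_mem by blast
qed

context complex_vs begin

lemma positive_rank_mono:
  assumes "positive_rank k V p" "subspace V" "\<And>v. v \<in> V \<Longrightarrow> v \<noteq> 0 \<Longrightarrow> 0 < Re (p v v) \<Longrightarrow> 0 < Re (q v v)"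
  shows "positive_rank k V q"
proof -
  obtain B where B: "B \<subseteq> V" "independent B" "finite B" "card B = k" "\<forall>x\<in>span B. x \<noteq> 0 \<longrightarrow> 0 < Re (p x x)"
    using assms(1) unfolding positive_rank_def by blast
  then have "\<forall>x\<in>span B. x \<noteq> 0 \<longrightarrow> 0 < Re (q x x)"
    using assms(3) span_minimal[OF B(1) assms(2)] by blast
  then show ?thesis unfolding positive_rank_def using B by blast
qed

lemma positive_definite_nondegenerate:
  assumes "\<And>v. v \<in> V \<Longrightarrow> v \<noteq> 0 \<Longrightarrow> 0 < Re (s v v)" shows "nondegenerate_on s V"
  unfolding nondegenerate_on_def using assms by (metis less_irrefl zero_complex.simps(1))

text \<open>Diagonalize \<open>p\<close> relative to the positive definite \<open>s\<close>. By
  inertia the threshold is the \<open>k\<close>-th largest quotient of diagonal entries, and a basis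
  vector attaining it lies in the radical of the pencil at \<open>l\<close>. The set
  \<open>E\<close> certifies that the dimension is at least \<open>k\<close>.\<close>

lemma kth_eigenvalue:
  assumes s: "hermitian_form s" and p: "hermitian_form p" and V: "subspace V" "dim_at_most d V"
    and pos: "\<And>v. v \<in> V \<Longrightarrow> v \<noteq> 0 \<Longrightarrow> 0 < Re (s v v)"
    and E: "E \<subseteq> V" "independent E" and k: "1 \<le> k" "k \<le> card E"
  obtains l where "\<And>t. positive_rank k V (pencil p s 1 (- t)) \<longleftrightarrow> t < l"
    "\<not> nondegenerate_on (pencil p s 1 (- l)) V"
proof -
  have "s v v \<noteq> 0" if "v \<in> V" "v \<noteq> 0" for v using pos[OF that] by auto
  then obtain B where B: "finite B" "span B = V" "orthogonal_for B s" "orthogonal_for B p" "\<forall>b\<in>B. s b b \<noteq> 0"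
    using orthogonal_eigenbasis[OF s p V positive_definite_nondegenerate[OF pos]] by blast
  have BV: "B \<subseteq> V" using B(2) span_superset by blast
  have spos: "0 < Re (s b b)" if "b \<in> B" for b
    using B(5) that BV pos[of b] form_zero_left[OF s] by (metis subsetD)
  have kB: "k \<le> card B" using k(2) independent_span_bound[OF B(1) E(2)] E(1) B(2) by simp
  then obtain c where c: "c \<in> B"
    "\<And>t. k \<le> card {b \<in> B. t < Re (p b b) / Re (s b b)} \<longleftrightarrow> t < Re (p c c) / Re (s c c)"
    using kth_largest[OF B(1) k(1) kB, of "\<lambda>b. Re (p b b) / Re (s b b)"] by blast
  define l where "l = Re (p c c) / Re (s c c)"
  have herm: "hermitian_form (pencil p s 1 (- t))" for t using hermitian_pencil[OF p s] .
  have "positive_rank k V (pencil p s 1 (- t)) \<longleftrightarrow> t < l" for t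
  proof -
    have "{b \<in> B. 0 < Re (pencil p s 1 (- t) b b)} = {b \<in> B. t < Re (p b b) / Re (s b b)}"
      using spos by (auto simp: Re_pencil field_simps)
    then show ?thesis
      using positive_rank_orthogonal_iff[OF s B(1,3,5) herm orthogonal_for_pencil[OF B(4,3)], of k] c(2)[of t]
      unfolding B(2) l_def by simp
  qed
  moreover have "\<not> nondegenerate_on (pencil p s 1 (- l)) V"
  proof
    assume nd: "nondegenerate_on (pencil p s 1 (- l)) V"
    have zero: "pencil p s 1 (- l) b c = 0" if "b \<in> B" for b
    proof (cases "b = c")
      case True
      have "Re (pencil p s 1 (- l) c c) = 0" using spos[OF c(1)] by (simp add: Re_pencil l_def)
      then show ?thesis using form_self_real[OF herm, of l c] True by simp
    next
      case False
      then show ?thesis using orthogonal_forD[OF orthogonal_for_pencil[OF B(4,3)] that c(1)] by blast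
    qed
    have "pencil p s 1 (- l) v c = 0" if "v \<in> V" for v
      using form_span_zero[OF herm, of v B c "{c}"] that B(2) zero span_base[of c "{c}"] by simp
    then have "c = 0" using nd c(1) BV unfolding nondegenerate_on_def by blast
    then show False using spos[OF c(1)] form_zero_left[OF s] by simp
  qed
  ultimately show ?thesis using that by blast
qed

end

section \<open>Matrices as Hermitian forms on \<open>C^n\<close>\<close>

interpretation fun_space: complex_vs "\<lambda>(c::complex) (f :: nat \<Rightarrow> complex) i. c * f i"
  by unfold_locales (auto simp: fun_eq_iff algebra_simps)

text \<open>The model of \<open>C^n\<close> inside one fixed vector space that serves all
  dimensions.\<close>

definition vecs :: "nat \<Rightarrow> (nat \<Rightarrow> complex) set" where
  "vecs n = {f. \<forall>i\<ge>n. f i = 0}"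

definition mat_form :: "nat \<Rightarrow> complex mat \<Rightarrow> (nat \<Rightarrow> complex) \<Rightarrow> (nat \<Rightarrow> complex) \<Rightarrow> complex" where
  "mat_form n M v w = (\<Sum>i<n. \<Sum>j<n. cnj (v i) * M $$ (i, j) * w j)"

definition dot :: "nat \<Rightarrow> (nat \<Rightarrow> complex) \<Rightarrow> (nat \<Rightarrow> complex) \<Rightarrow> complex" where
  "dot n v w = (\<Sum>i<n. cnj (v i) * w i)"

lemma sum_fun_apply: "(\<Sum>i\<in>S. f i) x = (\<Sum>i\<in>S. f i x)"
  for f :: "'i \<Rightarrow> 'a \<Rightarrow> 'b::comm_monoid_add"
  by (induction S rule: infinite_finite_induct) simp_all

lemma hermitian_mat_form:
  assumes "\<And>i j. i < n \<Longrightarrow> j < n \<Longrightarrow> cnj (M $$ (i, j)) = M $$ (j, i)"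
  shows "fun_space.hermitian_form (mat_form n M)"
  unfolding fun_space.hermitian_form_def
proof (intro conjI allI)
  fix v w
  have "cnj (mat_form n M v w) = (\<Sum>i<n. \<Sum>j<n. cnj (w j) * M $$ (j, i) * v i)"
    unfolding mat_form_def cnj_sum using assms by (intro sum.cong refl) (auto simp: mult_ac)
  then show "mat_form n M w v = cnj (mat_form n M v w)"
    unfolding mat_form_def by (subst sum.swap) simp
qed (simp_all add: mat_form_def sum_distrib_left sum.distrib algebra_simps)

lemma hermitian_dot: "fun_space.hermitian_form (dot n)"
  by (simp add: fun_space.hermitian_form_def dot_def sum.distrib sum_distrib_left algebra_simps)

lemma dot_self: "dot n v v = of_real (\<Sum>i<n. (cmod (v i))\<^sup>2)"
  unfolding dot_def of_real_sum by (intro sum.cong refl) (metis complex_norm_square mult.commute)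

lemma dot_pos: "v \<in> vecs n \<Longrightarrow> v \<noteq> 0 \<Longrightarrow> 0 < Re (dot n v v)"
proof -
  assume v: "v \<in> vecs n" "v \<noteq> 0"
  then obtain i where i: "v i \<noteq> 0" by (auto simp: fun_eq_iff)
  then have "i < n" using v(1) unfolding vecs_def by (metis (mono_tags) mem_Collect_eq not_le)
  then have "0 < (\<Sum>i<n. (cmod (v i))\<^sup>2)" using i by (intro sum_pos2[of _ i]) auto
  then show ?thesis by (simp add: dot_self)
qed

lemma subspace_vecs: "fun_space.subspace (vecs n)"
  by (auto simp: fun_space.subspace_def vecs_def)

definition unit_fun :: "nat \<Rightarrow> nat \<Rightarrow> complex" where
  "unit_fun i j = (if j = i then 1 else 0)"

lemma vecs_expansion: "v \<in> vecs n \<Longrightarrow> v = (\<Sum>i<n. (\<lambda>j. v i * unit_fun i j))"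
proof
  fix j assume "v \<in> vecs n"
  then show "v j = (\<Sum>i<n. (\<lambda>j. v i * unit_fun i j)) j"
    unfolding sum_fun_apply by (auto simp: unit_fun_def vecs_def if_distrib cong: if_cong)
qed

lemma unit_basis:
  "unit_fun ` {..<n} \<subseteq> vecs n" "fun_space.independent (unit_fun ` {..<n})" "card (unit_fun ` {..<n}) = n"
proof -
  show "unit_fun ` {..<n} \<subseteq> vecs n" by (auto simp: vecs_def unit_fun_def)
  have *: "\<forall>t<n. c t = 0" if "(\<Sum>t<n. (\<lambda>j. c t * unit_fun t j)) = 0" for c
  proof (intro allI impI)
    fix t assume "t < n"
    have "(\<Sum>t<n. (\<lambda>j. c t * unit_fun t j)) t = (\<Sum>i<n. c i * unit_fun i t)" by (simp add: sum_fun_apply)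
    then show "c t = 0" using that \<open>t < n\<close> by (simp add: unit_fun_def if_distrib cong: if_cong)
  qed
  note I = fun_space.independent_familyI[of unit_fun n, OF *]
  show "fun_space.independent (unit_fun ` {..<n})" using I by simp
  show "card (unit_fun ` {..<n}) = n" using card_image[OF I(1)] by simp
qed

lemma vecs_span: "vecs n \<subseteq> fun_space.span (unit_fun ` {..<n})"
proof
  fix v assume "v \<in> vecs n"
  then show "v \<in> fun_space.span (unit_fun ` {..<n})"
    by (subst vecs_expansion, assumption)
      (intro fun_space.span_sum fun_space.span_scale fun_space.span_base imageI)
qed

lemma dim_vecs: "fun_space.dim_at_most n (vecs n)"
  using fun_space.dim_at_most_span[OF _ vecs_span, of n] unit_basis(3)[of n] by simp

lemma mat_form_unit:
  assumes "M \<in> carrier_mat n n" "i < n"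
  shows "mat_form n M (unit_fun i) w = (M *\<^sub>v vec n w) $ i"
proof -
  have "mat_form n M (unit_fun i) w = (\<Sum>i'<n. if i' = i then (\<Sum>j<n. M $$ (i, j) * w j) else 0)"
    unfolding mat_form_def by (intro sum.cong refl) (simp add: unit_fun_def)
  also have "\<dots> = (\<Sum>j<n. M $$ (i, j) * w j)" using assms by simp
  finally show ?thesis using assms by (simp add: scalar_prod_def atLeast0LessThan)
qed

lemma det_nonzero_imp_nondegenerate:
  assumes M: "M \<in> carrier_mat n n" and det: "det M \<noteq> 0"
  shows "fun_space.nondegenerate_on (mat_form n M) (vecs n)"
  unfolding fun_space.nondegenerate_on_def
proof (intro ballI impI)
  fix v assume v: "v \<in> vecs n" and 0: "\<forall>w\<in>vecs n. mat_form n M w v = 0"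
  have "M *\<^sub>v vec n v = 0\<^sub>v n"
  proof (intro eq_vecI)
    fix i assume "i < dim_vec (0\<^sub>v n :: complex vec)"
    then have "i < n" by simp
    then show "(M *\<^sub>v vec n v) $ i = 0\<^sub>v n $ i"
      using mat_form_unit[OF M, of i v] 0 unit_basis(1)[of n] by force
  qed (use M in simp)
  then have "vec n v = 0\<^sub>v n" using det_0_iff_vec_prod_zero[OF M] det vec_carrier by blast
  then have "v i = 0" if "i < n" for i using that by (metis index_vec index_zero_vec(1))
  then show "v = 0" using v by (auto simp: vecs_def fun_eq_iff not_less[symmetric])
qed

lemma degenerate_imp_det_zero:
  assumes "M \<in> carrier_mat n n" "\<not> fun_space.nondegenerate_on (mat_form n M) (vecs n)"
  shows "det M = 0"
  using assms det_nonzero_imp_nondegenerate by blast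

lemma re_im_mat:
  assumes A: "A \<in> carrier_mat n n"
  shows "re_mat A \<in> carrier_mat n n" "im_mat A \<in> carrier_mat n n"
    and "i < n \<Longrightarrow> j < n \<Longrightarrow> re_mat A $$ (i, j) = (A $$ (i, j) + cnj (A $$ (j, i))) / 2"
    and "i < n \<Longrightarrow> j < n \<Longrightarrow> im_mat A $$ (i, j) = - (\<i> / 2) * (A $$ (i, j) - cnj (A $$ (j, i)))"
proof -
  have adj: "mat_adjoint A \<in> carrier_mat n n" using A by (auto simp: mat_adjoint_def)
  show "re_mat A \<in> carrier_mat n n" "im_mat A \<in> carrier_mat n n"
    using A adj by (auto simp: re_mat_def im_mat_def)
  show "re_mat A $$ (i, j) = (A $$ (i, j) + cnj (A $$ (j, i))) / 2"
    "im_mat A $$ (i, j) = - (\<i> / 2) * (A $$ (i, j) - cnj (A $$ (j, i)))" if "i < n" "j < n"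
    using A adj that mat_adjoint_index[OF A that] by (simp_all add: re_mat_def im_mat_def field_simps)
qed

lemma hermitian_re_im:
  assumes A: "A \<in> carrier_mat n n"
  shows "fun_space.hermitian_form (mat_form n (re_mat A))" "fun_space.hermitian_form (mat_form n (im_mat A))"
proof -
  have "cnj (re_mat A $$ (i, j)) = re_mat A $$ (j, i)" "cnj (im_mat A $$ (i, j)) = im_mat A $$ (j, i)"
    if "i < n" "j < n" for i j
    unfolding re_im_mat(3,4)[OF A that] re_im_mat(3,4)[OF A that(2,1)] by (simp_all add: algebra_simps)
  then show "fun_space.hermitian_form (mat_form n (re_mat A))" "fun_space.hermitian_form (mat_form n (im_mat A))"
    by (intro hermitian_mat_form; simp)+
qed

lemma mat_form_adjoint_parts:
  assumes A: "A \<in> carrier_mat n n"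
  shows "mat_form n A v w = mat_form n (re_mat A) v w + \<i> * mat_form n (im_mat A) v w"
    and "mat_form n (re_mat A) v w = (mat_form n A v w + cnj (mat_form n A w v)) / 2"
    and "mat_form n (im_mat A) v w = - (\<i> / 2) * (mat_form n A v w - cnj (mat_form n A w v))"
proof -
  have c: "cnj (mat_form n A w v) = (\<Sum>i<n. \<Sum>j<n. cnj (v i) * cnj (A $$ (j, i)) * w j)"
    unfolding mat_form_def cnj_sum by (subst sum.swap) (simp add: mult_ac)
  show 2: "mat_form n (re_mat A) v w = (mat_form n A v w + cnj (mat_form n A w v)) / 2"
    unfolding c unfolding mat_form_def sum.distrib[symmetric] sum_divide_distrib
    by (intro sum.cong refl) (simp add: re_im_mat(3)[OF A] algebra_simps)
  show 3: "mat_form n (im_mat A) v w = - (\<i> / 2) * (mat_form n A v w - cnj (mat_form n A w v))"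
    unfolding c unfolding mat_form_def sum_subtractf[symmetric] sum_distrib_left
    by (intro sum.cong refl) (simp add: re_im_mat(4)[OF A] algebra_simps)
  show "mat_form n A v w = mat_form n (re_mat A) v w + \<i> * mat_form n (im_mat A) v w"
    unfolding 2 3 by (simp add: field_simps)
qed

lemma mat_adjoint_rect:
  fixes X :: "complex mat"
  assumes "X \<in> carrier_mat n k"
  shows "mat_adjoint X \<in> carrier_mat k n"
    and "i < k \<Longrightarrow> j < n \<Longrightarrow> mat_adjoint X $$ (i, j) = cnj (X $$ (j, i))"
  using assms by (auto simp: mat_adjoint_def mat_of_rows_def)

lemma adjoint_product_entries:
  fixes X A :: "complex mat" and n :: nat
  defines "col' \<equiv> \<lambda>X j i. if i < n then X $$ (i, j) else 0"
  assumes X: "X \<in> carrier_mat n k" and A: "A \<in> carrier_mat n n" and jl: "j < k" "l < k"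
  shows "(mat_adjoint X * X) $$ (j, l) = dot n (col' X j) (col' X l)"
    and "(mat_adjoint X * A * X) $$ (j, l) = mat_form n A (col' X j) (col' X l)"
proof -
  note adj = mat_adjoint_rect[OF X]
  show "(mat_adjoint X * X) $$ (j, l) = dot n (col' X j) (col' X l)"
    using X adj jl by (simp add: scalar_prod_def dot_def col'_def atLeast0LessThan)
  have "(mat_adjoint X * A * X) $$ (j, l) =
      (\<Sum>i<n. cnj (X $$ (i, j)) * (\<Sum>m<n. A $$ (i, m) * X $$ (m, l)))"
    using X A adj jl by (simp add: scalar_prod_def atLeast0LessThan)
  also have "\<dots> = mat_form n A (col' X j) (col' X l)"
    unfolding mat_form_def sum_distrib_left by (simp add: col'_def mult.assoc)
  finally show "(mat_adjoint X * A * X) $$ (j, l) = mat_form n A (col' X j) (col' X l)" .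
qed

text \<open>The value at a real point of the matrix whose determinant is the Kippenhahn
  polynomial.\<close>

definition char_mat :: "complex mat \<Rightarrow> real \<Rightarrow> real \<Rightarrow> real \<Rightarrow> complex mat" where
  "char_mat A t x y = of_real t \<cdot>\<^sub>m 1\<^sub>m (dim_row A) + of_real x \<cdot>\<^sub>m re_mat A + of_real y \<cdot>\<^sub>m im_mat A"

context
  fixes A :: "complex mat" and n :: nat
  assumes A: "A \<in> carrier_mat n n"
begin

abbreviation "re_form \<equiv> mat_form n (re_mat A)"
abbreviation "im_form \<equiv> mat_form n (im_mat A)"
abbreviation "re_shift a \<equiv> fun_space.pencil re_form (dot n) 1 (- a)"
abbreviation "im_shift b \<equiv> fun_space.pencil im_form (dot n) 1 (- b)"
abbreviation "pencil_shift t x y \<equiv> fun_space.pencil (fun_space.pencil re_form im_form x y) (dot n) 1 t"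

lemmas hermitian_parts = hermitian_re_im[OF A]

lemma hermitian_shift:
  "fun_space.hermitian_form (re_shift a)" "fun_space.hermitian_form (im_shift b)"
  "fun_space.hermitian_form (pencil_shift t x y)"
  by (intro fun_space.hermitian_pencil hermitian_parts hermitian_dot)+

lemma char_mat_carrier: "char_mat A t x y \<in> carrier_mat n n"
  using A re_im_mat(1,2)[OF A] by (simp add: char_mat_def)

lemma pencil_shift_eq: "pencil_shift t x y = mat_form n (char_mat A t x y)"
proof (intro ext)
  fix v w
  have "dot n v w = (\<Sum>i<n. \<Sum>j<n. cnj (v i) * (if i = j then 1 else 0) * w j)"
    unfolding dot_def by (intro sum.cong refl) (simp add: if_distrib if_distribR cong: if_cong)
  moreover have "char_mat A t x y $$ (i, j) =
      of_real t * (if i = j then 1 else 0) + of_real x * re_mat A $$ (i, j) + of_real y * im_mat A $$ (i, j)"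
    if "i < n" "j < n" for i j
    using that A re_im_mat(1,2)[OF A] by (simp add: char_mat_def)
  ultimately show "pencil_shift t x y v w = mat_form n (char_mat A t x y) v w"
    unfolding fun_space.pencil_def mat_form_def
    by (simp only: sum_distrib_left sum.distrib[symmetric])
      (intro sum.cong refl; simp add: algebra_simps)
qed

text \<open>This is where the dual line enters: the pencil of the two shifted forms consists of the
  forms at the points of \<open>t + a * x + b * y = 0\<close>.\<close>

lemma pencil_shift_shift:
  "fun_space.pencil (re_shift a) (im_shift b) x y = pencil_shift (- (a * x + b * y)) x y"
  by (intro ext) (simp add: fun_space.pencil_def algebra_simps)

text \<open>Taking Hermitian and skew-Hermitian parts of the compression shows that
  \<open>re_mat A\<close> and \<open>im_mat A\<close> compress to \<open>a\<close> and
  \<open>b\<close> times the identity. The columns of \<open>X\<close> are independent because they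
  are orthonormal.\<close>

lemma rank_numerical_range_imp_isotropic:
  assumes "Complex a b \<in> rank_numerical_range k A"
  shows "fun_space.isotropic_rank k (vecs n) (re_shift a) (im_shift b)"
proof -
  obtain X where X: "X \<in> carrier_mat n k" "mat_adjoint X * X = 1\<^sub>m k"
    "mat_adjoint X * A * X = Complex a b \<cdot>\<^sub>m 1\<^sub>m k"
    using assms A by (auto simp: rank_numerical_range_def)
  define x where "x j i = (if i < n then X $$ (i, j) else 0)" for j i
  have d: "dot n (x j) (x l) = (if j = l then 1 else 0)" if "j < k" "l < k" for j l
    using adjoint_product_entries(1)[OF X(1) A that] X(2) that by (simp add: x_def[abs_def])
  have m: "mat_form n A (x j) (x l) = (if j = l then Complex a b else 0)" if "j < k" "l < k" for j l
    unfolding x_def[abs_def] adjoint_product_entries(2)[OF X(1) A that, symmetric] X(3) using that by simp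
  have 0: "re_shift a (x j) (x l) = 0 \<and> im_shift b (x j) (x l) = 0" if "j < k" "l < k" for j l
    using d[OF that] m[OF that] m[OF that(2,1)]
    by (auto simp: fun_space.pencil_def mat_form_adjoint_parts(2,3)[OF A] complex_eq_iff)
  have *: "\<forall>t<k. c t = 0" if c: "(\<Sum>t<k. (\<lambda>j. c t * x t j)) = 0" for c
  proof (intro allI impI)
    fix t assume t: "t < k"
    have "dot n (x t) (\<Sum>u<k. (\<lambda>j. c u * x u j)) = (\<Sum>u<k. c u * dot n (x t) (x u))"
      unfolding fun_space.form_sum_right[OF hermitian_dot] fun_space.form_scale_right[OF hermitian_dot] ..
    also have "\<dots> = (\<Sum>u<k. if u = t then c t else 0)" using d t by (intro sum.cong) auto
    also have "\<dots> = c t" using t by simp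
    finally show "c t = 0" using c fun_space.form_zero_right[OF hermitian_dot] by simp
  qed
  note I = fun_space.independent_familyI[of x k, OF *]
  have "x j \<in> vecs n" for j by (simp add: vecs_def x_def)
  then show ?thesis unfolding fun_space.isotropic_rank_def
    using I 0 card_image[OF I(1)] by (intro exI[of _ "x ` {..<k}"]) auto
qed

text \<open>Both shifted forms vanish on the whole span of \<open>B\<close>, so \<open>B\<close> may
  be replaced by an orthonormal basis of that span, whose vectors become the columns of
  \<open>X\<close>.\<close>

lemma isotropic_imp_rank_numerical_range:
  assumes "fun_space.isotropic_rank k (vecs n) (re_shift a) (im_shift b)"
  shows "Complex a b \<in> rank_numerical_range k A"
proof -
  obtain B where B: "B \<subseteq> vecs n" "fun_space.independent B" "finite B" "card B = k"
    "\<forall>v\<in>B. \<forall>w\<in>B. re_shift a v w = 0 \<and> im_shift b v w = 0"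
    using assms unfolding fun_space.isotropic_rank_def by blast
  let ?V = "fun_space.span B"
  have V: "?V \<subseteq> vecs n" using fun_space.span_minimal[OF B(1) subspace_vecs] .
  have pos: "0 < Re (dot n v v)" if "v \<in> ?V" "v \<noteq> 0" for v using dot_pos V that by blast
  have 0: "re_shift a v w = 0" "im_shift b v w = 0" if "v \<in> ?V" "w \<in> ?V" for v w
    using fun_space.form_span_zero[OF hermitian_shift(1) that] fun_space.form_span_zero[OF hermitian_shift(2) that] B(5)
    by blast+
  have "dot n v v \<noteq> 0" if "v \<in> ?V" "v \<noteq> 0" for v using pos[OF that] by auto
  \<comment> \<open>An eigenbasis for \<open>dot n\<close> paired with itself is an orthogonal
    basis; this takes the place of Gram-Schmidt.\<close>
  then have "\<exists>C. finite C \<and> fun_space.span C = ?V \<and> fun_space.orthogonal_for C (dot n) \<and>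
      fun_space.orthogonal_for C (dot n) \<and> (\<forall>c\<in>C. dot n c c \<noteq> 0)"
    by (intro fun_space.orthogonal_eigenbasis[OF hermitian_dot hermitian_dot fun_space.subspace_span
        fun_space.dim_at_most_span[OF B(3) subset_refl]]
        fun_space.positive_definite_nondegenerate pos)
  then obtain C where C: "finite C" "fun_space.span C = ?V" "fun_space.orthogonal_for C (dot n)"
    "\<forall>c\<in>C. dot n c c \<noteq> 0" by blast
  have indC: "fun_space.independent C" using fun_space.orthogonal_independent[OF hermitian_dot C(1,3,4)] .
  have "card C = k"
    using fun_space.independent_span_bound[OF C(1) B(2)] fun_space.independent_span_bound[OF B(3) indC]
      C(2) B(4) fun_space.span_superset[of B] fun_space.span_superset[of C] by simp
  then obtain cs where cs: "set cs = C" "distinct cs" "length cs = k"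
    using finite_distinct_list[OF C(1)] distinct_card by metis
  define s where "s j = sqrt (Re (dot n (cs ! j) (cs ! j)))" for j
  define X where "X = mat n k (\<lambda>(i, j). (1 / of_real (s j)) * (cs ! j) i)"
  have X: "X \<in> carrier_mat n k" by (simp add: X_def)
  define x where "x j i = (if i < n then X $$ (i, j) else 0)" for j i
  have csC: "cs ! j \<in> C" if "j < k" for j using cs that by auto
  have xj: "x j = (\<lambda>i. (1 / of_real (s j)) * (cs ! j) i)" if "j < k" for j
  proof
    fix i
    have "cs ! j \<in> vecs n" using csC[OF that] C(2) V fun_space.span_superset by blast
    then show "x j i = (1 / of_real (s j)) * (cs ! j) i" using that by (simp add: x_def X_def vecs_def)
  qed
  have xV: "x j \<in> ?V" if "j < k" for j
    unfolding xj[OF that] C(2)[symmetric] using csC[OF that]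
    by (intro fun_space.span_scale fun_space.span_base)
  have d: "dot n (x j) (x l) = (if j = l then 1 else 0)" if jl: "j < k" "l < k" for j l
  proof -
    have e: "dot n (x j) (x l) = cnj (1 / of_real (s j)) * ((1 / of_real (s l)) * dot n (cs ! j) (cs ! l))"
      unfolding xj[OF jl(1)] xj[OF jl(2)]
      by (simp only: fun_space.form_scale_left[OF hermitian_dot] fun_space.form_scale_right[OF hermitian_dot])
    show ?thesis
    proof (cases "j = l")
      case True
      have "0 < Re (dot n (cs ! j) (cs ! j))"
        using pos[of "cs ! j"] csC[OF jl(1)] C(2,4) fun_space.span_superset[of C]
          fun_space.form_zero_left[OF hermitian_dot] by (metis subsetD)
      then have "s j * s j = Re (dot n (cs ! j) (cs ! j))" "s j \<noteq> 0" by (auto simp: s_def)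
      then have "dot n (cs ! j) (cs ! j) = of_real (s j) * of_real (s j)"
        using fun_space.form_self_real[OF hermitian_dot, of n "cs ! j"] by (metis of_real_mult)
      then show ?thesis using e True \<open>s j \<noteq> 0\<close> by simp
    next
      case False
      then have "cs ! j \<noteq> cs ! l" using cs jl nth_eq_iff_index_eq[OF cs(2)] by simp
      then show ?thesis
        using e False fun_space.orthogonal_forD[OF C(3) csC[OF jl(1)] csC[OF jl(2)]] by simp
    qed
  qed
  have m: "mat_form n A (x j) (x l) = (if j = l then Complex a b else 0)" if jl: "j < k" "l < k" for j l
    using 0[OF xV[OF jl(1)] xV[OF jl(2)]] d[OF jl]
    by (auto simp: fun_space.pencil_def mat_form_adjoint_parts(1)[OF A, of "x j" "x l"] complex_eq_iff)
  have XX: "(mat_adjoint X * X) $$ (j, l) = dot n (x j) (x l)"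
    "(mat_adjoint X * A * X) $$ (j, l) = mat_form n A (x j) (x l)" if "j < k" "l < k" for j l
    unfolding x_def[abs_def] by (rule adjoint_product_entries[OF X A that])+
  note adj = mat_adjoint_rect(1)[OF X]
  have "mat_adjoint X * X = 1\<^sub>m k"
    using X adj d by (intro eq_matI) (simp_all add: XX(1) del: index_mult_mat(1))
  moreover have "mat_adjoint X * A * X = Complex a b \<cdot>\<^sub>m 1\<^sub>m k"
    using X A adj m by (intro eq_matI) (simp_all add: XX(2) del: index_mult_mat(1) assoc_mult_mat)
  ultimately show ?thesis using X A by (auto simp: rank_numerical_range_def)
qed

lemma mat_form_bounded:
  obtains c where "0 \<le> c" "\<And>v. \<bar>Re (mat_form n M v v)\<bar> \<le> c * Re (dot n v v)"
proof -
  define c where "c = (\<Sum>i<n. \<Sum>j<n. cmod (M $$ (i, j)))"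
  have "\<bar>Re (mat_form n M v v)\<bar> \<le> c * Re (dot n v v)" for v
  proof -
    have D: "Re (dot n v v) = (\<Sum>i<n. (cmod (v i))\<^sup>2)" by (simp add: dot_self)
    have le: "(cmod (v i))\<^sup>2 \<le> Re (dot n v v)" if "i < n" for i
      unfolding D using that by (intro member_le_sum) auto
    have "cmod (cnj (v i) * M $$ (i, j) * v j) \<le> cmod (M $$ (i, j)) * Re (dot n v v)" if "i < n" "j < n" for i j
    proof -
      have "0 \<le> (cmod (v i) - cmod (v j))\<^sup>2" by simp
      then have "2 * (cmod (v i) * cmod (v j)) \<le> (cmod (v i))\<^sup>2 + (cmod (v j))\<^sup>2"
        by (simp add: power2_diff algebra_simps)
      then have "cmod (v i) * cmod (v j) \<le> Re (dot n v v)" using le[OF that(1)] le[OF that(2)] by simp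
      then have "cmod (M $$ (i, j)) * (cmod (v i) * cmod (v j)) \<le> cmod (M $$ (i, j)) * Re (dot n v v)"
        by (intro mult_left_mono) simp_all
      then show ?thesis by (simp add: norm_mult mult_ac)
    qed
    then have "cmod (mat_form n M v v) \<le> (\<Sum>i<n. \<Sum>j<n. cmod (M $$ (i, j)) * Re (dot n v v))"
      unfolding mat_form_def by (intro order_trans[OF norm_sum] sum_mono) auto
    also have "\<dots> = c * Re (dot n v v)" by (simp add: c_def sum_distrib_right)
    finally show ?thesis using abs_Re_le_cmod order_trans by blast
  qed
  then show ?thesis using that[of c] by (simp add: c_def sum_nonneg)
qed

section \<open>The k-th largest eigenvalue as a function of the direction\<close>

context
  fixes k :: nat assumes k: "1 \<le> k" "k \<le> n"
begin

text \<open>\<open>L z\<close> is the \<open>k\<close>-th largest eigenvalue of the Hermitian matrix \<open>Re z \<cdot> \<Re>(A) + Im z \<cdot> \<Im>(A)\<close>.\<close>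

lemma kth_eigenvalue_function:
  obtains L :: "complex \<Rightarrow> real" where
    "\<And>z t. fun_space.positive_rank k (vecs n) (pencil_shift (- t) (Re z) (Im z)) \<longleftrightarrow> t < L z"
    "\<And>z. det (char_mat A (- L z) (Re z) (Im z)) = 0"
proof -
  have "\<exists>l. (\<forall>t. fun_space.positive_rank k (vecs n) (pencil_shift (- t) (Re z) (Im z)) \<longleftrightarrow> t < l) \<and>
      det (char_mat A (- l) (Re z) (Im z)) = 0" for z
  proof -
    obtain l where "\<And>t. fun_space.positive_rank k (vecs n) (pencil_shift (- t) (Re z) (Im z)) \<longleftrightarrow> t < l"
      "\<not> fun_space.nondegenerate_on (pencil_shift (- l) (Re z) (Im z)) (vecs n)"
      using fun_space.kth_eigenvalue[OF hermitian_dot fun_space.hermitian_pencil[OF hermitian_parts, of "Re z" "Im z"] subspace_vecs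
          dim_vecs dot_pos unit_basis(1,2)[of n] k(1)] unit_basis(3)[of n] k(2) by auto
    then show ?thesis using degenerate_imp_det_zero[OF char_mat_carrier] unfolding pencil_shift_eq by blast
  qed
  then show ?thesis using that by metis
qed

context
  fixes L :: "complex \<Rightarrow> real"
  assumes L: "\<And>z t. fun_space.positive_rank k (vecs n) (pencil_shift (- t) (Re z) (Im z)) \<longleftrightarrow> t < L z"
begin

lemma Re_pencil_shift: "Re (pencil_shift t x y v v) = x * Re (re_form v v) + y * Re (im_form v v) + t * Re (dot n v v)"
  by (simp add: fun_space.Re_pencil)

lemma kth_eigenvalue_homogeneous: "0 < r \<Longrightarrow> L (of_real r * z) = r * L z"
proof -
  assume r: "0 < r"
  have "r * t < L (of_real r * z) \<longleftrightarrow> t < L z" for t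
  proof -
    have e: "Re (pencil_shift (- (r * t)) (Re (of_real r * z)) (Im (of_real r * z)) v v) =
        r * Re (pencil_shift (- t) (Re z) (Im z) v v)" for v
      unfolding Re_pencil_shift by (simp add: algebra_simps)
    have "0 < Re (pencil_shift (- (r * t)) (Re (of_real r * z)) (Im (of_real r * z)) v v) \<longleftrightarrow>
        0 < Re (pencil_shift (- t) (Re z) (Im z) v v)" for v
      unfolding e using r by (simp only: zero_less_mult_iff) simp
    then show ?thesis unfolding L[symmetric]
      using fun_space.positive_rank_mono[OF _ subspace_vecs] by metis
  qed
  then have eq: "s < L (of_real r * z) \<longleftrightarrow> s < r * L z" for s
    using r by (metis mult.commute nonzero_eq_divide_eq not_less_iff_gr_or_eq pos_divide_less_eq)
  then show ?thesis by (meson less_irrefl linorder_neqE)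
qed

text \<open>\<open>L\<close> is Lipschitz: a subspace positive for \<open>z\<close> at a threshold
  raised by \<open>(c + d) * dist z z'\<close> stays positive for \<open>z'\<close> at the original
  threshold.\<close>

lemma kth_eigenvalue_continuous: "continuous_on UNIV L"
proof -
  obtain c where c: "0 \<le> c" "\<And>v. \<bar>Re (re_form v v)\<bar> \<le> c * Re (dot n v v)" using mat_form_bounded by blast
  obtain d where d: "0 \<le> d" "\<And>v. \<bar>Re (im_form v v)\<bar> \<le> d * Re (dot n v v)" using mat_form_bounded by blast
  have le: "L z - (c + d) * dist z z' \<le> L z'" for z z'
  proof (rule ccontr)
    assume "\<not> L z - (c + d) * dist z z' \<le> L z'"
    then have "L z' + (c + d) * dist z z' < L z" by simp
    then have "fun_space.positive_rank k (vecs n)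
        (pencil_shift (- (L z' + (c + d) * dist z z')) (Re z) (Im z))" using L by blast
    then have "fun_space.positive_rank k (vecs n) (pencil_shift (- L z') (Re z') (Im z'))"
    proof (rule fun_space.positive_rank_mono[OF _ subspace_vecs])
      fix v assume v: "0 < Re (pencil_shift (- (L z' + (c + d) * dist z z')) (Re z) (Im z) v v)"
      have nn: "0 \<le> Re (dot n v v)" by (simp add: dot_self sum_nonneg)
      have "\<bar>Re z - Re z'\<bar> \<le> dist z z'" "\<bar>Im z - Im z'\<bar> \<le> dist z z'"
        using abs_Re_le_cmod[of "z - z'"] abs_Im_le_cmod[of "z - z'"] by (simp_all add: dist_norm)
      then have "\<bar>Re z - Re z'\<bar> * \<bar>Re (re_form v v)\<bar> \<le> dist z z' * (c * Re (dot n v v))"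
        "\<bar>Im z - Im z'\<bar> * \<bar>Re (im_form v v)\<bar> \<le> dist z z' * (d * Re (dot n v v))"
        using c(2)[of v] d(2)[of v] by (intro mult_mono; simp)+
      moreover have "(Re z - Re z') * Re (re_form v v) \<le> \<bar>Re z - Re z'\<bar> * \<bar>Re (re_form v v)\<bar>"
        "(Im z - Im z') * Re (im_form v v) \<le> \<bar>Im z - Im z'\<bar> * \<bar>Re (im_form v v)\<bar>"
        by (metis abs_ge_self abs_mult)+
      ultimately show "0 < Re (pencil_shift (- L z') (Re z') (Im z') v v)"
        using v unfolding Re_pencil_shift by (simp add: algebra_simps)
    qed
    then show False using L[where t = "L z'" and z = z'] by simp
  qed
  have "\<bar>L z - L z'\<bar> \<le> (c + d) * dist z z'" for z z'
    using le[of z z'] le[of z' z] by (simp add: dist_commute abs_le_iff)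
  then have lip: "dist (L z') (L z) \<le> (c + d) * dist z' z" for z z' by (simp add: dist_real_def)
  show ?thesis
  proof (intro continuous_at_imp_continuous_on ballI)
    fix z
    show "isCont L z" unfolding isCont_def
    proof (rule metric_LIM_I)
      fix e :: real assume "0 < e"
      moreover have "0 < c + d + 1" using c(1) d(1) by simp
      moreover have "dist (L z') (L z) < e" if "dist z' z < e / (c + d + 1)" for z'
      proof -
        have "(c + d) * dist z' z \<le> (c + d + 1) * dist z' z" by (simp add: algebra_simps)
        also have "\<dots> < e" using that \<open>0 < c + d + 1\<close> by (simp add: field_simps)
        finally show ?thesis using lip[of z' z] by simp
      qed
      ultimately show "\<exists>d>0. \<forall>z'. z' \<noteq> z \<and> dist z' z < d \<longrightarrow> dist (L z') (L z) < e"
        by (intro exI[of _ "e / (c + d + 1)"]) simp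
    qed
  qed
qed

text \<open>On the common isotropic subspace the form of direction \<open>z\<close> equals
  \<open>a * Re z + b * Im z\<close> times the inner product; were this factor above
  \<open>L z\<close>, the subspace would be positive at threshold \<open>L z\<close>.\<close>

lemma rank_numerical_range_le_kth_eigenvalue:
  assumes "Complex a b \<in> rank_numerical_range k A"
  shows "a * Re z + b * Im z \<le> L z"
proof (rule ccontr)
  assume "\<not> a * Re z + b * Im z \<le> L z"
  then have lt: "0 < a * Re z + b * Im z - L z" by simp
  obtain B where B: "B \<subseteq> vecs n" "fun_space.independent B" "finite B" "card B = k"
    "\<forall>v\<in>B. \<forall>w\<in>B. re_shift a v w = 0 \<and> im_shift b v w = 0"
    using rank_numerical_range_imp_isotropic[OF assms] unfolding fun_space.isotropic_rank_def by blast
  have "0 < Re (pencil_shift (- L z) (Re z) (Im z) v v)" if v: "v \<in> fun_space.span B" "v \<noteq> 0" for v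
  proof -
    have "re_shift a v v = 0" "im_shift b v v = 0"
      using fun_space.form_span_zero[OF hermitian_shift(1) v(1,1)]
        fun_space.form_span_zero[OF hermitian_shift(2) v(1,1)] B(5) by blast+
    then have "Re (re_form v v) = a * Re (dot n v v)" "Re (im_form v v) = b * Re (dot n v v)"
      using fun_space.Re_pencil[of re_form "dot n" 1 "- a" v v] fun_space.Re_pencil[of im_form "dot n" 1 "- b" v v] by auto
    then have "Re (pencil_shift (- L z) (Re z) (Im z) v v) = (a * Re z + b * Im z - L z) * Re (dot n v v)"
      unfolding Re_pencil_shift by (simp add: algebra_simps)
    moreover have "0 < Re (dot n v v)"
      using dot_pos v fun_space.span_minimal[OF B(1) subspace_vecs] by blast
    ultimately show ?thesis using lt by simp
  qed
  then have "fun_space.positive_rank k (vecs n) (pencil_shift (- L z) (Re z) (Im z))"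
    unfolding fun_space.positive_rank_def using B by blast
  then show False using L[where t = "L z" and z = z] by simp
qed

text \<open>The assumption \<open>det\<close> provides a nondegenerate member of the pencil, in
  direction \<open>u\<close>; the pair is rotated so that this member comes first.\<close>

lemma rank_numerical_range_of_less_kth_eigenvalue:
  assumes less: "\<And>z. z \<noteq> 0 \<Longrightarrow> a * Re z + b * Im z < L z"
    and det: "det (char_mat A (- (a * Re u + b * Im u)) (Re u) (Im u)) \<noteq> 0"
  shows "Complex a b \<in> rank_numerical_range k A"
proof -
  let ?x = "Re u" and ?y = "Im u"
  let ?h = "fun_space.pencil (re_shift a) (im_shift b) ?x ?y"
  let ?g = "fun_space.pencil (re_shift a) (im_shift b) (- ?y) ?x"
  have u: "u \<noteq> 0"
  proof
    assume "u = 0"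
    then have "char_mat A (- (a * Re u + b * Im u)) (Re u) (Im u) = 0 \<cdot>\<^sub>m 1\<^sub>m n"
      using A re_im_mat(1,2)[OF A] by (intro eq_matI) (auto simp: char_mat_def)
    then show False using det k by (simp add: power_0_left)
  qed
  have norm: "?x\<^sup>2 + ?y\<^sup>2 \<noteq> 0" using u by (simp add: complex_eq_iff sum_power2_eq_zero_iff)
  have nd: "fun_space.nondegenerate_on ?h (vecs n)"
    unfolding pencil_shift_shift pencil_shift_eq using det_nonzero_imp_nondegenerate[OF char_mat_carrier det] .
  have pos: "fun_space.positive_rank k (vecs n) (fun_space.pencil ?h ?g s t)" if st: "(s, t) \<noteq> (0, 0)" for s t
  proof -
    \<comment> \<open>Complex multiplication by \<open>u\<close> converts coefficients for the
      rotated pair into coefficients for the original one.\<close>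
    define z where "z = Complex s t * u"
    have "Complex s t \<noteq> 0" using st by (simp add: complex_eq_iff)
    then have z: "z \<noteq> 0" using u by (simp add: z_def)
    have "fun_space.pencil ?h ?g s t = fun_space.pencil (re_shift a) (im_shift b) (Re z) (Im z)"
      by (intro ext) (simp add: fun_space.pencil_def z_def algebra_simps)
    then show ?thesis using L[where t = "a * Re z + b * Im z" and z = z] less[OF z] by (simp only: pencil_shift_shift)
  qed
  have "fun_space.isotropic_rank k (vecs n) ?h ?g"
    using fun_space.isotropic_rank_of_positive_pencil[OF _ _ subspace_vecs dim_vecs nd pos]
      fun_space.hermitian_pencil hermitian_shift by blast
  then show ?thesis
    using fun_space.isotropic_rank_pencil[OF _ norm] isotropic_imp_rank_numerical_range by blast
qed

end

end

end

section \<open>Evaluation of polynomials and ideals\<close>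

definition eval3 :: "'r::comm_ring_1 \<Rightarrow> 'r \<Rightarrow> 'r \<Rightarrow> 'r poly3 \<Rightarrow> 'r" where
  "eval3 t x y F = poly (poly (poly F [:[:t:]:]) [:x:]) y"

lemma comm_ring_hom_eval3: "comm_ring_hom (eval3 t x y)"
  by unfold_locales (simp_all add: eval3_def)

lemma eval3_vars [simp]:
  "eval3 t x y var_t = t" "eval3 t x y var_x = x" "eval3 t x y var_y = y" "eval3 t x y (const3 c) = c"
  by (simp_all add: eval3_def var_t_def var_x_def var_y_def const3_def)

lemma eval3_map_poly3:
  assumes "comm_ring_hom h"
  shows "eval3 (h t) (h x) (h y) (map_poly3 h F) = h (eval3 t x y F)"
proof -
  interpret h1: comm_ring_hom h by fact
  interpret h2: comm_ring_hom "map_poly h" by (rule comm_ring_hom_map_poly) unfold_locales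
  interpret h3: comm_ring_hom "map_poly (map_poly h)" by (rule comm_ring_hom_map_poly) unfold_locales
  have 1: "[:[:h t:]:] = map_poly (map_poly h) [:[:t:]:]" "[:h x:] = map_poly h [:x:]"
    by (simp_all add: Polynomial.map_poly_pCons)
  show ?thesis unfolding eval3_def map_poly3_def 1 h3.poly_map_poly h2.poly_map_poly h1.poly_map_poly ..
qed

lemma eval3_kippenhahn:
  assumes A: "A \<in> carrier_mat n n"
  shows "complex_of_real (eval3 t x y (kippenhahn A)) = det (char_mat A t x y)"
proof -
  interpret e: comm_ring_hom "eval3 (complex_of_real t) (of_real x) (of_real y)" by (rule comm_ring_hom_eval3)
  have r: "comm_ring_hom complex_of_real" by unfold_locales
  have "complex_of_real (eval3 t x y (kippenhahn A)) = eval3 (of_real t) (of_real x) (of_real y) (kippenhahn_complex A)"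
    using eval3_map_poly3[OF r, of t x y "kippenhahn A"] of_real_kippenhahn[OF A] by simp
  also have "\<dots> = det (char_mat A t x y)"
    unfolding kippenhahn_complex_def e.hom_det[symmetric]
  proof (rule arg_cong[where f = det], rule eq_matI)
    fix i j assume "i < dim_row (char_mat A t x y)" "j < dim_col (char_mat A t x y)"
    then have ij: "i < n" "j < n" using char_mat_carrier[OF A, of t x y] by auto
    then show "map_mat (eval3 (of_real t) (of_real x) (of_real y))
        (var_t \<cdot>\<^sub>m 1\<^sub>m (dim_row A) + var_x \<cdot>\<^sub>m map_mat const3 (re_mat A)
          + var_y \<cdot>\<^sub>m map_mat const3 (im_mat A)) $$ (i, j)
      = char_mat A t x y $$ (i, j)"
      using A re_im_mat(1,2)[OF A] by (simp add: char_mat_def e.hom_add e.hom_mult)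
  qed (use A re_im_mat(1,2)[OF A] in \<open>simp_all add: char_mat_def\<close>)
  finally show ?thesis .
qed

lemma eval3_kippenhahn_scale:
  assumes A: "A \<in> carrier_mat n n" and 0: "eval3 t x y (kippenhahn A) = 0"
  shows "0 < n \<Longrightarrow> eval3 (r * t) (r * x) (r * y) (kippenhahn A) = 0"
proof -
  have "char_mat A (r * t) (r * x) (r * y) = of_real r \<cdot>\<^sub>m char_mat A t x y"
    using A re_im_mat(1,2)[OF A] by (intro eq_matI) (auto simp: char_mat_def algebra_simps)
  then have "complex_of_real (eval3 (r * t) (r * x) (r * y) (kippenhahn A)) = 0"
    unfolding eval3_kippenhahn[OF A] using eval3_kippenhahn[OF A, of t x y] 0 by simp
  then show ?thesis by simp
qed

lemma kippenhahn_nonzero: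
  assumes A: "A \<in> carrier_mat n n" shows "kippenhahn A \<noteq> 0"
proof
  assume "kippenhahn A = 0"
  then have "det (char_mat A 1 0 0) = 0" using eval3_kippenhahn[OF A, of 1 0 0] by (simp add: eval3_def)
  moreover have "char_mat A 1 0 0 = 1\<^sub>m n"
    using A re_im_mat(1,2)[OF A] by (intro eq_matI) (auto simp: char_mat_def)
  ultimately show False by simp
qed

text \<open>Neither multiplicities nor units affect zeros; the product of the prime factorization is
  only associated to \<open>f\<close>.\<close>

lemma eval3_squarefree_red:
  fixes f :: "real poly3" assumes "f \<noteq> 0"
  shows "eval3 t x y (squarefree_red f) = 0 \<longleftrightarrow> eval3 t x y f = 0"
proof -
  interpret e: comm_ring_hom "eval3 t x y" by (rule comm_ring_hom_eval3)
  have dvd0: "eval3 t x y q = 0" if "p dvd q" "eval3 t x y p = 0" for p q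
    using that by (auto simp: dvd_def e.hom_mult)
  let ?M = "prime_factorization f"
  have M: "eval3 t x y (prod_mset N) = 0 \<longleftrightarrow> (\<exists>p\<in>#N. eval3 t x y p = 0)" for N
    by (induction N) (simp_all add: e.hom_mult e.hom_one)
  have S: "eval3 t x y (\<Prod>S) = 0 \<longleftrightarrow> (\<exists>p\<in>S. eval3 t x y p = 0)" if "finite S" for S
    using that by (induction S rule: finite_induct) (simp_all add: e.hom_mult e.hom_one)
  have "normalize (prod_mset ?M) = normalize f" using prod_mset_prime_factorization_weak[OF assms] .
  then have "prod_mset ?M dvd f" "f dvd prod_mset ?M" by (metis associatedD1 associatedD2)+
  then have "eval3 t x y f = 0 \<longleftrightarrow> eval3 t x y (prod_mset ?M) = 0" using dvd0 by blast
  then show ?thesis unfolding M squarefree_red_def S[OF finite_set_mset] by simp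
qed

lemma has_derivative_eval3:
  fixes f :: "real poly3"
  assumes T: "(T has_real_derivative T') (at s)" and X: "(X has_real_derivative X') (at s)"
    and Y: "(Y has_real_derivative Y') (at s)"
  shows "((\<lambda>s. eval3 (T s) (X s) (Y s) f) has_real_derivative
     eval3 (T s) (X s) (Y s) (deriv_t f) * T' + eval3 (T s) (X s) (Y s) (deriv_x f) * X' +
     eval3 (T s) (X s) (Y s) (deriv_y f) * Y') (at s)"
proof -
  have 1: "((\<lambda>s. poly p (Y s)) has_real_derivative poly (pderiv p) (Y s) * Y') (at s)" for p
    using DERIV_chain2[OF poly_DERIV Y] .
  have 2: "((\<lambda>s. poly (poly q [:X s:]) (Y s)) has_real_derivative
      poly (poly (pderiv q) [:X s:]) (Y s) * X' + poly (poly (map_poly pderiv q) [:X s:]) (Y s) * Y') (at s)" for q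
  proof (induction q)
    case 0 then show ?case by simp
  next
    case (pCons p q)
    have "((\<lambda>s. poly p (Y s) + X s * poly (poly q [:X s:]) (Y s)) has_real_derivative
        poly (pderiv p) (Y s) * Y' + (X' * poly (poly q [:X s:]) (Y s) + (poly (poly (pderiv q) [:X s:]) (Y s) * X'
          + poly (poly (map_poly pderiv q) [:X s:]) (Y s) * Y') * X s)) (at s)"
      using 1 X pCons.IH by (intro DERIV_add DERIV_mult)
    then show ?case by (simp add: Polynomial.map_poly_pCons pderiv_pCons algebra_simps)
  qed
  have "((\<lambda>s. poly (poly (poly f [:[:T s:]:]) [:X s:]) (Y s)) has_real_derivative
      poly (poly (poly (pderiv f) [:[:T s:]:]) [:X s:]) (Y s) * T' +
      poly (poly (poly (map_poly pderiv f) [:[:T s:]:]) [:X s:]) (Y s) * X' +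
      poly (poly (poly (map_poly (map_poly pderiv) f) [:[:T s:]:]) [:X s:]) (Y s) * Y') (at s)"
  proof (induction f)
    case 0 then show ?case by simp
  next
    case (pCons q f)
    let ?e = "\<lambda>F. poly (poly (poly F [:[:T s:]:]) [:X s:]) (Y s)"
    have "((\<lambda>s. poly (poly q [:X s:]) (Y s) + T s * poly (poly (poly f [:[:T s:]:]) [:X s:]) (Y s)) has_real_derivative
        (poly (poly (pderiv q) [:X s:]) (Y s) * X' + poly (poly (map_poly pderiv q) [:X s:]) (Y s) * Y') +
        (T' * ?e f + (?e (pderiv f) * T' + ?e (map_poly pderiv f) * X' + ?e (map_poly (map_poly pderiv) f) * Y') * T s)) (at s)"
      using 2 T pCons.IH by (intro DERIV_add DERIV_mult)
    then show ?case by (simp add: Polynomial.map_poly_pCons pderiv_pCons algebra_simps)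
  qed
  then show ?thesis by (simp add: eval3_def deriv_t_def deriv_x_def deriv_y_def)
qed

lemma tendsto_eval3:
  fixes f :: "real poly3"
  assumes "(T \<longlongrightarrow> t) F" "(X \<longlongrightarrow> x) F" "(Y \<longlongrightarrow> y) F"
  shows "((\<lambda>s. eval3 (T s) (X s) (Y s) f) \<longlongrightarrow> eval3 t x y f) F"
proof -
  have 2: "((\<lambda>s. poly (poly q [:X s:]) (Y s)) \<longlongrightarrow> poly (poly q [:x:]) y) F" for q
    by (induction q) (auto intro!: tendsto_intros assms)
  show ?thesis unfolding eval3_def
  proof (induction f)
    case (pCons q f)
    have "((\<lambda>s. poly (poly q [:X s:]) (Y s) + T s * poly (poly (poly f [:[:T s:]:]) [:X s:]) (Y s)) \<longlongrightarrow>
        poly (poly q [:x:]) y + t * poly (poly (poly f [:[:t:]:]) [:x:]) y) F"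
      by (intro tendsto_intros 2 pCons.IH assms)
    then show ?case by simp
  qed simp
qed

lemma deriv_map_poly3:
  assumes "comm_ring_hom h"
  shows "deriv_t (map_poly3 h f) = map_poly3 h (deriv_t f)"
    and "deriv_x (map_poly3 h f) = map_poly3 h (deriv_x f)"
    and "deriv_y (map_poly3 h f) = map_poly3 h (deriv_y f)"
proof -
  interpret h: comm_ring_hom h by fact
  interpret h2: comm_ring_hom "map_poly h" by (rule comm_ring_hom_map_poly) unfold_locales
  interpret h3: comm_ring_hom "map_poly (map_poly h)" by (rule comm_ring_hom_map_poly) unfold_locales
  show "deriv_t (map_poly3 h f) = map_poly3 h (deriv_t f)"
    by (intro poly_eqI) (simp add: deriv_t_def map_poly3_def coeff_map_poly coeff_pderiv h3.hom_mult h3.hom_of_nat del: of_nat_Suc)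
  show "deriv_x (map_poly3 h f) = map_poly3 h (deriv_x f)"
    by (intro poly_eqI) (simp add: deriv_x_def map_poly3_def coeff_map_poly coeff_pderiv h2.hom_mult h2.hom_of_nat del: of_nat_Suc)
  show "deriv_y (map_poly3 h f) = map_poly3 h (deriv_y f)"
    by (intro poly_eqI) (simp add: deriv_y_def map_poly3_def coeff_map_poly coeff_pderiv h.hom_mult h.hom_of_nat del: of_nat_Suc)
qed

section \<open>Evaluation on the incidence and dual ideals\<close>

lemma ideal_gen_superset: "S \<subseteq> ideal_gen S"
  unfolding ideal_gen_def by (rule Modules.module.span_superset[OF module_times])

lemma hom_zero_on_ideal_gen:
  assumes "comm_ring_hom h" "\<And>p. p \<in> S \<Longrightarrow> h p = 0" "p \<in> ideal_gen S"
  shows "h p = 0"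
proof -
  interpret h: comm_ring_hom h by fact
  have "ideal_gen S \<subseteq> {p. h p = 0}" unfolding ideal_gen_def
    by (rule Modules.module.span_minimal[OF module_times])
      (auto simp: assms(2) Modules.module.subspace_def[OF module_times] h.hom_add h.hom_mult)
  then show ?thesis using assms(3) by blast
qed

lemma power_in_ideal_pow: "p \<in> I \<Longrightarrow> p ^ N \<in> ideal_pow I N"
proof (induction N)
  case (Suc N)
  then have "p ^ Suc N \<in> {p * q | p q. p \<in> I \<and> q \<in> ideal_pow I N}" by auto
  then show ?case unfolding ideal_pow.simps by (rule subsetD[OF ideal_gen_superset])
qed simp

definition eval5 :: "real \<Rightarrow> real \<Rightarrow> real \<Rightarrow> real \<Rightarrow> real \<Rightarrow> poly_ab poly3 \<Rightarrow> real" where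
  "eval5 t x y a b P = eval_ab (eval3 [:[:t:]:] [:[:x:]:] [:[:y:]:] P) a b"

lemma comm_ring_hom_eval5: "comm_ring_hom (eval5 t x y a b)"
proof -
  interpret e: comm_ring_hom "eval3 [:[:t:]:] [:[:x:]:] [:[:y:]:]" by (rule comm_ring_hom_eval3)
  show ?thesis
    by unfold_locales (simp_all add: eval5_def eval_ab_def e.hom_add e.hom_mult e.hom_one)
qed

text \<open>Evaluation at the point kills all generators of the incidence ideal, the last minor
  because \<open>dx\<close> and \<open>dy\<close> give both of its terms the same value. A power of
  \<open>g\<close> times a power of any coordinate lies in that ideal; taking a coordinate that is
  nonzero at the point, its factor cancels.\<close>

lemma dual_ideal_vanishes:
  fixes A :: "complex mat"
  defines "f \<equiv> squarefree_red (kippenhahn A)"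
  assumes g: "g \<in> dual_ideal A" and nz: "(t, x, y) \<noteq> (0, 0, 0)"
    and f0: "eval3 t x y f = 0" and line: "t + a * x + b * y = 0"
    and dx: "eval3 t x y (deriv_x f) = a * eval3 t x y (deriv_t f)"
    and dy: "eval3 t x y (deriv_y f) = b * eval3 t x y (deriv_t f)"
  shows "eval_ab g a b = 0"
proof -
  interpret e: comm_ring_hom "eval5 t x y a b" by (rule comm_ring_hom_eval5)
  let ?c = "\<lambda>c::real. [:[:c:]:]"
  have c: "comm_ring_hom ?c" by unfold_locales (simp_all add: one_pCons)
  have map: "eval5 t x y a b (map_poly3 ?c p) = eval3 t x y p" for p
    using eval3_map_poly3[OF c, of t x y p] by (simp add: eval5_def eval_ab_def)
  have const: "eval5 t x y a b (const3 p) = eval_ab p a b" for p by (simp add: eval5_def)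
  have vars: "eval5 t x y a b var_t = t" "eval5 t x y a b var_x = x" "eval5 t x y a b var_y = y"
    "eval5 t x y a b (const3 var_a) = a" "eval5 t x y a b (const3 var_b) = b"
    by (simp_all add: eval5_def eval_ab_def var_a_def var_b_def)
  have I: "eval5 t x y a b p = 0" if "p \<in> incidence_ideal A" for p
    using that unfolding incidence_ideal_def Let_def
  proof (rule hom_zero_on_ideal_gen[OF comm_ring_hom_eval5, rotated])
    fix q
    assume "q \<in> {map_poly3 ?c (squarefree_red (kippenhahn A)),
        var_t + const3 var_a * var_x + const3 var_b * var_y,
        deriv_x (map_poly3 ?c (squarefree_red (kippenhahn A)))
          - const3 var_a * deriv_t (map_poly3 ?c (squarefree_red (kippenhahn A))),
        deriv_y (map_poly3 ?c (squarefree_red (kippenhahn A)))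
          - const3 var_b * deriv_t (map_poly3 ?c (squarefree_red (kippenhahn A))),
        const3 var_a * deriv_y (map_poly3 ?c (squarefree_red (kippenhahn A)))
          - const3 var_b * deriv_x (map_poly3 ?c (squarefree_red (kippenhahn A)))}"
    then show "eval5 t x y a b q = 0"
      using f0 line dx dy
      by (auto simp: deriv_map_poly3[OF c] e.hom_add e.hom_mult e.hom_minus vars map f_def)
  qed
  obtain M where M: "const3 (g ^ M) \<in> ideal_saturation (incidence_ideal A) (ideal_gen {var_t, var_x, var_y})"
    using g unfolding dual_ideal_def ideal_radical_def by blast
  then obtain N where N:
    "\<And>q. q \<in> ideal_pow (ideal_gen {var_t, var_x, var_y}) N \<Longrightarrow> const3 (g ^ M) * q \<in> incidence_ideal A"
    unfolding ideal_saturation_def ideal_colon_def by blast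
  obtain v :: "poly_ab poly3" where v: "v \<in> {var_t, var_x, var_y}" "eval5 t x y a b v \<noteq> 0"
  proof -
    have "\<exists>v\<in>{var_t, var_x, var_y}. eval5 t x y a b v \<noteq> 0" using nz vars by auto
    then show ?thesis using that by blast
  qed
  have "v ^ N \<in> ideal_pow (ideal_gen {var_t, var_x, var_y}) N"
    by (intro power_in_ideal_pow subsetD[OF ideal_gen_superset] v(1))
  then have "eval5 t x y a b (const3 (g ^ M) * v ^ N) = 0" using N I by blast
  then have "eval_ab g a b ^ M * eval5 t x y a b v ^ N = 0"
    by (simp add: e.hom_mult e.hom_power const) (simp add: eval_ab_def)
  then show ?thesis using v(2) by simp
qed

section \<open>Boundary points\<close>

text \<open>
  For small fixed \<open>u\<close> the function \<open>F u\<close> is injective near \<open>0\<close>, so the level function \<open>l\<close> takes no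
  value twice there and cannot have a local minimum at \<open>0\<close>.
\<close>

lemma no_minimum_of_implicit_function:
  fixes F G :: "real \<Rightarrow> real \<Rightarrow> real" and l :: "real \<Rightarrow> real"
  assumes deriv: "\<And>u s. ((\<lambda>s. F u s) has_real_derivative G u s) (at s)"
    and cont: "((\<lambda>p. G (fst p) (snd p)) \<longlongrightarrow> G 0 0) (nhds (0, 0))"
    and ne: "G 0 0 \<noteq> 0" and l: "continuous_on UNIV l" "l 0 = 0" "\<And>s. 0 \<le> l s" "\<And>s. F (l s) s = 0"
  shows False
proof -
  have "\<forall>\<^sub>F p in nhds (0, 0). G (fst p) (snd p) \<noteq> 0"
    using tendsto_imp_eventually_ne[OF cont ne] .
  then obtain S where S: "open S" "(0, 0) \<in> S" "\<And>p. p \<in> S \<Longrightarrow> G (fst p) (snd p) \<noteq> 0"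
    unfolding eventually_nhds by blast
  obtain U V where UV: "open U" "open V" "0 \<in> U" "0 \<in> V" "U \<times> V \<subseteq> S"
    by (rule open_prod_elim[OF S(1,2)]) auto
  have "open (l -` U)" using UV(1) l(1) by (simp add: continuous_on_open_vimage)
  then have "open (l -` U \<inter> V)" "0 \<in> l -` U \<inter> V" using UV l(2) by auto
  then obtain d where d: "0 < d" "ball 0 d \<subseteq> l -` U \<inter> V"
    using open_contains_ball by (metis (no_types, lifting))
  \<comment> \<open>Equal levels make \<open>s\<close> and \<open>t\<close> zeros of the same
    function \<open>F (l s)\<close>. The mean value theorem gives a zero of \<open>G (l s)\<close>
    between them, inside the rectangle where \<open>G\<close> is nonzero.\<close>
  have inj: "l s \<noteq> l t" if st: "s < t" "\<bar>s\<bar> < d" "\<bar>t\<bar> < d" for s t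
  proof
    assume eq: "l s = l t"
    obtain z where z: "s < z" "z < t" "F (l s) t - F (l s) s = (t - s) * G (l s) z"
      using MVT2[OF st(1), of "F (l s)" "G (l s)"] deriv by blast
    have "F (l s) t = 0" using l(4)[of t] eq by simp
    then have "G (l s) z = 0" using z(3) l(4)[of s] st(1) by simp
    moreover have "s \<in> ball 0 d" "z \<in> ball 0 d" using st z by (auto simp: dist_real_def)
    then have "(l s, z) \<in> S" using d(2) UV(5) by blast
    ultimately show False using S(3) by fastforce
  qed
  define e where "e = d / 2"
  have e: "0 < e" "e < d" using d(1) by (simp_all add: e_def)
  \<comment> \<open>A level that \<open>l\<close> reaches on both sides of 0, since it starts from
    \<open>l 0 = 0\<close> and is at least \<open>m\<close> at both ends.\<close>
  define m where "m = min (l e) (l (- e))"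
  have "l e \<noteq> 0" "l (- e) \<noteq> 0" using inj[of 0 e] inj[of "- e" 0] e l(2) by auto
  then have m: "0 < m" "m \<le> l e" "m \<le> l (- e)" using l(3)[of e] l(3)[of "- e"] by (auto simp: m_def)
  obtain s where s: "0 \<le> s" "s \<le> e" "l s = m"
    using IVT'[of l 0 m e] l(1,2) m e continuous_on_subset[OF l(1)] by (metis less_imp_le subset_UNIV)
  obtain t where t: "- e \<le> t" "t \<le> 0" "l t = m"
    using IVT2'[of l 0 m "- e"] l(1,2) m e continuous_on_subset[OF l(1)]
    by (metis less_imp_le neg_le_0_iff_le subset_UNIV)
  have "t < s" using s t m(1) l(2) by (cases "t = s") auto
  then show False using inj[of t s] s t e by auto
qed

lemma continuous_attains_inf_circle:
  fixes h :: "complex \<Rightarrow> real"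
  assumes "continuous_on UNIV h"
  obtains z where "cmod z = 1" "\<And>w. cmod w = 1 \<Longrightarrow> h z \<le> h w"
proof -
  have "continuous_on {0..2 * pi} (\<lambda>x. h (cis x))"
    by (intro continuous_on_compose2[OF assms] continuous_intros continuous_on_cis) auto
  then obtain x where x: "x \<in> {0..2 * pi}" "\<And>y. y \<in> {0..2 * pi} \<Longrightarrow> h (cis x) \<le> h (cis y)"
    using continuous_attains_inf[of "{0..2 * pi}" "\<lambda>x. h (cis x)"] by fastforce
  have "h (cis x) \<le> h w" if w: "cmod w = 1" for w
  proof -
    have "(Re w)\<^sup>2 + (Im w)\<^sup>2 = 1" using w by (simp add: cmod_def)
    then obtain y where "0 \<le> y" "y < 2 * pi" "Re w = cos y" "Im w = sin y"
      using sincos_total_2pi by metis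
    then have "w = cis y" "y \<in> {0..2 * pi}" by (auto simp: complex_eq_iff)
    then show ?thesis using x(2) by simp
  qed
  then show ?thesis using that[of "cis x"] by simp
qed

lemma dot_le_cmod: "a * Re z + b * Im z \<le> cmod (Complex a b) * cmod z"
proof -
  have "a * Re z + b * Im z = Re (cnj (Complex a b) * z)" by simp
  also have "\<dots> \<le> cmod (cnj (Complex a b) * z)" by (rule complex_Re_le_cmod)
  finally show ?thesis by (simp add: norm_mult)
qed

theorem theorem5p4:
  fixes A :: "complex mat" and n k :: nat and g :: "real poly poly" and a b :: real
  assumes "A \<in> carrier_mat n n"
    and "\<not> power_of_linear_form (kippenhahn A)"
    and "1 \<le> k" and "k \<le> n"
    and "is_g_poly A g"
    and "Complex a b \<in> frontier (rank_numerical_range k A)"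
  shows "eval_ab g a b = 0"
proof -
  note A = assms(1) and k = assms(3,4)
  have n: "0 < n" using k by simp
  let ?\<Lambda> = "rank_numerical_range k A"
  define f where "f = squarefree_red (kippenhahn A)"
  define ft where "ft t x y = eval3 t x y (deriv_t f)" for t x y
  define fx where "fx t x y = eval3 t x y (deriv_x f)" for t x y
  define fy where "fy t x y = eval3 t x y (deriv_y f)" for t x y
  have f0: "eval3 t x y f = 0 \<longleftrightarrow> det (char_mat A t x y) = 0" for t x y
    unfolding f_def eval3_squarefree_red[OF kippenhahn_nonzero[OF A]] eval3_kippenhahn[OF A, symmetric]
    by simp
  have g: "g \<in> dual_ideal A"
    using assms(5) ideal_gen_superset[of "{g}"] by (auto simp: is_g_poly_def)

  \<comment> \<open>The derivative of \<open>f\<close> at the point \<open>(u, Re z, Im z)\<close>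
    in the direction \<open>(\<phi> w, Re w, Im w)\<close>, that is, along the dual line.\<close>
  define D where "D u z w = - (a * Re w + b * Im w) * ft u (Re z) (Im z)
      + fx u (Re z) (Im z) * Re w + fy u (Re z) (Im z) * Im w" for u z w
  define \<phi> where "\<phi> z = - (a * Re z + b * Im z)" for z
  \<comment> \<open>Here \<open>u\<close> displaces the path from the dual line in the
    \<open>t\<close> direction; being constant, it does not enter the velocity.\<close>
  have deriv: "((\<lambda>s. eval3 (\<phi> (z + of_real s * w) - u) (Re (z + of_real s * w)) (Im (z + of_real s * w)) f)
      has_real_derivative D (\<phi> (z + of_real s * w) - u) (z + of_real s * w) w) (at s)" for z w u s
    unfolding D_def ft_def fx_def fy_def \<phi>_def
    by (rule DERIV_cong[OF has_derivative_eval3]) (auto intro!: derivative_eq_intros simp: algebra_simps)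
  have deriv_zero: "D (\<phi> z) z w = 0"
    if "\<And>s. eval3 (\<phi> (z + of_real s * w)) (Re (z + of_real s * w)) (Im (z + of_real s * w)) f = 0" for z w
  proof -
    have "((\<lambda>s. eval3 (\<phi> (z + of_real s * w) - 0) (Re (z + of_real s * w)) (Im (z + of_real s * w)) f)
        has_real_derivative 0) (at 0)"
      by (simp only: that diff_zero DERIV_const)
    from DERIV_unique[OF deriv[of z w 0 0] this] show ?thesis by simp
  qed
  \<comment> \<open>\<open>z\<close> and \<open>\<i> * z\<close> form a real basis of the plane, so
    two vanishing derivatives yield the equations \<open>f_x = a f_t\<close> and
    \<open>f_y = b f_t\<close>.\<close>
  have critical: "eval_ab g a b = 0"
    if z: "z \<noteq> 0" "eval3 (\<phi> z) (Re z) (Im z) f = 0" and D0: "D (\<phi> z) z z = 0" "D (\<phi> z) z (\<i> * z) = 0" for z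
  proof -
    define u where "u = fx (\<phi> z) (Re z) (Im z) - a * ft (\<phi> z) (Re z) (Im z)"
    define v where "v = fy (\<phi> z) (Re z) (Im z) - b * ft (\<phi> z) (Re z) (Im z)"
    have eq: "u * Re z + v * Im z = 0" "v * Re z - u * Im z = 0"
      using D0 by (simp_all add: D_def u_def v_def algebra_simps)
    have norm: "(Re z)\<^sup>2 + (Im z)\<^sup>2 \<noteq> 0" using z(1) by (simp add: complex_eq_iff sum_power2_eq_zero_iff)
    have "u * ((Re z)\<^sup>2 + (Im z)\<^sup>2) = (u * Re z + v * Im z) * Re z - (v * Re z - u * Im z) * Im z"
      "v * ((Re z)\<^sup>2 + (Im z)\<^sup>2) = (u * Re z + v * Im z) * Im z + (v * Re z - u * Im z) * Re z"
      by (simp_all add: algebra_simps power2_eq_square)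
    then have "u * ((Re z)\<^sup>2 + (Im z)\<^sup>2) = 0" "v * ((Re z)\<^sup>2 + (Im z)\<^sup>2) = 0" unfolding eq by simp_all
    then have "u = 0" "v = 0" using norm by (metis mult_eq_0_iff)+
    then show ?thesis
      using dual_ideal_vanishes[OF g, of "\<phi> z" "Re z" "Im z" a b] z norm
      by (auto simp: f_def[symmetric] \<phi>_def u_def v_def fx_def fy_def ft_def)
  qed

  show ?thesis
  proof (cases "\<forall>z. eval3 (\<phi> z) (Re z) (Im z) f = 0")
    case True
    then have "D (\<phi> 1) 1 w = 0" for w using deriv_zero by blast
    then show ?thesis using critical[OF one_neq_zero] True by blast
  next
    case False
    then obtain z1 where z1: "eval3 (\<phi> z1) (Re z1) (Im z1) f \<noteq> 0" by blast
    obtain L where L: "\<And>z t. fun_space.positive_rank k (vecs n)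
        (fun_space.pencil (fun_space.pencil (mat_form n (re_mat A)) (mat_form n (im_mat A)) (Re z) (Im z))
          (dot n) 1 (- t)) \<longleftrightarrow> t < L z"
      and detL: "\<And>z. det (char_mat A (- L z) (Re z) (Im z)) = 0"
      using kth_eigenvalue_function[OF A k] by metis
    note contL = kth_eigenvalue_continuous[OF A k L]
    \<comment> \<open>The half-plane is closed, so the inequality reaches boundary points that need
      not belong to the range.\<close>
    have le: "- \<phi> z \<le> L z" for z
    proof -
      let ?S = "{\<mu>. Re \<mu> * Re z + Im \<mu> * Im z \<le> L z}"
      have "closed ?S" by (intro closed_Collect_le continuous_intros)
      moreover have "?\<Lambda> \<subseteq> ?S"
        using rank_numerical_range_le_kth_eigenvalue[OF A k L] by (metis (mono_tags, lifting) complex_surj mem_Collect_eq subsetI)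
      ultimately have "closure ?\<Lambda> \<subseteq> ?S" by (rule closure_minimal[rotated])
      then show ?thesis using assms(6) by (auto simp: frontier_def \<phi>_def)
    qed
    \<comment> \<open>Otherwise strictness is uniform on the unit circle. Both it and the
      nonvanishing of \<open>f\<close> in direction \<open>z1\<close> persist for nearby points, so
      \<open>Complex a b\<close> would be an interior point.\<close>
    have "\<exists>z. z \<noteq> 0 \<and> - \<phi> z = L z"
    proof (rule ccontr)
      assume "\<not> (\<exists>z. z \<noteq> 0 \<and> - \<phi> z = L z)"
      then have less: "- \<phi> z < L z" if "z \<noteq> 0" for z using le[of z] that by force
      have "continuous_on UNIV (\<lambda>z. L z + \<phi> z)"
        unfolding \<phi>_def by (intro continuous_intros contL)
      then obtain z2 where z2: "cmod z2 = 1" "\<And>w. cmod w = 1 \<Longrightarrow> L z2 + \<phi> z2 \<le> L w + \<phi> w"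
        using continuous_attains_inf_circle by blast
      define \<delta> where "\<delta> = L z2 + \<phi> z2"
      have "z2 \<noteq> 0" using z2(1) by auto
      then have \<delta>: "0 < \<delta>" using less[of z2] by (simp add: \<delta>_def)
      have "((\<lambda>\<mu>. eval3 (- (Re \<mu> * Re z1 + Im \<mu> * Im z1)) (Re z1) (Im z1) f) \<longlongrightarrow>
          eval3 (- (Re (Complex a b) * Re z1 + Im (Complex a b) * Im z1)) (Re z1) (Im z1) f) (nhds (Complex a b))"
        by (intro tendsto_eval3 tendsto_intros filterlim_ident)
      then have "\<forall>\<^sub>F \<mu> in nhds (Complex a b).
          eval3 (- (Re \<mu> * Re z1 + Im \<mu> * Im z1)) (Re z1) (Im z1) f \<noteq> 0"
        using z1 by (intro tendsto_imp_eventually_ne) (auto simp: \<phi>_def)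
      then obtain \<epsilon> where \<epsilon>: "0 < \<epsilon>" "\<And>\<mu>. dist \<mu> (Complex a b) < \<epsilon> \<Longrightarrow>
          eval3 (- (Re \<mu> * Re z1 + Im \<mu> * Im z1)) (Re z1) (Im z1) f \<noteq> 0"
        unfolding eventually_nhds_metric by blast
      have "Complex c d \<in> ?\<Lambda>" if cd: "dist (Complex c d) (Complex a b) < min \<epsilon> \<delta>" for c d
      proof (rule rank_numerical_range_of_less_kth_eigenvalue[OF A k L])
        fix z :: complex assume z: "z \<noteq> 0"
        define w where "w = of_real (1 / cmod z) * z"
        have w: "cmod w = 1" using z by (simp add: w_def norm_divide)
        have zw: "z = of_real (cmod z) * w" using z by (simp add: w_def)
        have "(c - a) * Re w + (d - b) * Im w \<le> cmod (Complex (c - a) (d - b)) * cmod w" by (rule dot_le_cmod)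
        also have "\<dots> < \<delta>" using cd w by (simp add: dist_norm complex_diff)
        also have "\<delta> \<le> L w + \<phi> w" using z2(2)[OF w] by (simp add: \<delta>_def)
        finally have "c * Re w + d * Im w < L w" by (simp add: \<phi>_def algebra_simps)
        then have "cmod z * (c * Re w + d * Im w) < cmod z * L w" using z by (intro mult_strict_left_mono) auto
        also have "cmod z * L w = L z" using kth_eigenvalue_homogeneous[OF A k L, of "cmod z" w] z zw by simp
        also have "cmod z * (c * Re w + d * Im w) = c * Re z + d * Im z"
          using z by (simp add: w_def field_simps)
        finally show "c * Re z + d * Im z < L z" .
      next
        show "det (char_mat A (- (c * Re z1 + d * Im z1)) (Re z1) (Im z1)) \<noteq> 0"
          using \<epsilon>(2)[of "Complex c d"] cd f0 by simp
      qed
      then have "ball (Complex a b) (min \<epsilon> \<delta>) \<subseteq> ?\<Lambda>"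
        by (metis complex_surj dist_commute mem_ball subsetI)
      then have "Complex a b \<in> interior ?\<Lambda>"
        using \<epsilon>(1) \<delta> by (intro interiorI[of "ball (Complex a b) (min \<epsilon> \<delta>)"]) auto
      then show False using assms(6) by (simp add: frontier_def)
    qed
    then obtain z0 where z0: "z0 \<noteq> 0" "- \<phi> z0 = L z0" by blast
    \<comment> \<open>The zero set of the homogeneous Kippenhahn polynomial is a cone, and
      \<open>f\<close> has the same zeros. This settles the radial derivative; only the direction
      \<open>\<i> * z0\<close> remains.\<close>
    have ray: "eval3 (\<phi> (of_real r * z0)) (Re (of_real r * z0)) (Im (of_real r * z0)) f = 0" for r
    proof -
      have "eval3 (- L z0) (Re z0) (Im z0) (kippenhahn A) = 0"
        using detL[of z0] eval3_kippenhahn[OF A, of "- L z0" "Re z0" "Im z0"] by simp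
      then have "eval3 (r * (- L z0)) (r * Re z0) (r * Im z0) (kippenhahn A) = 0"
        using eval3_kippenhahn_scale[OF A _ n] by blast
      moreover have "\<phi> (of_real r * z0) = r * (- L z0)" 
        unfolding z0(2)[symmetric] by (simp add: \<phi>_def algebra_simps)
      ultimately show ?thesis
        unfolding f_def eval3_squarefree_red[OF kippenhahn_nonzero[OF A]] by simp
    qed
    have zero: "eval3 (\<phi> z0) (Re z0) (Im z0) f = 0" using ray[of 1] by simp
    have radial: "D (\<phi> z0) z0 z0 = 0"
    proof -
      have "eval3 (\<phi> (z0 + of_real s * z0)) (Re (z0 + of_real s * z0)) (Im (z0 + of_real s * z0)) f = 0" for s
        using ray[of "1 + s"] by (simp add: algebra_simps)
      then show ?thesis by (rule deriv_zero)
    qed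
    have "D (\<phi> z0) z0 (\<i> * z0) = 0"
    proof (rule ccontr)
      assume ne: "D (\<phi> z0) z0 (\<i> * z0) \<noteq> 0"
      \<comment> \<open>The path is affine, perpendicular to \<open>z0\<close>. With level
        \<open>L (p s) + \<phi> (p s)\<close> the first coordinate becomes \<open>- L (p s)\<close>,
        so vanishing of \<open>f\<close> there is the eigenvalue equation
        \<open>detL\<close>.\<close>
      define p where "p s = z0 + of_real s * (\<i> * z0)" for s
      show False
      proof (rule no_minimum_of_implicit_function)
        show "((\<lambda>s. eval3 (\<phi> (p s) - u) (Re (p s)) (Im (p s)) f) has_real_derivative
            D (\<phi> (p s) - u) (p s) (\<i> * z0)) (at s)" for u s
          unfolding p_def by (rule deriv)
        show "((\<lambda>q. D (\<phi> (p (snd q)) - fst q) (p (snd q)) (\<i> * z0)) \<longlongrightarrow>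
            D (\<phi> (p 0) - 0) (p 0) (\<i> * z0)) (nhds (0, 0))"
        proof -
          have fst: "(fst \<longlongrightarrow> (0::real)) (nhds (0::real, 0::real))"
            and snd: "(snd \<longlongrightarrow> (0::real)) (nhds (0::real, 0::real))"
            using tendsto_fst[OF filterlim_ident, of "(0::real, 0::real)"]
              tendsto_snd[OF filterlim_ident, of "(0::real, 0::real)"] by simp_all
          show ?thesis unfolding D_def ft_def fx_def fy_def \<phi>_def p_def
            by (intro tendsto_intros tendsto_eval3 fst snd)
        qed
        show "D (\<phi> (p 0) - 0) (p 0) (\<i> * z0) \<noteq> 0" using ne by (simp add: p_def)
        show "continuous_on UNIV (\<lambda>s. L (p s) + \<phi> (p s))"
          unfolding p_def \<phi>_def by (intro continuous_intros continuous_on_compose2[OF contL]) auto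
        show "L (p 0) + \<phi> (p 0) = 0" using z0(2) by (simp add: p_def)
        show "0 \<le> L (p s) + \<phi> (p s)" for s using le[of "p s"] by simp
        show "eval3 (\<phi> (p s) - (L (p s) + \<phi> (p s))) (Re (p s)) (Im (p s)) f = 0" for s
          using detL[of "p s"] by (simp add: f0)
      qed
    qed
    then show ?thesis using critical z0(1) zero radial by blast
  qed
qed

end
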